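(* Let $X$ be a sigma-finite measure space with measure denoted $dx$, let $t$ and $t_A$ be closed non-negative quadratic forms in $L^2(X)$, and let $T_A$ be the self-adjoint operator corresponding to $t_A$. Assume that $t_A$ satisfies a diamagnetic inequality with respect to $t$. (a) Let $1<\kappa<\infty$ and $q=2\kappa/(\kappa-1)$. Assume that $t$ satisfies the generalized Beurling--Deny conditions with parameter $\kappa$ and that there is a constant $S>0$ such that for all $u\in\mathrm{dom}\,t$, $$ t[u]\geq S\left(\int_X|u|^q\,dx\right)^{2/q}. $$ Then for all $0\leq V\in L^\kappa(X)$, $$ N(0,T_A-V)\ \leq\ e^{\kappa-1}S^{-\kappa}\int_X V^\kappa\,dx. $$ (b) Let $\kappa,\gamma\in(0,\infty)$ with $\gamma+\kappa>1$, and let $q=\frac{2(\gamma+\kappa)}{\gamma+\kappa-1}$ and $\theta=\frac{\kappa}{\gamma+\kappa}$. Assume that $t$ satisfies the generalized Beurling--Deny conditions with parameter $\gamma+\kappa$ and that there is a constant $S>0$ such that for all $u\in\mathrm{dom}\,t$, $$ t[u]^\theta\,\|u\|^{2(1-\theta)}\geq S\left(\int_X|u|^q\,dx\right)^{2/q}. $$ Then for all $0\leq V\in L^{\gamma+\kappa}(X)$ and all $\tau>0$, $$ N(-\tau,T_A-V)\ \leq\ e^{\gamma+\kappa-1}\left(\theta^{-\theta}(1-\theta)^{-1+\theta}S\right)^{-\gamma-\kappa}\,\tau^{-\gamma}\int_X V^{\gamma+\kappa}\,dx. $$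
   Context: $L^2(X)$ is the complex Hilbert space of square-integrable functions with respect to $dx$, with norm $\|\cdot\|$; $L^p(X)$ is the usual $L^p$ space, and for a non-negative function $w$ on $X$, $L^p(X,w)$ is the $L^p$ space with respect to the measure $w(x)\,dx$. The forms $t$, $t_A$ are densely defined with domains $\mathrm{dom}\,t$, $\mathrm{dom}\,t_A$. $t[\cdot,\cdot]$ and $t_A[\cdot,\cdot]$ denote the associated sesquilinear forms, anti-linear in the first and linear in the second argument. Diamagnetic inequality: $t_A$ satisfies a diamagnetic inequality with respect to $t$ if for any $u\in\mathrm{dom}\,t_A$ and $v\in\mathrm{dom}\,t$ with $0\leq v\leq|u|$ one has $|u|\in\mathrm{dom}\,t$, $v\,\mathrm{sgn}\,u\in\mathrm{dom}\,t_A$ and $$ t[v,|u|]\leq \mathrm{Re}\; t_A[v\,\mathrm{sgn}\,u,\,u], $$ where $\mathrm{sgn}\,u(x):=u(x)/|u(x)|$ if $u(x)\neq0$ and $\mathrm{sgn}\,u(x):=0$ if $u(x)=0$. Generalized Beurling--Deny conditions with parameter $p\in(1,\infty)$: (i) if $u,v\in\mathrm{dom}\,t$ are real-valued then $t[u+iv]=t[u]+t[v]$; (ii) if $u\in\mathrm{dom}\,t$ is real-valued then $|u|\in\mathrm{dom}\,t$ and $t[|u|]\leq t[u]$; (iii) there is a measurable, a.e. positive function $\omega$ on $X$ such that if $u\in\mathrm{dom}\,t$ is non-negative then $\min(u,\omega)\in\mathrm{dom}\,t$ and $t[\min(u,\omega)]\leq t[u]$; moreover, there is a form core $\mathcal Q$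 of $t$ such that $\omega^{-1}\mathcal Q$ is dense in $L^2(X,\omega^{2p/(p-1)})$. For $\tau\geq0$, $N(-\tau,T_A-V)$ denotes the number of eigenvalues of the operator $T_A-V$ less than $-\tau$, counted with multiplicity. The operator $T_A-V$ is understood in the sense of quadratic forms, and by the variational principle $N(-\tau,T_A-V)$ is the supremum of $\dim M$ over subspaces $M\subset\mathrm{dom}\,t_A$ such that $t_A[u]+\tau\int_X|u|^2\,dx<\int_X V|u|^2\,dx$ for all $0\neq u\in M$. *)

theory Defs
  imports "HOL-Analysis.Analysis"
begin

(* Elements of Lebesgue spaces are represented by measurable functions. Identification of
   functions that agree almost everywhere is imposed explicitly wherever it matters. *)

definition Lp_space :: "'a measure \<Rightarrow> real \<Rightarrow> ('a \<Rightarrow> 'b::real_normed_vector) set" where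
  "Lp_space M p = {f \<in> borel_measurable M. integrable M (\<lambda>x. norm (f x) powr p)}"

definition Lp_norm :: "'a measure \<Rightarrow> real \<Rightarrow> ('a \<Rightarrow> 'b::real_normed_vector) \<Rightarrow> real" where
  "Lp_norm M p f = (\<integral>x. norm (f x) powr p \<partial>M) powr (1 / p)"

definition L2_inner :: "'a measure \<Rightarrow> ('a \<Rightarrow> complex) \<Rightarrow> ('a \<Rightarrow> complex) \<Rightarrow> complex" where
  "L2_inner M u v = (\<integral>x. cnj (u x) * v x \<partial>M)"

definition dense_in_L2 :: "'a measure \<Rightarrow> ('a \<Rightarrow> complex) set \<Rightarrow> bool" where
  "dense_in_L2 M A \<longleftrightarrow> A \<subseteq> Lp_space M 2 \<and>
     (\<forall>f\<in>Lp_space M 2. \<forall>e>0. \<exists>g\<in>A. Lp_norm M 2 (\<lambda>x. f x - g x) < e)"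

definition fun_subspace :: "('a \<Rightarrow> complex) set \<Rightarrow> bool" where
  "fun_subspace W \<longleftrightarrow> (\<lambda>x. 0) \<in> W \<and>
     (\<forall>u\<in>W. \<forall>v\<in>W. (\<lambda>x. u x + v x) \<in> W) \<and>
     (\<forall>c. \<forall>u\<in>W. (\<lambda>x. c * u x) \<in> W)"

(* For a subspace W of functions, the complex dimension of its image in the quotient by
   functions vanishing almost everywhere. *)
definition ae_dim :: "'a measure \<Rightarrow> ('a \<Rightarrow> complex) set \<Rightarrow> enat" where
  "ae_dim M W = Sup {enat n | n. \<exists>u :: nat \<Rightarrow> 'a \<Rightarrow> complex. (\<forall>i<n. u i \<in> W) \<and>
     (\<forall>c. (AE x in M. (\<Sum>i<n. c i * u i x) = 0) \<longrightarrow> (\<forall>i<n. c i = 0))}"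

(* A form is given by its domain and its sesquilinear form, anti-linear in the first and
   linear in the second argument; values outside the domain are irrelevant. *)
record 'a form =
  form_dom :: "('a \<Rightarrow> complex) set"
  sesq :: "('a \<Rightarrow> complex) \<Rightarrow> ('a \<Rightarrow> complex) \<Rightarrow> complex"

definition quad :: "'a form \<Rightarrow> ('a \<Rightarrow> complex) \<Rightarrow> real" where
  "quad t u = Re (sesq t u u)"

definition form_norm :: "'a measure \<Rightarrow> 'a form \<Rightarrow> ('a \<Rightarrow> complex) \<Rightarrow> real" where
  "form_norm M t u = sqrt (quad t u + (Lp_norm M 2 u)\<^sup>2)"

(* Non-negative, densely defined forms in L^2; the third and fourth conditions say that the
   domain and the form are well defined on almost-everywhere classes. *)
definition nonneg_form :: "'a measure \<Rightarrow> 'a form \<Rightarrow> bool" where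
  "nonneg_form M t \<longleftrightarrow>
     fun_subspace (form_dom t) \<and>
     dense_in_L2 M (form_dom t) \<and>
     (\<forall>u\<in>form_dom t. \<forall>v\<in>borel_measurable M. (AE x in M. u x = v x) \<longrightarrow> v \<in> form_dom t) \<and>
     (\<forall>u\<in>form_dom t. \<forall>u'\<in>form_dom t. \<forall>v\<in>form_dom t.
        (AE x in M. u x = u' x) \<longrightarrow> sesq t u v = sesq t u' v) \<and>
     (\<forall>u\<in>form_dom t. \<forall>v\<in>form_dom t. \<forall>w\<in>form_dom t.
        sesq t u (\<lambda>x. v x + w x) = sesq t u v + sesq t u w) \<and>
     (\<forall>c. \<forall>u\<in>form_dom t. \<forall>v\<in>form_dom t. sesq t u (\<lambda>x. c * v x) = c * sesq t u v) \<and>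
     (\<forall>u\<in>form_dom t. \<forall>v\<in>form_dom t. sesq t v u = cnj (sesq t u v)) \<and>
     (\<forall>u\<in>form_dom t. 0 \<le> quad t u)"

definition closed_form :: "'a measure \<Rightarrow> 'a form \<Rightarrow> bool" where
  "closed_form M t \<longleftrightarrow>
     (\<forall>u :: nat \<Rightarrow> 'a \<Rightarrow> complex. (\<forall>n. u n \<in> form_dom t) \<longrightarrow>
        (\<forall>e>0. \<exists>N. \<forall>m\<ge>N. \<forall>n\<ge>N. form_norm M t (\<lambda>x. u m x - u n x) < e) \<longrightarrow>
        (\<exists>v\<in>form_dom t. (\<lambda>n. form_norm M t (\<lambda>x. u n x - v x)) \<longlonglongrightarrow> 0))"

definition form_core :: "'a measure \<Rightarrow> 'a form \<Rightarrow> ('a \<Rightarrow> complex) set \<Rightarrow> bool" where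
  "form_core M t Q \<longleftrightarrow> fun_subspace Q \<and> Q \<subseteq> form_dom t \<and>
     (\<forall>u\<in>form_dom t. \<forall>e>0. \<exists>v\<in>Q. form_norm M t (\<lambda>x. u x - v x) < e)"

(* The library's sgn on complex numbers is z / |z|, with sgn 0 = 0. The real part on the
   left-hand side only makes the inequality meaningful: under the first Beurling-Deny
   condition the form is real on real-valued functions. *)
definition diamagnetic :: "'a measure \<Rightarrow> 'a form \<Rightarrow> 'a form \<Rightarrow> bool" where
  "diamagnetic M t tA \<longleftrightarrow>
     (\<forall>u\<in>form_dom tA. \<forall>v :: 'a \<Rightarrow> real.
        (\<lambda>x. complex_of_real (v x)) \<in> form_dom t \<longrightarrow>
        (AE x in M. 0 \<le> v x \<and> v x \<le> cmod (u x)) \<longrightarrow>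
        (\<lambda>x. complex_of_real (cmod (u x))) \<in> form_dom t \<and>
        (\<lambda>x. complex_of_real (v x) * sgn (u x)) \<in> form_dom tA \<and>
        Re (sesq t (\<lambda>x. complex_of_real (v x)) (\<lambda>x. complex_of_real (cmod (u x))))
          \<le> Re (sesq tA (\<lambda>x. complex_of_real (v x) * sgn (u x)) u))"

definition beurling_deny :: "'a measure \<Rightarrow> 'a form \<Rightarrow> real \<Rightarrow> bool" where
  "beurling_deny M t p \<longleftrightarrow>
     (\<forall>u v :: 'a \<Rightarrow> real.
        (\<lambda>x. complex_of_real (u x)) \<in> form_dom t \<longrightarrow>
        (\<lambda>x. complex_of_real (v x)) \<in> form_dom t \<longrightarrow>
        quad t (\<lambda>x. complex_of_real (u x) + \<i> * complex_of_real (v x)) =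
          quad t (\<lambda>x. complex_of_real (u x)) + quad t (\<lambda>x. complex_of_real (v x))) \<and>
     (\<forall>u :: 'a \<Rightarrow> real.
        (\<lambda>x. complex_of_real (u x)) \<in> form_dom t \<longrightarrow>
        (\<lambda>x. complex_of_real \<bar>u x\<bar>) \<in> form_dom t \<and>
        quad t (\<lambda>x. complex_of_real \<bar>u x\<bar>) \<le> quad t (\<lambda>x. complex_of_real (u x))) \<and>
     (\<exists>\<omega> :: 'a \<Rightarrow> real. \<omega> \<in> borel_measurable M \<and> (AE x in M. 0 < \<omega> x) \<and>
        (\<forall>u :: 'a \<Rightarrow> real.
           (\<lambda>x. complex_of_real (u x)) \<in> form_dom t \<longrightarrow> (AE x in M. 0 \<le> u x) \<longrightarrow>
           (\<lambda>x. complex_of_real (min (u x) (\<omega> x))) \<in> form_dom t \<and>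
           quad t (\<lambda>x. complex_of_real (min (u x) (\<omega> x))) \<le> quad t (\<lambda>x. complex_of_real (u x))) \<and>
        (\<exists>Q. form_core M t Q \<and>
           dense_in_L2 (density M (\<lambda>x. ennreal (\<omega> x powr (2 * p / (p - 1)))))
             ((\<lambda>u x. complex_of_real (inverse (\<omega> x)) * u x) ` Q)))"

(* The form t - V, on the functions u in the domain of t for which V |u|^2 is integrable. *)
definition form_minus :: "'a measure \<Rightarrow> 'a form \<Rightarrow> ('a \<Rightarrow> real) \<Rightarrow> 'a form" where
  "form_minus M t V =
     \<lparr>form_dom = {u \<in> form_dom t. integrable M (\<lambda>x. V x * (cmod (u x))\<^sup>2)},
      sesq = (\<lambda>u v. sesq t u v - (\<integral>x. complex_of_real (V x) * (cnj (u x) * v x) \<partial>M))\<rparr>"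

(* Graph of the operator associated with a form by the first representation theorem. *)
definition form_operator :: "'a measure \<Rightarrow> 'a form \<Rightarrow> (('a \<Rightarrow> complex) \<times> ('a \<Rightarrow> complex)) set" where
  "form_operator M t =
     {(u, f). u \<in> form_dom t \<and> f \<in> Lp_space M 2 \<and>
        (\<forall>v\<in>form_dom t. sesq t v u = L2_inner M v f)}"

definition eigenspace ::
    "(('a \<Rightarrow> complex) \<times> ('a \<Rightarrow> complex)) set \<Rightarrow> real \<Rightarrow> ('a \<Rightarrow> complex) set" where
  "eigenspace T l = {u. (u, \<lambda>x. complex_of_real l * u x) \<in> T}"

(* Number of eigenvalues of T below a, counted with multiplicity: only eigenvalues have an
   eigenspace of non-zero dimension. *)
definition eigenvalues_below ::
    "'a measure \<Rightarrow> (('a \<Rightarrow> complex) \<times> ('a \<Rightarrow> complex)) set \<Rightarrow> real \<Rightarrow> ennreal" where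
  "eigenvalues_below M T a = (\<Sum>\<^sub>\<infinity>l\<in>{..<a}. ennreal_of_enat (ae_dim M (eigenspace T l)))"

(* The number of eigenvalues of T - V below -\<tau>, as given by the variational principle. Unlike the
   eigenvalue count it also detects essential spectrum below -\<tau>. The right-hand integral is
   taken in [0, \<infinity>]; V is meant to be non-negative and \<tau> \<ge> 0. *)
definition variational_count :: "'a measure \<Rightarrow> 'a form \<Rightarrow> ('a \<Rightarrow> real) \<Rightarrow> real \<Rightarrow> enat" where
  "variational_count M t V \<tau> =
     Sup {ae_dim M W | W. fun_subspace W \<and> W \<subseteq> form_dom t \<and>
       (\<forall>u\<in>W. \<not> (AE x in M. u x = 0) \<longrightarrow>
          ennreal (quad t u + \<tau> * (\<integral>x. (cmod (u x))\<^sup>2 \<partial>M))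
            < (\<integral>\<^sup>+x. ennreal (V x * (cmod (u x))\<^sup>2) \<partial>M))}"

end

theory Submission
  imports Defs "HOL-Real_Asymp.Real_Asymp"
begin

text \<open>The argument is a discrete version of the heat kernel method of Li and Yau. It works with resolvents instead of the heat
semigroup, and with a finite matrix instead of an integral kernel, so that neither the existence of kernels nor the spectral
theorem is needed.

Formally, let \<open>\<Upsilon>\<close> be the operator of the form \<open>t\<close> in \<open>L\<^sup>2(V dx)\<close>; the negative eigenvalues of \<open>T - V\<close> correspond to the
eigenvalues of \<open>\<Upsilon>\<close> below 1. Let \<open>H\<close> be the kernel of \<open>exp (- s\<Upsilon> / 2)\<close>, which is nonnegative, and put
\<open>p(s) = Tr \<Upsilon>\<^sup>-\<^sup>1 exp (- s\<Upsilon>)\<close>, so that \<open>- p'(s) = Tr exp (- s\<Upsilon>)\<close>. By duality the Sobolev inequality reads \<open>\<langle>f, \<Upsilon>\<^sup>-\<^sup>1 f\<rangle> \<le> S\<^sup>-\<^sup>1 \<parallel>V f\<parallel>\<^sup>2\<close> with the norm of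
\<open>L\<^sup>r\<close> on the right, \<open>r = q/(q-1)\<close>. One applies it to \<open>f = H(x, \<cdot>)\<close>, interpolates the norm between \<open>\<integral> V f\<^sup>2\<close> and
\<open>\<integral> f V\<^bsup>(\<kappa>+1)/2\<^esup>\<close>, and integrates over \<open>x\<close>. Since \<open>exp (- s\<Upsilon> / 2)\<close> is a contraction, the result is
\<open>p \<le> S\<^sup>-\<^sup>1 (\<integral> V\<^sup>\<kappa>)\<^bsup>1/\<kappa>\<^esup> (- p')\<^bsup>1-1/\<kappa>\<^esup>\<close>. Integrating this differential inequality gives
\<open>p(s) \<le> S\<^sup>-\<^sup>\<kappa> ((\<kappa>-1)/s)\<^bsup>\<kappa>-1\<^esup> \<integral> V\<^sup>\<kappa>\<close>. As an eigenvalue below 1 contributes at least \<open>exp (- s)\<close> to \<open>p(s)\<close>, the choice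
\<open>s = \<kappa> - 1\<close> yields the bound. The form \<open>t\<^sub>A\<close> enters through the entrywise domination of its resolvents by those of \<open>t\<close>, by
which the traces for \<open>t\<^sub>A\<close> are bounded by those for \<open>t\<close>.

To make this rigorous, given \<open>N\<close> functions in the domain of \<open>t\<^sub>A\<close> that are orthonormal in \<open>L\<^sup>2(V dx)\<close> and at which the form is at most 1,
the resolvents \<open>(1 + \<epsilon> \<Upsilon>)\<^sup>-\<^sup>1\<close> are compressed to the span of finitely many functions with disjoint supports.
Powers of the resulting matrix \<open>\<rho>\<close> take the place of the semigroup: \<open>dual_sobolev\<close> and \<open>hs_power_sum_le\<close> are the dual Sobolev inequality
and its sum over columns, \<open>nash_iteration\<close> is the differential inequality and \<open>nash_limit\<close> the limit \<open>\<epsilon> \<rightarrow> 0\<close>.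
The number of basis functions grows as \<open>\<epsilon> \<rightarrow> 0\<close>, but only polynomially, and it enters the estimate only through its
power with an exponent of order \<open>\<epsilon>\<close>. Positivity and domination of the resolvents are \<open>real_resolvent_nonneg\<close> and \<open>magnetic_resolvent_dominated\<close>; the outcome is
\<open>orthonormal_family_bound\<close>, which \<open>variational_count_le\<close> and \<open>eigenvalues_below_le\<close> turn into the bounds on the two counting functions.\<close>

section \<open>Convexity inequalities\<close>

lemma weighted_am_gm3:
  fixes x y z a b c :: real
  assumes "0 \<le> x" "0 \<le> y" "0 \<le> z" "0 < a" "0 < b" "0 < c" "a + b + c = 1"
  shows "x powr a * y powr b * z powr c \<le> a * x + b * y + c * z"
proof (cases "x = 0 \<or> y = 0 \<or> z = 0")
  case True
  moreover have "0 \<le> a * x + b * y + c * z" using assms by simp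
  ultimately show ?thesis by auto
next
  case False
  then have pos: "0 < x" "0 < y" "0 < z" using assms by auto
  have "x powr a * y powr b = (x powr (a/(a+b)) * y powr (b/(a+b))) powr (a + b)"
    using pos assms by (simp add: powr_mult powr_powr)
  also have "\<dots> \<le> (a/(a+b) * x + b/(a+b) * y) powr (a + b)"
    using pos assms
    by (intro powr_mono2 Youngs_inequality_0) (auto simp: divide_simps)
  finally have 1: "x powr a * y powr b \<le> (a/(a+b) * x + b/(a+b) * y) powr (a + b)" .
  have p: "0 < a/(a+b) * x + b/(a+b) * y"
    using pos assms by (simp add: add_pos_pos)
  have "x powr a * y powr b * z powr c \<le> (a/(a+b) * x + b/(a+b) * y) powr (a + b) * z powr c"
    using 1 by (intro mult_right_mono) auto
  also have "\<dots> \<le> (a + b) * (a/(a+b) * x + b/(a+b) * y) + c * z"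
    using Youngs_inequality_0[of "a + b" c] p pos assms by auto
  also have "(a + b) * (a/(a+b) * x + b/(a+b) * y) = a * x + b * y"
    using assms by (simp add: distrib_left)
  finally show ?thesis .
qed

text \<open>Three exponents are convenient: the pairing of a resolvent with a combination of basis functions below is a product of powers of three integrable functions.\<close>

lemma holder3:
  fixes F G H :: "'a \<Rightarrow> real"
  assumes F: "integrable M F" "\<And>x. 0 \<le> F x" and G: "integrable M G" "\<And>x. 0 \<le> G x"
    and H: "integrable M H" "\<And>x. 0 \<le> H x"
    and abc: "0 < a" "0 < b" "0 < c" "a + b + c = 1"
  shows "integrable M (\<lambda>x. F x powr a * G x powr b * H x powr c)" (is ?I)
    and "(\<integral>x. F x powr a * G x powr b * H x powr c \<partial>M)
           \<le> (\<integral>x. F x \<partial>M) powr a * (\<integral>x. G x \<partial>M) powr b * (\<integral>x. H x \<partial>M) powr c" (is ?L)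
proof -
  let ?P = "\<lambda>x. F x powr a * G x powr b * H x powr c"
  have meas[measurable]: "F \<in> borel_measurable M" "G \<in> borel_measurable M" "H \<in> borel_measurable M"
    using F G H by auto
  show I: ?I
  proof (rule Bochner_Integration.integrable_bound)
    show "integrable M (\<lambda>x. a * F x + b * G x + c * H x)" using F G H by auto
    show "AE x in M. norm (?P x) \<le> norm (a * F x + b * G x + c * H x)"
      using weighted_am_gm3[of "F _" "G _" "H _" a b c] F(2) G(2) H(2) abc
      by (intro AE_I2) (auto simp: abs_mult intro: order_trans)
  qed measurable
  define X Y Z where "X = (\<integral>x. F x \<partial>M)" "Y = (\<integral>x. G x \<partial>M)" "Z = (\<integral>x. H x \<partial>M)"
  have nn: "0 \<le> X" "0 \<le> Y" "0 \<le> Z" unfolding X_Y_Z_def using F G H by auto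
  show ?L
  proof (cases "X = 0 \<or> Y = 0 \<or> Z = 0")
    case True
    then have "AE x in M. ?P x = 0"
    proof (elim disjE)
      assume "X = 0"
      then have "AE x in M. F x = 0"
        using integral_nonneg_eq_0_iff_AE[OF F(1)] F(2) by (auto simp: X_Y_Z_def)
      then show ?thesis by eventually_elim simp
    next
      assume "Y = 0"
      then have "AE x in M. G x = 0"
        using integral_nonneg_eq_0_iff_AE[OF G(1)] G(2) by (auto simp: X_Y_Z_def)
      then show ?thesis by eventually_elim simp
    next
      assume "Z = 0"
      then have "AE x in M. H x = 0"
        using integral_nonneg_eq_0_iff_AE[OF H(1)] H(2) by (auto simp: X_Y_Z_def)
      then show ?thesis by eventually_elim simp
    qed
    then have "(\<integral>x. ?P x \<partial>M) = 0" by (subst integral_cong_AE[of _ _ "\<lambda>x. 0"]) auto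
    then show ?thesis by simp
  next
    case False
    then have pos: "0 < X" "0 < Y" "0 < Z" using nn by auto
    define K where "K = X powr a * Y powr b * Z powr c"
    have "(\<integral>x. ?P x \<partial>M) \<le> (\<integral>x. K * (a * (F x / X) + b * (G x / Y) + c * (H x / Z)) \<partial>M)"
    proof (rule integral_mono[OF I])
      show "integrable M (\<lambda>x. K * (a * (F x / X) + b * (G x / Y) + c * (H x / Z)))"
        using F G H by auto
      fix x
      have "?P x = K * ((F x / X) powr a * (G x / Y) powr b * (H x / Z) powr c)"
        using pos F(2)[of x] G(2)[of x] H(2)[of x] by (simp add: K_def powr_divide)
      also have "\<dots> \<le> K * (a * (F x / X) + b * (G x / Y) + c * (H x / Z))"
        using pos F(2)[of x] G(2)[of x] H(2)[of x] abc
        by (intro mult_left_mono weighted_am_gm3) (auto simp: K_def)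
      finally show "?P x \<le> K * (a * (F x / X) + b * (G x / Y) + c * (H x / Z))" .
    qed
    also have "\<dots> = K * (a * (X / X) + b * (Y / Y) + c * (Z / Z))"
      using F G H by (simp add: X_Y_Z_def)
    also have "\<dots> = K" using pos abc by simp
    finally show ?thesis by (simp add: K_def X_Y_Z_def)
  qed
qed

lemma holder2:
  fixes F G :: "'a \<Rightarrow> real"
  assumes F: "integrable M F" "\<And>x. 0 \<le> F x" and G: "integrable M G" "\<And>x. 0 \<le> G x"
    and ab: "0 < a" "0 < b" "a + b = 1"
  shows "integrable M (\<lambda>x. F x powr a * G x powr b)"
    and "(\<integral>x. F x powr a * G x powr b \<partial>M) \<le> (\<integral>x. F x \<partial>M) powr a * (\<integral>x. G x \<partial>M) powr b"
  using holder3[OF F F G, of "a/2" "a/2" b] ab by (simp_all flip: powr_add)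

lemma holder_sum:
  fixes F G :: "'i \<Rightarrow> real"
  assumes "finite I" "\<And>i. 0 \<le> F i" "\<And>i. 0 \<le> G i" "0 < a" "0 < b" "a + b = 1"
  shows "(\<Sum>i\<in>I. F i powr a * G i powr b) \<le> (\<Sum>i\<in>I. F i) powr a * (\<Sum>i\<in>I. G i) powr b"
  using holder2(2)[of "count_space I" F G a b] assms
  by (simp add: lebesgue_integral_count_space_finite integrable_count_space)

section \<open>A discrete differential inequality\<close>

lemma powr_minus_diff_ge:
  fixes y z \<beta> :: real
  assumes "0 < y" "y \<le> z" "0 < \<beta>"
  shows "y powr (-\<beta>) - z powr (-\<beta>) \<ge> \<beta> * z powr (-(\<beta> + 1)) * (z - y)"
proof -
  define w where "w = y / z"
  have w: "0 < w" using assms by (simp add: w_def)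
  have "1 + \<beta> * (1 - w) \<le> 1 + (-\<beta> * ln w)"
    using mult_left_mono[OF ln_le_minus_one[OF w], of \<beta>] assms by (simp add: algebra_simps)
  also have "\<dots> \<le> exp (-\<beta> * ln w)" by (rule exp_ge_add_one_self)
  also have "\<dots> = w powr (-\<beta>)" using w by (simp add: powr_def)
  finally have "z powr (-\<beta>) * (1 + \<beta> * (1 - w)) \<le> z powr (-\<beta>) * w powr (-\<beta>)"
    by (intro mult_left_mono) auto
  also have "\<dots> = y powr (-\<beta>)"
    using assms by (simp add: w_def powr_divide)
  finally have "z powr (-\<beta>) * (\<beta> * (1 - w)) \<le> y powr (-\<beta>) - z powr (-\<beta>)"
    by (simp add: algebra_simps)
  moreover have "z powr (-\<beta>) * (\<beta> * (1 - w)) = \<beta> * z powr (-(\<beta> + 1)) * (z - y)"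
    using assms by (simp add: w_def powr_diff powr_minus field_simps)
  ultimately show ?thesis by simp
qed

text \<open>The tails \<open>y\<^sub>n = h \<Sum>\<^sub>k\<^sub>>\<^sub>n g\<^sub>k\<close> satisfy \<open>y\<^sub>n\<^sup>\<alpha> \<le> C g\<^sub>n\<close> with \<open>C = c\<^sup>\<alpha>\<close>, and \<open>y\<^sub>n\<^sub>-\<^sub>1 - y\<^sub>n = h g\<^sub>n\<close>: this is
a discrete form of \<open>- y' \<ge> y\<^sup>\<alpha> / C\<close>. The continuous inequality gives \<open>y\<^sup>-\<^sup>\<beta> \<ge> \<beta> t / C\<close>
whatever the initial value is. In the discrete version the increments of
\<open>y\<^sup>-\<^sup>\<beta>\<close> are only bounded below by a multiple of \<open>(y\<^sub>n / y\<^sub>n\<^sub>-\<^sub>1)\<^sup>\<alpha>\<close>, and the arithmetic-geometric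
mean inequality turns their sum into \<open>n (y\<^sub>n / y\<^sub>0)\<^bsup>\<alpha>/n\<^esup>\<close>. The initial value therefore enters
only through \<open>(C g\<^sub>0)\<^bsup>1/n\<^esup>\<close>, which tends to 1 as long as \<open>g\<^sub>0\<close> grows polynomially in \<open>n\<close>.\<close>

lemma nash_iteration:
  fixes g :: "nat \<Rightarrow> real" and \<kappa> c h N r :: real
  assumes \<kappa>: "1 < \<kappa>" and c: "0 < c" and h: "0 < h" and N: "0 < N" and r: "0 < r" "r < 1"
    and g0: "\<And>k. 0 \<le> g k"
    and lower: "\<And>k. 1 \<le> k \<Longrightarrow> N * r ^ (2 * k) \<le> g k"
    and upper: "\<And>n K. h * (\<Sum>k<K. g (k + n + 1)) \<le> c * g n powr (1 - 1 / \<kappa>)"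
    and n: "1 \<le> n"
  defines "\<alpha> \<equiv> \<kappa> / (\<kappa> - 1)" and "\<beta> \<equiv> 1 / (\<kappa> - 1)"
  shows "(h * N * r ^ (2 * n + 2) / (1 - r\<^sup>2)) powr (\<beta> + \<alpha> / real n)
           \<le> c powr \<alpha> / (h * \<beta> * real n) * (c powr \<alpha> * g 0) powr (1 / real n)"
proof -
  define C where "C = c powr \<alpha>"
  have C: "0 < C" using c by (simp add: C_def)
  have \<alpha>\<beta>: "\<alpha> = \<beta> + 1" "0 < \<beta>" "0 < \<alpha>" "(1 - 1 / \<kappa>) * \<alpha> = 1"
    using \<kappa> by (auto simp: \<alpha>_def \<beta>_def field_simps)
  have sm: "summable (\<lambda>k. g (k + n + 1))" for n
  proof (rule summableI_nonneg_bounded)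
    show "(\<Sum>k<K. g (k + n + 1)) \<le> c * g n powr (1 - 1 / \<kappa>) / h" for K
      using upper[where K=K and n=n] h by (simp add: field_simps)
  qed (use g0 in auto)
  define y where "y = (\<lambda>n. h * (\<Sum>k. g (k + n + 1)))"
  have step: "y n - y (Suc n) = h * g (Suc n)" for n
    using suminf_split_head[OF sm[of n]] by (simp add: y_def flip: right_diff_distrib)
  have y_up: "y n \<le> c * g n powr (1 - 1 / \<kappa>)" for n
  proof -
    have "(\<Sum>k. g (k + n + 1)) \<le> c * g n powr (1 - 1 / \<kappa>) / h"
      using upper[where n=n] h by (intro suminf_le_const[OF sm]) (simp add: field_simps)
    then show ?thesis using h by (simp add: y_def field_simps)
  qed
  have r2: "0 < r\<^sup>2" "r\<^sup>2 < 1" using r by (auto simp: power_less_one_iff)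
  have y_low: "h * N * r ^ (2 * n + 2) / (1 - r\<^sup>2) \<le> y n" for n
  proof -
    have geo: "(\<lambda>k. N * r ^ (2 * n + 2) * (r\<^sup>2) ^ k) sums (N * r ^ (2 * n + 2) * (1 / (1 - r\<^sup>2)))"
      using r2 by (intro sums_mult geometric_sums) auto
    have "N * r ^ (2 * n + 2) * (1 / (1 - r\<^sup>2)) = (\<Sum>k. N * r ^ (2 * n + 2) * (r\<^sup>2) ^ k)"
      using geo by (rule sums_unique)
    also have "\<dots> \<le> (\<Sum>k. g (k + n + 1))"
    proof (rule suminf_le[OF _ sums_summable[OF geo] sm])
      fix k
      have "2 * (k + n + 1) = (2 * n + 2) + 2 * k" by simp
      then have "N * r ^ (2 * n + 2) * (r\<^sup>2) ^ k = N * r ^ (2 * (k + n + 1))"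
        by (simp only: power_add power_mult mult.assoc)
      from ord_eq_le_trans[OF this lower]
      show "N * r ^ (2 * n + 2) * (r\<^sup>2) ^ k \<le> g (k + n + 1)" by simp
    qed
    finally have "h * (N * r ^ (2 * n + 2) * (1 / (1 - r\<^sup>2))) \<le> y n"
      unfolding y_def using h by (intro mult_left_mono) auto
    then show ?thesis by (simp add: mult.assoc)
  qed
  have y_pos: "0 < y n" for n
    using y_low[of n] h N r r2 by (smt (verit) divide_pos_pos mult_pos_pos zero_less_power)
  have y_dec: "y (Suc n) \<le> y n" for n
    using step[of n] g0[of "Suc n"] h by (smt (verit) mult_nonneg_nonneg)
  have y_pow: "y n powr \<alpha> \<le> C * g n" for n
  proof -
    have "y n powr \<alpha> \<le> (c * g n powr (1 - 1 / \<kappa>)) powr \<alpha>"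
      using y_up[of n] y_pos[of n] \<alpha>\<beta> by (intro powr_mono2) auto
    also have "\<dots> = C * g n"
      using c g0[of n] \<alpha>\<beta> by (simp add: powr_mult powr_powr C_def)
    finally show ?thesis .
  qed
  define K where "K = h * \<beta> / C"
  have K: "0 < K" using h \<alpha>\<beta> C by (simp add: K_def)
  have incr: "y (Suc k) powr (-\<beta>) - y k powr (-\<beta>) \<ge> K * (y (Suc k) / y k) powr \<alpha>" for k
  proof -
    have "K * (y (Suc k) / y k) powr \<alpha> = \<beta> * y k powr (-(\<beta> + 1)) * (h * (y (Suc k) powr \<alpha> / C))"
      using y_pos[of k] y_pos[of "Suc k"] unfolding K_def powr_minus
      by (simp add: powr_divide field_simps \<alpha>\<beta>(1))
    also have "\<dots> \<le> \<beta> * y k powr (-(\<beta> + 1)) * (h * g (Suc k))"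
      using y_pow[of "Suc k"] C h \<alpha>\<beta> by (intro mult_left_mono) (auto simp: field_simps)
    also have "\<dots> = \<beta> * y k powr (-(\<beta> + 1)) * (y k - y (Suc k))" by (simp add: step)
    also have "\<dots> \<le> y (Suc k) powr (-\<beta>) - y k powr (-\<beta>)"
      using powr_minus_diff_ge[OF y_pos y_dec] \<alpha>\<beta> by auto
    finally show ?thesis .
  qed
  have tel: "(\<Sum>k<m. K * (y (Suc k) / y k) powr \<alpha>) \<le> y m powr (-\<beta>)" for m
  proof -
    have "(\<Sum>k<m. K * (y (Suc k) / y k) powr \<alpha>) \<le> (\<Sum>k<m. y (Suc k) powr (-\<beta>) - y k powr (-\<beta>))"
      using incr by (intro sum_mono) auto
    also have "\<dots> = y m powr (-\<beta>) - y 0 powr (-\<beta>)"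
      by (rule sum_lessThan_telescope)
    finally show ?thesis by (smt (verit) powr_ge_zero)
  qed
  have prod: "(\<Prod>k<m. (y (Suc k) / y k) powr \<alpha>) = (y m / y 0) powr \<alpha>" for m
  proof (induction m)
    case (Suc m)
    then show ?case using y_pos[of m] y_pos[of "Suc m"] y_pos[of 0]
      by (simp add: powr_divide field_simps)
  qed (use y_pos[of 0] in auto)
  have "((y n / y 0) powr \<alpha>) powr (1 / real n) \<le> (\<Sum>k<n. (y (Suc k) / y k) powr \<alpha> / real n)"
  proof -
    have "{..<n} \<noteq> {}" using n by (auto simp: lessThan_empty_iff)
    from arith_geom_mean[OF finite_lessThan this, of "\<lambda>k. (y (Suc k) / y k) powr \<alpha>"]
    show ?thesis by (simp only: prod card_lessThan powr_ge_zero simp_thms)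
  qed
  then have "K * real n * ((y n / y 0) powr \<alpha>) powr (1 / real n)
      \<le> K * real n * (\<Sum>k<n. (y (Suc k) / y k) powr \<alpha> / real n)"
    using K by (intro mult_left_mono) auto
  also have "\<dots> = (\<Sum>k<n. K * (y (Suc k) / y k) powr \<alpha>)"
    using n by (simp add: sum_distrib_left)
  also have "\<dots> \<le> y n powr (-\<beta>)" by (rule tel)
  finally have main: "K * real n * (y n / y 0) powr (\<alpha> / real n) \<le> y n powr (-\<beta>)"
    by (simp add: powr_powr)
  have "y n powr (\<beta> + \<alpha> / real n) = y n powr \<beta> * (y n / y 0) powr (\<alpha> / real n) * y 0 powr (\<alpha> / real n)"
    using y_pos[of n] y_pos[of 0] by (simp add: powr_add powr_divide)
  also have "\<dots> \<le> y n powr \<beta> * (y n powr (-\<beta>) / (K * real n)) * y 0 powr (\<alpha> / real n)"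
    using main K n by (intro mult_right_mono mult_left_mono) (auto simp: field_simps)
  also have "\<dots> = 1 / (K * real n) * (y 0 powr \<alpha>) powr (1 / real n)"
    using y_pos[of n] by (simp add: powr_minus powr_powr)
  also have "\<dots> \<le> 1 / (K * real n) * (C * g 0) powr (1 / real n)"
    using y_pow[of 0] K n by (intro mult_left_mono powr_mono2) auto
  also have "1 / (K * real n) = C / (h * \<beta> * real n)" by (simp add: K_def)
  finally have fin: "y n powr (\<beta> + \<alpha> / real n) \<le> C / (h * \<beta> * real n) * (C * g 0) powr (1 / real n)" .
  have "0 \<le> h * N * r ^ (2 * n + 2) / (1 - r\<^sup>2)"
    using h N r r2 by (intro divide_nonneg_nonneg mult_nonneg_nonneg) auto
  moreover have "0 \<le> \<beta> + \<alpha> / real n" using \<alpha>\<beta> by simp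
  ultimately have "(h * N * r ^ (2 * n + 2) / (1 - r\<^sup>2)) powr (\<beta> + \<alpha> / real n) \<le> y n powr (\<beta> + \<alpha> / real n)"
    using y_low[of n] by (intro powr_mono2)
  with fin show ?thesis by (simp add: C_def)
qed

text \<open>The conclusion of the iteration with step \<open>h = 2\<epsilon>\<close>, where \<open>\<epsilon>\<close> is chosen such that
\<open>h \<beta> n = 1\<close>, and with \<open>g\<^sub>0\<close> bounded by a polynomial. The factor \<open>r\<^bsup>2n+2\<^esup>\<close> converges to
\<open>exp (1 - \<kappa>)\<close>, which is where the constant \<open>exp (\<kappa> - 1)\<close> comes from.\<close>

lemma nash_limit:
  fixes \<kappa> c N J B :: real
  assumes \<kappa>: "1 < \<kappa>" and c: "0 < c" and N: "0 < N" and J: "0 \<le> J" and B: "0 \<le> B"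
    and ev: "\<forall>\<^sub>F n in sequentially. 
      (let \<epsilon> = (\<kappa> - 1) / (2 * real n); r = 1 - \<epsilon> - B / (real n)\<^sup>2 in
       (2 * \<epsilon> * N * r ^ (2 * n + 2) / (1 - r\<^sup>2)) powr (1 / (\<kappa> - 1) + \<kappa> / (\<kappa> - 1) / real n)
           \<le> c powr (\<kappa> / (\<kappa> - 1)) * (c powr (\<kappa> / (\<kappa> - 1)) * (2 * real n + 1) powr J) powr (1 / real n))"
  shows "N \<le> exp (\<kappa> - 1) * c powr \<kappa>"
proof -
  define d where "d = \<kappa> - 1"
  have d: "0 < d" using \<kappa> by (simp add: d_def)
  define C where "C = c powr (\<kappa> / d)"
  have C: "0 < C" using c by (simp add: C_def)
  have l1: "(\<lambda>n. 2 * (d / (2 * real n)) / (1 - (1 - d / (2 * real n) - B / (real n)\<^sup>2)\<^sup>2)) \<longlonglongrightarrow> 1"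
    using d B by real_asymp
  have l2: "(\<lambda>n. (1 - d / (2 * real n) - B / (real n)\<^sup>2) ^ (2 * n + 2)) \<longlonglongrightarrow> exp (- d)"
    using d B by real_asymp
  have l3: "(\<lambda>n. (C * (2 * real n + 1) powr J) powr (1 / real n)) \<longlonglongrightarrow> 1"
    using C J by real_asymp
  have l4: "(\<lambda>n. 1 / d + \<kappa> / d / real n) \<longlonglongrightarrow> 1 / d"
    by real_asymp
  have lim1: "(\<lambda>n. (2 * (d / (2 * real n)) / (1 - (1 - d / (2 * real n) - B / (real n)\<^sup>2)\<^sup>2)
       * N * (1 - d / (2 * real n) - B / (real n)\<^sup>2) ^ (2 * n + 2)) powr (1 / d + \<kappa> / d / real n))
     \<longlonglongrightarrow> (1 * N * exp (- d)) powr (1 / d)"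
    using N by (intro tendsto_powr tendsto_mult l1 l2 l4 tendsto_const) auto
  have lim2: "(\<lambda>n. C * (C * (2 * real n + 1) powr J) powr (1 / real n)) \<longlonglongrightarrow> C * 1"
    by (intro tendsto_mult l3 tendsto_const)
  have "(1 * N * exp (- d)) powr (1 / d) \<le> C * 1"
  proof (rule tendsto_le[OF sequentially_bot lim2 lim1])
    show "\<forall>\<^sub>F n in sequentially. (2 * (d / (2 * real n)) / (1 - (1 - d / (2 * real n) - B / (real n)\<^sup>2)\<^sup>2)
       * N * (1 - d / (2 * real n) - B / (real n)\<^sup>2) ^ (2 * n + 2)) powr (1 / d + \<kappa> / d / real n)
      \<le> C * (C * (2 * real n + 1) powr J) powr (1 / real n)"
      using ev by eventually_elim (simp add: Let_def C_def mult_ac flip: d_def)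
  qed
  then have "((N * exp (- d)) powr (1 / d)) powr d \<le> C powr d"
    using d by (intro powr_mono2) auto
  then have "N * exp (- d) \<le> c powr \<kappa>"
    using d N by (simp add: powr_powr C_def)
  then show ?thesis using d by (simp add: exp_minus field_simps flip: d_def)
qed

section \<open>Iterates of nonnegative and of Hermitian matrices\<close>

text \<open>The product of a matrix and a vector, both indexed by \<open>I\<close>.\<close>

definition mv :: "'i set \<Rightarrow> ('i \<Rightarrow> 'i \<Rightarrow> 'c::comm_ring_1) \<Rightarrow> ('i \<Rightarrow> 'c) \<Rightarrow> 'i \<Rightarrow> 'c" where
  "mv I A x = (\<lambda>i. \<Sum>k\<in>I. A i k * x k)"

text \<open>Column \<open>j\<close> of the \<open>n\<close>-th power of a matrix.\<close>

definition col :: "'i set \<Rightarrow> ('i \<Rightarrow> 'i \<Rightarrow> 'c::comm_ring_1) \<Rightarrow> nat \<Rightarrow> 'i \<Rightarrow> 'i \<Rightarrow> 'c" where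
  "col I A n j = (mv I A ^^ n) (\<lambda>i. if i = j then 1 else 0)"

lemma mv_iterate_symmetric:
  fixes A :: "'i \<Rightarrow> 'i \<Rightarrow> real"
  assumes sym: "\<And>i k. i \<in> I \<Longrightarrow> k \<in> I \<Longrightarrow> A i k = A k i"
  shows "(\<Sum>i\<in>I. x i * (mv I A ^^ n) y i) = (\<Sum>i\<in>I. (mv I A ^^ n) x i * y i)"
proof (induction n arbitrary: x y)
  case (Suc n)
  have 1: "(\<Sum>i\<in>I. x i * mv I A y i) = (\<Sum>i\<in>I. mv I A x i * y i)" for x y
  proof -
    have "(\<Sum>i\<in>I. x i * mv I A y i) = (\<Sum>i\<in>I. \<Sum>k\<in>I. x i * A i k * y k)"
      by (simp add: mv_def sum_distrib_left mult_ac)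
    also have "\<dots> = (\<Sum>k\<in>I. \<Sum>i\<in>I. x i * A i k * y k)" by (rule sum.swap)
    also have "\<dots> = (\<Sum>k\<in>I. mv I A x k * y k)"
      by (intro sum.cong) (auto simp: mv_def sum_distrib_left sum_distrib_right mult_ac sym)
    finally show ?thesis .
  qed
  have "(\<Sum>i\<in>I. x i * (mv I A ^^ Suc n) y i) = (\<Sum>i\<in>I. mv I A x i * (mv I A ^^ n) y i)"
    by (simp add: 1)
  also have "\<dots> = (\<Sum>i\<in>I. (mv I A ^^ n) (mv I A x) i * y i)" by (rule Suc.IH)
  also have "(mv I A ^^ n) (mv I A x) = (mv I A ^^ Suc n) x" by (simp add: funpow_swap1)
  finally show ?case .
qed simp

lemma mv_iterate_hermitian:
  fixes A :: "'i \<Rightarrow> 'i \<Rightarrow> complex"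
  assumes herm: "\<And>i k. i \<in> I \<Longrightarrow> k \<in> I \<Longrightarrow> A i k = cnj (A k i)"
  shows "(\<Sum>i\<in>I. cnj (x i) * (mv I A ^^ n) y i) = (\<Sum>i\<in>I. cnj ((mv I A ^^ n) x i) * y i)"
proof (induction n arbitrary: x y)
  case (Suc n)
  have 1: "(\<Sum>i\<in>I. cnj (x i) * mv I A y i) = (\<Sum>i\<in>I. cnj (mv I A x i) * y i)" for x y
  proof -
    have "(\<Sum>i\<in>I. cnj (x i) * mv I A y i) = (\<Sum>i\<in>I. \<Sum>k\<in>I. cnj (x i) * A i k * y k)"
      by (simp add: mv_def sum_distrib_left mult_ac)
    also have "\<dots> = (\<Sum>k\<in>I. \<Sum>i\<in>I. cnj (x i) * A i k * y k)" by (rule sum.swap)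
    also have "\<dots> = (\<Sum>k\<in>I. cnj (mv I A x k) * y k)"
      by (intro sum.cong) (auto simp: mv_def sum_distrib_left sum_distrib_right mult_ac herm[symmetric])
    finally show ?thesis .
  qed
  have "(\<Sum>i\<in>I. cnj (x i) * (mv I A ^^ Suc n) y i) = (\<Sum>i\<in>I. cnj (mv I A x i) * (mv I A ^^ n) y i)"
    by (simp add: 1)
  also have "\<dots> = (\<Sum>i\<in>I. cnj ((mv I A ^^ n) (mv I A x) i) * y i)" by (rule Suc.IH)
  also have "(mv I A ^^ n) (mv I A x) = (mv I A ^^ Suc n) x" by (simp add: funpow_swap1)
  finally show ?case .
qed simp

lemma mv_iterate_nonneg:
  fixes A :: "'i \<Rightarrow> 'i \<Rightarrow> real"
  assumes "\<And>i k. i \<in> I \<Longrightarrow> k \<in> I \<Longrightarrow> 0 \<le> A i k" "\<And>i. i \<in> I \<Longrightarrow> 0 \<le> x i" "i \<in> I"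
  shows "0 \<le> (mv I A ^^ n) x i"
  using \<open>i \<in> I\<close>
proof (induction n arbitrary: i)
  case (Suc n)
  then show ?case by (simp add: mv_def) (intro sum_nonneg mult_nonneg_nonneg assms; simp)
qed (use assms in auto)

text \<open>Entrywise domination passes to powers. In this way the norms of powers of the magnetic resolvents are bounded by those of the nonmagnetic ones.\<close>

lemma norm_col_le:
  fixes A :: "'i \<Rightarrow> 'i \<Rightarrow> real" and B :: "'i \<Rightarrow> 'i \<Rightarrow> complex"
  assumes dom: "\<And>i k. i \<in> I \<Longrightarrow> k \<in> I \<Longrightarrow> cmod (B i k) \<le> A i k" and "i \<in> I"
  shows "cmod (col I B n j i) \<le> col I A n j i"
  using \<open>i \<in> I\<close>
proof (induction n arbitrary: i)
  case (Suc n)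
  have "cmod (col I B (Suc n) j i) \<le> (\<Sum>k\<in>I. cmod (B i k) * cmod (col I B n j k))"
    by (simp add: col_def mv_def) (rule norm_sum[THEN order_trans], simp add: norm_mult)
  also have "\<dots> \<le> (\<Sum>k\<in>I. A i k * col I A n j k)"
    using Suc dom by (intro sum_mono mult_mono) (auto intro: order_trans[OF norm_ge_zero])
  also have "\<dots> = col I A (Suc n) j i" by (simp add: col_def mv_def)
  finally show ?case .
qed (simp add: col_def)

text \<open>The squared Hilbert--Schmidt norm of the \<open>n\<close>-th power.\<close>

definition hs_power :: "'i set \<Rightarrow> ('i \<Rightarrow> 'i \<Rightarrow> real) \<Rightarrow> nat \<Rightarrow> real" where
  "hs_power I A n = (\<Sum>j\<in>I. \<Sum>i\<in>I. (col I A n j i)\<^sup>2)"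

lemma hs_power_nonneg: "0 \<le> hs_power I A n"
  by (simp add: hs_power_def sum_nonneg)

lemma hs_power_0: "finite I \<Longrightarrow> hs_power I A 0 = card I"
  by (simp add: hs_power_def col_def if_distrib[where f="\<lambda>z. z\<^sup>2"] cong: if_cong)

text \<open>A symmetric matrix with nonnegative entries which satisfies \<open>\<rho>\<^sup>2 \<le> \<rho>\<close> as a quadratic form, together
with an abstract Sobolev inequality. In the application \<open>\<rho>\<close> is a compression of a resolvent
\<open>(1 + \<epsilon> \<Upsilon>)\<^sup>-\<^sup>1\<close>, \<open>f\<close> is the coefficient vector of a nonnegative function, and
\<open>\<langle>x, (\<rho> - \<rho>\<^sup>2) x\<rangle>\<close> bounds \<open>\<epsilon>\<close> times the form at the resolvent of \<open>x\<close>.\<close>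

locale nash_matrix =
  fixes I :: "'i set" and \<rho> :: "'i \<Rightarrow> 'i \<Rightarrow> real" and b :: "'i \<Rightarrow> real" and \<kappa> P A :: real
  assumes fin: "finite I"
    and kappa: "1 < \<kappa>" and P_nonneg: "0 \<le> P"
    and sym: "\<And>i k. i \<in> I \<Longrightarrow> k \<in> I \<Longrightarrow> \<rho> i k = \<rho> k i"
    and nonneg: "\<And>i k. i \<in> I \<Longrightarrow> k \<in> I \<Longrightarrow> 0 \<le> \<rho> i k"
    and b_nonneg: "\<And>i. i \<in> I \<Longrightarrow> 0 \<le> b i"
    and b_le: "(\<Sum>i\<in>I. (b i)\<^sup>2) \<le> A"
    and contr: "\<And>x. (\<Sum>i\<in>I. (mv I \<rho> x i)\<^sup>2) \<le> (\<Sum>i\<in>I. x i * mv I \<rho> x i)"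
    and sob: "\<And>x f. (\<And>i. i \<in> I \<Longrightarrow> 0 \<le> f i) \<Longrightarrow>
       (\<Sum>i\<in>I. f i * mv I \<rho> x i)\<^sup>2
         \<le> P * (\<Sum>i\<in>I. (f i)\<^sup>2) powr (1 - 1 / \<kappa>) * (\<Sum>i\<in>I. f i * b i) powr (2 / \<kappa>)
            * ((\<Sum>i\<in>I. x i * mv I \<rho> x i) - (\<Sum>i\<in>I. (mv I \<rho> x i)\<^sup>2))"
begin

abbreviation "T \<equiv> mv I \<rho>"

lemma T_contraction: "(\<Sum>i\<in>I. (T x i)\<^sup>2) \<le> (\<Sum>i\<in>I. (x i)\<^sup>2)"
proof -
  have "2 * (\<Sum>i\<in>I. x i * T x i) = (\<Sum>i\<in>I. 2 * x i * T x i)" by (simp add: sum_distrib_left mult_ac)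
  also have "\<dots> \<le> (\<Sum>i\<in>I. (x i)\<^sup>2 + (T x i)\<^sup>2)" by (intro sum_mono sum_squares_bound)
  finally show ?thesis using contr[of x] by (simp add: sum.distrib)
qed

lemma T_iterate_contraction: "(\<Sum>i\<in>I. ((T ^^ n) x i)\<^sup>2) \<le> (\<Sum>i\<in>I. (x i)\<^sup>2)"
  by (induction n) (auto intro: order_trans[OF T_contraction])

text \<open>The Sobolev inequality is applied to the partial Neumann sum \<open>x = \<Sum>\<^sub>k \<rho>\<^sup>k f\<close>, for which
\<open>x - \<rho> x = f - \<rho>\<^sup>2\<^sup>K f\<close>. It then bounds the square of \<open>\<langle>f, \<rho> x\<rangle>\<close> by a multiple of
\<open>\<langle>f, \<rho> x\<rangle>\<close> itself. Positivity of the entries makes the remainder harmless.\<close>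

lemma dual_sobolev:
  assumes f: "\<And>i. i \<in> I \<Longrightarrow> 0 \<le> f i"
  shows "2 * (\<Sum>k<K. \<Sum>i\<in>I. ((T ^^ Suc k) f i)\<^sup>2)
    \<le> P * (\<Sum>i\<in>I. (f i)\<^sup>2) powr (1 - 1 / \<kappa>) * (\<Sum>i\<in>I. f i * b i) powr (2 / \<kappa>)"
proof -
  define x where "x = (\<lambda>i. \<Sum>k<2*K. (T ^^ k) f i)"
  define w where "w = (\<Sum>i\<in>I. f i * T x i)"
  have Tx: "T x i = (\<Sum>k<2*K. (T ^^ Suc k) f i)" for i
    by (simp add: x_def mv_def sum_distrib_left) (rule sum.swap)
  have tel: "x i - T x i = f i - (T ^^ (2*K)) f i" for i
    using sum_lessThan_telescope'[of "\<lambda>k. (T ^^ k) f i" "2*K"]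
    unfolding Tx by (simp add: x_def sum_subtractf)
  have itn: "0 \<le> (T ^^ n) f i" if "i \<in> I" for n i
    by (rule mv_iterate_nonneg) (use nonneg f that in auto)
  have Txn: "0 \<le> T x i" if "i \<in> I" for i
    unfolding Tx by (intro sum_nonneg itn that)
  have "(\<Sum>i\<in>I. x i * T x i) - (\<Sum>i\<in>I. (T x i)\<^sup>2) = (\<Sum>i\<in>I. (x i - T x i) * T x i)"
    by (simp add: left_diff_distrib power2_eq_square sum_subtractf)
  also have "\<dots> \<le> w"
    unfolding w_def tel by (intro sum_mono mult_right_mono) (auto simp: itn Txn)
  finally have le: "(\<Sum>i\<in>I. x i * T x i) - (\<Sum>i\<in>I. (T x i)\<^sup>2) \<le> w" .
  define R where "R = P * (\<Sum>i\<in>I. (f i)\<^sup>2) powr (1 - 1 / \<kappa>) * (\<Sum>i\<in>I. f i * b i) powr (2 / \<kappa>)"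
  have R: "0 \<le> R" unfolding R_def using P_nonneg by (intro mult_nonneg_nonneg) auto
  have "w\<^sup>2 \<le> R * ((\<Sum>i\<in>I. x i * T x i) - (\<Sum>i\<in>I. (T x i)\<^sup>2))"
    unfolding w_def R_def by (rule sob[OF f])
  also have "\<dots> \<le> R * w" by (rule mult_left_mono[OF le R])
  finally have sq: "w * w \<le> R * w" by (simp only: power2_eq_square)
  have w: "w \<le> R"
  proof (cases "0 < w")
    case True
    with sq show ?thesis by (rule mult_right_le_imp_le)
  qed (use R in linarith)
  \<comment> \<open>odd powers dominate the following even ones, since \<open>\<rho> \<ge> \<rho>\<^sup>2\<close>\<close>
  have half: "(\<Sum>i\<in>I. ((T ^^ (k+1)) f i)\<^sup>2) \<le> (\<Sum>i\<in>I. f i * (T ^^ (2*k+1)) f i)" for k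
  proof -
    have "(\<Sum>i\<in>I. f i * (T ^^ (2*k+1)) f i) = (\<Sum>i\<in>I. f i * (T ^^ k) ((T ^^ (k+1)) f) i)"
    proof -
      have "2*k+1 = k+(k+1)" by simp
      then show ?thesis by (simp only: funpow_add comp_apply)
    qed
    also have "\<dots> = (\<Sum>i\<in>I. (T ^^ k) f i * (T ^^ (k+1)) f i)"
      by (rule mv_iterate_symmetric) (rule sym)
    also have "\<dots> = (\<Sum>i\<in>I. (T ^^ k) f i * T ((T ^^ k) f) i)" by simp
    also have "\<dots> \<ge> (\<Sum>i\<in>I. (T ((T ^^ k) f) i)\<^sup>2)" by (rule contr)
    finally show ?thesis by simp
  qed
  have full: "(\<Sum>i\<in>I. ((T ^^ (k+1)) f i)\<^sup>2) = (\<Sum>i\<in>I. f i * (T ^^ (2*k+2)) f i)" for k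
  proof -
    have "(\<Sum>i\<in>I. f i * (T ^^ (2*k+2)) f i) = (\<Sum>i\<in>I. f i * (T ^^ (k+1)) ((T ^^ (k+1)) f) i)"
    proof -
      have "2*k+2 = (k+1)+(k+1)" by simp
      then show ?thesis by (simp only: funpow_add comp_apply)
    qed
    also have "\<dots> = (\<Sum>i\<in>I. (T ^^ (k+1)) f i * (T ^^ (k+1)) f i)"
      by (rule mv_iterate_symmetric) (rule sym)
    finally show ?thesis by (simp add: power2_eq_square)
  qed
  have pairs: "(\<Sum>k<K. a (2*k+1) + a (2*k+2)) = (\<Sum>k<2*K. a (Suc k))" for a :: "nat \<Rightarrow> real"
    by (induction K) auto
  have "2 * (\<Sum>k<K. \<Sum>i\<in>I. ((T ^^ Suc k) f i)\<^sup>2)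
      = (\<Sum>k<K. 2 * (\<Sum>i\<in>I. ((T ^^ Suc k) f i)\<^sup>2))"
    by (rule sum_distrib_left)
  also have "\<dots> \<le> (\<Sum>k<K. (\<Sum>i\<in>I. f i * (T ^^ (2*k+1)) f i) + (\<Sum>i\<in>I. f i * (T ^^ (2*k+2)) f i))"
  proof (intro sum_mono)
    fix k
    show "2 * (\<Sum>i\<in>I. ((T ^^ Suc k) f i)\<^sup>2)
        \<le> (\<Sum>i\<in>I. f i * (T ^^ (2*k+1)) f i) + (\<Sum>i\<in>I. f i * (T ^^ (2*k+2)) f i)"
      using half[of k] full[of k] unfolding Suc_eq_plus1 by linarith
  qed
  also have "\<dots> = (\<Sum>k<2*K. \<Sum>i\<in>I. f i * (T ^^ Suc k) f i)"
    by (rule pairs[of "\<lambda>m. \<Sum>i\<in>I. f i * (T ^^ m) f i"])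
  also have "\<dots> = w"
    unfolding w_def Tx sum_distrib_left by (rule sum.swap)
  also note w
  finally show ?thesis unfolding R_def .
qed

text \<open>Summing the dual inequality over the columns \<open>f\<close> of \<open>\<rho>\<^sup>n\<close> gives the inequality that is iterated.
By symmetry the pairings of these columns with \<open>b\<close> are the entries of \<open>\<rho>\<^sup>n b\<close>, and \<open>\<rho>\<close> is a contraction.\<close>

lemma hs_power_sum_le:
  "2 * (\<Sum>k<K. hs_power I \<rho> (k + n + 1)) \<le> P * A powr (1 / \<kappa>) * hs_power I \<rho> n powr (1 - 1 / \<kappa>)"
proof -
  define c where "c = col I \<rho> n"
  have iter: "col I \<rho> (k + n + 1) j = (T ^^ Suc k) (c j)" for k j
    by (simp add: c_def col_def funpow_add)
  have cn: "0 \<le> c j i" if "i \<in> I" for i j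
    unfolding c_def col_def by (rule mv_iterate_nonneg) (use nonneg that in auto)
  have cb: "(\<Sum>i\<in>I. c j i * b i) = (T ^^ n) b j" if "j \<in> I" for j
  proof -
    have "(\<Sum>i\<in>I. c j i * b i) = (\<Sum>i\<in>I. (if i = j then 1 else 0) * (T ^^ n) b i)"
      unfolding c_def col_def by (rule mv_iterate_symmetric[symmetric]) (rule sym)
    also have "\<dots> = (T ^^ n) b j"
      using fin that by (simp add: if_distrib[where f="\<lambda>z. z * _"] cong: if_cong)
    finally show ?thesis .
  qed
  have tb: "0 \<le> (T ^^ n) b j" if "j \<in> I" for j
    by (rule mv_iterate_nonneg) (use nonneg b_nonneg that in auto)
  have "2 * (\<Sum>k<K. hs_power I \<rho> (k + n + 1))
      = (\<Sum>j\<in>I. 2 * (\<Sum>k<K. \<Sum>i\<in>I. ((T ^^ Suc k) (c j) i)\<^sup>2))"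
    unfolding hs_power_def iter sum_distrib_left by (rule sum.swap)
  also have "\<dots> \<le> (\<Sum>j\<in>I. P * (\<Sum>i\<in>I. (c j i)\<^sup>2) powr (1 - 1 / \<kappa>) * (\<Sum>i\<in>I. c j i * b i) powr (2 / \<kappa>))"
    by (intro sum_mono dual_sobolev cn)
  also have "\<dots> = P * (\<Sum>j\<in>I. (\<Sum>i\<in>I. (c j i)\<^sup>2) powr (1 - 1 / \<kappa>) * (((T ^^ n) b j)\<^sup>2) powr (1 / \<kappa>))"
    unfolding sum_distrib_left
  proof (intro sum.cong refl)
    fix j assume j: "j \<in> I"
    have "((T ^^ n) b j)\<^sup>2 powr (1 / \<kappa>) = (T ^^ n) b j powr (2 / \<kappa>)"
      using tb[OF j] by (cases "(T ^^ n) b j = 0") (simp_all add: powr_powr flip: powr_numeral)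
    then show "P * (\<Sum>i\<in>I. (c j i)\<^sup>2) powr (1 - 1 / \<kappa>) * (\<Sum>i\<in>I. c j i * b i) powr (2 / \<kappa>)
        = P * ((\<Sum>i\<in>I. (c j i)\<^sup>2) powr (1 - 1 / \<kappa>) * (((T ^^ n) b j)\<^sup>2) powr (1 / \<kappa>))"
      using cb[OF j] by simp
  qed
  also have "\<dots> \<le> P * ((\<Sum>j\<in>I. \<Sum>i\<in>I. (c j i)\<^sup>2) powr (1 - 1 / \<kappa>) * (\<Sum>j\<in>I. ((T ^^ n) b j)\<^sup>2) powr (1 / \<kappa>))"
    using fin kappa P_nonneg by (intro mult_left_mono holder_sum) (auto simp: sum_nonneg)
  also have "\<dots> \<le> P * ((\<Sum>j\<in>I. \<Sum>i\<in>I. (c j i)\<^sup>2) powr (1 - 1 / \<kappa>) * A powr (1 / \<kappa>))"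
    using kappa P_nonneg T_iterate_contraction[of n b] b_le
    by (intro mult_left_mono powr_mono2) (auto simp: sum_nonneg)
  also have "\<dots> = P * A powr (1 / \<kappa>) * hs_power I \<rho> n powr (1 - 1 / \<kappa>)"
    by (simp add: hs_power_def c_def)
  finally show ?thesis .
qed

end

lemma cauchy_schwarz_cmod:
  "(cmod (\<Sum>i\<in>I. cnj (x i) * y i))\<^sup>2 \<le> (\<Sum>i\<in>I. (cmod (x i))\<^sup>2) * (\<Sum>i\<in>I. (cmod (y i))\<^sup>2)"
proof -
  have "cmod (\<Sum>i\<in>I. cnj (x i) * y i) \<le> (\<Sum>i\<in>I. cmod (x i) * cmod (y i))"
    by (rule norm_sum[THEN order_trans]) (simp add: norm_mult)
  then have "(cmod (\<Sum>i\<in>I. cnj (x i) * y i))\<^sup>2 \<le> (\<Sum>i\<in>I. cmod (x i) * cmod (y i))\<^sup>2"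
    by (intro power_mono) auto
  also note Cauchy_Schwarz_ineq_sum
  finally show ?thesis .
qed

lemma sum_cnj_self: "(\<Sum>i\<in>I. cnj (x i) * x i) = complex_of_real (\<Sum>i\<in>I. (cmod (x i))\<^sup>2)"
  unfolding of_real_sum by (intro sum.cong refl) (simp only: complex_norm_square mult.commute)

text \<open>The moments \<open>\<parallel>\<sigma>\<^sup>k c\<parallel>\<^sup>2\<close> are log-convex in \<open>k\<close>, so that they are at least the corresponding power of the first one.
This replaces the spectral theorem.\<close>

lemma hermitian_moment_ge:
  fixes \<sigma> :: "'i \<Rightarrow> 'i \<Rightarrow> complex"
  assumes herm: "\<And>i k. i \<in> I \<Longrightarrow> k \<in> I \<Longrightarrow> \<sigma> i k = cnj (\<sigma> k i)"
    and c1: "(\<Sum>i\<in>I. (cmod (c i))\<^sup>2) \<le> 1"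
    and r: "0 < r" "r \<le> Re (\<Sum>i\<in>I. cnj (c i) * mv I \<sigma> c i)" and k: "1 \<le> k"
  shows "r ^ (2 * k) \<le> (\<Sum>i\<in>I. (cmod ((mv I \<sigma> ^^ k) c i))\<^sup>2)"
proof -
  define q where "q = (\<lambda>k. \<Sum>i\<in>I. (cmod ((mv I \<sigma> ^^ k) c i))\<^sup>2)"
  have q0: "0 \<le> q k" for k by (simp add: q_def sum_nonneg)
  have logc: "(q (Suc k))\<^sup>2 \<le> q k * q (Suc (Suc k))" for k
  proof -
    have "(\<Sum>i\<in>I. cnj ((mv I \<sigma> ^^ k) c i) * (mv I \<sigma> ^^ 1) ((mv I \<sigma> ^^ Suc k) c) i)
        = (\<Sum>i\<in>I. cnj ((mv I \<sigma> ^^ 1) ((mv I \<sigma> ^^ k) c) i) * (mv I \<sigma> ^^ Suc k) c i)"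
      by (rule mv_iterate_hermitian) (rule herm)
    also have "\<dots> = complex_of_real (q (Suc k))"
      unfolding q_def sum_cnj_self[symmetric] by simp
    finally have "complex_of_real (q (Suc k)) =
        (\<Sum>i\<in>I. cnj ((mv I \<sigma> ^^ k) c i) * (mv I \<sigma> ^^ Suc (Suc k)) c i)" by simp
    then have "(q (Suc k))\<^sup>2 = (cmod (\<Sum>i\<in>I. cnj ((mv I \<sigma> ^^ k) c i) * (mv I \<sigma> ^^ Suc (Suc k)) c i))\<^sup>2"
      by (metis norm_of_real power2_abs)
    also note cauchy_schwarz_cmod
    finally show ?thesis by (simp add: q_def)
  qed
  have q01: "q 0 \<le> 1" using c1 by (simp add: q_def)
  have "r\<^sup>2 \<le> (cmod (\<Sum>i\<in>I. cnj (c i) * mv I \<sigma> c i))\<^sup>2"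
    using r complex_Re_le_cmod[of "\<Sum>i\<in>I. cnj (c i) * mv I \<sigma> c i"] by (intro power_mono) auto
  also have "\<dots> \<le> q 0 * q 1" using cauchy_schwarz_cmod[of c "mv I \<sigma> c" I] by (simp add: q_def)
  also have "\<dots> \<le> 1 * q 1" using q01 q0 by (intro mult_right_mono) auto
  finally have q1: "r\<^sup>2 \<le> q 1" by simp
  have ratio: "r\<^sup>2 * q k \<le> q (Suc k) \<and> 0 < q (Suc k)" for k
  proof (induction k)
    case 0
    have "r\<^sup>2 * q 0 \<le> r\<^sup>2 * 1" using q01 by (intro mult_left_mono) auto
    moreover have "0 < r\<^sup>2" using r by simp
    ultimately show ?case using q1 by (simp only: One_nat_def mult_1_right) linarith
  next
    case (Suc k)
    then have pos: "0 < q (Suc k)" and le: "r\<^sup>2 * q k \<le> q (Suc k)" by auto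
    have "r\<^sup>2 * q (Suc k) * q (Suc k) \<le> r\<^sup>2 * (q k * q (Suc (Suc k)))"
      using mult_left_mono[OF logc[of k], of "r\<^sup>2"] by (simp add: power2_eq_square mult.assoc)
    also have "\<dots> = (r\<^sup>2 * q k) * q (Suc (Suc k))" by simp
    also have "\<dots> \<le> q (Suc k) * q (Suc (Suc k))" using le q0 by (intro mult_right_mono) auto
    finally have "r\<^sup>2 * q (Suc k) \<le> q (Suc (Suc k))" using pos by (simp add: mult.commute)
    moreover have "0 < r\<^sup>2 * q (Suc k)" using pos r by simp
    ultimately show ?case by auto
  qed
  have "r ^ (2 * Suc m) \<le> q (Suc m)" for m
  proof (induction m)
    case (Suc m)
    have "r ^ (2 * Suc (Suc m)) = r\<^sup>2 * r ^ (2 * Suc m)" by (simp add: power2_eq_square)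
    also have "\<dots> \<le> r\<^sup>2 * q (Suc m)" using Suc by (intro mult_left_mono) auto
    also have "\<dots> \<le> q (Suc (Suc m))" using ratio by auto
    finally show ?case .
  qed (use q1 in \<open>simp add: power2_eq_square\<close>)
  from this[of "k - 1"] k show ?thesis by (simp add: q_def)
qed

text \<open>The vectors \<open>c j\<close> need not be orthonormal; it suffices that they satisfy Bessel's inequality,
as projections of orthonormal vectors do.\<close>

lemma hs_power_ge:
  fixes \<sigma> :: "'i \<Rightarrow> 'i \<Rightarrow> complex" and \<rho> :: "'i \<Rightarrow> 'i \<Rightarrow> real" and c :: "nat \<Rightarrow> 'i \<Rightarrow> complex"
  assumes fin: "finite I"
    and herm: "\<And>i k. i \<in> I \<Longrightarrow> k \<in> I \<Longrightarrow> \<sigma> i k = cnj (\<sigma> k i)"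
    and dom: "\<And>i k. i \<in> I \<Longrightarrow> k \<in> I \<Longrightarrow> cmod (\<sigma> i k) \<le> \<rho> i k"
    and bessel: "\<And>d. (\<Sum>j<N. (cmod (\<Sum>i\<in>I. cnj (d i) * c j i))\<^sup>2) \<le> (\<Sum>i\<in>I. (cmod (d i))\<^sup>2)"
    and c1: "\<And>j. j < N \<Longrightarrow> (\<Sum>i\<in>I. (cmod (c j i))\<^sup>2) \<le> 1"
    and r: "0 < r" "\<And>j. j < N \<Longrightarrow> r \<le> Re (\<Sum>i\<in>I. cnj (c j i) * mv I \<sigma> (c j) i)" and k: "1 \<le> k"
  shows "real N * r ^ (2 * k) \<le> hs_power I \<rho> k"
proof -
  have coef: "(\<Sum>i\<in>I. cnj (col I \<sigma> k l i) * c j i) = (mv I \<sigma> ^^ k) (c j) l" if "l \<in> I" for l j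
  proof -
    have "(\<Sum>i\<in>I. cnj (col I \<sigma> k l i) * c j i)
        = (\<Sum>i\<in>I. cnj (if i = l then 1 else 0) * (mv I \<sigma> ^^ k) (c j) i)"
      unfolding col_def by (rule mv_iterate_hermitian[symmetric]) (rule herm)
    also have "\<dots> = (mv I \<sigma> ^^ k) (c j) l"
      using fin that by (simp add: if_distrib[where f=cnj] if_distrib[where f="\<lambda>z. z * _"] cong: if_cong)
    finally show ?thesis .
  qed
  have "real N * r ^ (2 * k) = (\<Sum>j<N. r ^ (2 * k))" by simp
  also have "\<dots> \<le> (\<Sum>j<N. \<Sum>l\<in>I. (cmod ((mv I \<sigma> ^^ k) (c j) l))\<^sup>2)"
    by (intro sum_mono hermitian_moment_ge[OF herm] c1 r k) auto
  also have "\<dots> = (\<Sum>l\<in>I. \<Sum>j<N. (cmod (\<Sum>i\<in>I. cnj (col I \<sigma> k l i) * c j i))\<^sup>2)"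
    by (subst sum.swap) (simp add: coef)
  also have "\<dots> \<le> (\<Sum>l\<in>I. \<Sum>i\<in>I. (cmod (col I \<sigma> k l i))\<^sup>2)"
    by (intro sum_mono bessel)
  also have "\<dots> \<le> hs_power I \<rho> k"
    unfolding hs_power_def by (intro sum_mono power_mono norm_col_le dom) auto
  finally show ?thesis .
qed

section \<open>Weighted inner products\<close>

lemma borel_measurable_cnj:
  "f \<in> borel_measurable M \<Longrightarrow> (\<lambda>x. cnj (f x)) \<in> borel_measurable M"
  by (intro borel_measurable_continuous_on[where f=cnj] continuous_on_cnj continuous_on_id)

text \<open>The weighted space \<open>L\<^sup>2(V dx)\<close>, its inner product (anti-linear in the first argument) and the square of its
norm. Its elements are functions, not classes, and the weight may vanish on sets of positive measure, so that this is
a semi-inner product. The weight \<open>V = 1\<close> gives \<open>L\<^sup>2(dx)\<close>.\<close>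

definition L2w :: "'a measure \<Rightarrow> ('a \<Rightarrow> real) \<Rightarrow> ('a \<Rightarrow> complex) set" where
  "L2w M V = {f \<in> borel_measurable M. integrable M (\<lambda>x. V x * (cmod (f x))\<^sup>2)}"

definition wip :: "'a measure \<Rightarrow> ('a \<Rightarrow> real) \<Rightarrow> ('a \<Rightarrow> complex) \<Rightarrow> ('a \<Rightarrow> complex) \<Rightarrow> complex" where
  "wip M V f g = (\<integral>x. complex_of_real (V x) * (cnj (f x) * g x) \<partial>M)"

definition wsq :: "'a measure \<Rightarrow> ('a \<Rightarrow> real) \<Rightarrow> ('a \<Rightarrow> complex) \<Rightarrow> real" where
  "wsq M V f = (\<integral>x. V x * (cmod (f x))\<^sup>2 \<partial>M)"

locale weight =
  fixes M :: "'a measure" and V :: "'a \<Rightarrow> real"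
  assumes V_meas[measurable]: "V \<in> borel_measurable M" and V_nonneg: "\<And>x. 0 \<le> V x"
begin

lemma L2w_meas: "f \<in> L2w M V \<Longrightarrow> f \<in> borel_measurable M"
  by (simp add: L2w_def)

lemma L2w_int: "f \<in> L2w M V \<Longrightarrow> integrable M (\<lambda>x. V x * (cmod (f x))\<^sup>2)"
  by (simp add: L2w_def)

lemma L2w_bound:
  assumes "f \<in> L2w M V" "g \<in> borel_measurable M" "AE x in M. cmod (g x) \<le> cmod (f x)"
  shows "g \<in> L2w M V"
proof -
  have "integrable M (\<lambda>x. V x * (cmod (g x))\<^sup>2)"
  proof (rule Bochner_Integration.integrable_bound[OF L2w_int[OF assms(1)]])
    show "AE x in M. norm (V x * (cmod (g x))\<^sup>2) \<le> norm (V x * (cmod (f x))\<^sup>2)"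
      using assms(3) by eventually_elim (auto simp: abs_mult V_nonneg intro!: mult_left_mono power_mono)
  qed (use assms(2) in measurable)
  then show ?thesis using assms(2) by (simp add: L2w_def)
qed

lemma L2w_zero: "(\<lambda>x. 0) \<in> L2w M V"
  by (simp add: L2w_def)

lemma L2w_scale:
  assumes "f \<in> L2w M V"
  shows "(\<lambda>x. c * f x) \<in> L2w M V"
proof -
  have "integrable M (\<lambda>x. (cmod c)\<^sup>2 * (V x * (cmod (f x))\<^sup>2))" using assms by (simp add: L2w_def)
  moreover have [measurable]: "f \<in> borel_measurable M" using assms by (simp add: L2w_def)
  have "(\<lambda>x. c * f x) \<in> borel_measurable M" by measurable
  ultimately show ?thesis by (simp add: L2w_def norm_mult power_mult_distrib mult.left_commute)
qed

lemma L2w_add: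
  assumes "f \<in> L2w M V" "g \<in> L2w M V"
  shows "(\<lambda>x. f x + g x) \<in> L2w M V"
proof -
  have [measurable]: "f \<in> borel_measurable M" "g \<in> borel_measurable M" using assms by (auto simp: L2w_def)
  have "integrable M (\<lambda>x. V x * (cmod (f x + g x))\<^sup>2)"
  proof (rule Bochner_Integration.integrable_bound)
    show "integrable M (\<lambda>x. 2 * (V x * (cmod (f x))\<^sup>2) + 2 * (V x * (cmod (g x))\<^sup>2))"
      using assms by (auto simp: L2w_def)
    have "V x * (cmod (f x + g x))\<^sup>2 \<le> 2 * (V x * (cmod (f x))\<^sup>2) + 2 * (V x * (cmod (g x))\<^sup>2)" for x
    proof -
      have "(cmod (f x + g x))\<^sup>2 \<le> (cmod (f x) + cmod (g x))\<^sup>2"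
        by (intro power_mono norm_triangle_ineq) auto
      also have "\<dots> \<le> 2 * (cmod (f x))\<^sup>2 + 2 * (cmod (g x))\<^sup>2"
        using sum_squares_bound[of "cmod (f x)" "cmod (g x)"] by (simp add: power2_sum)
      finally show ?thesis using mult_left_mono[OF _ V_nonneg[of x]] by (fastforce simp: algebra_simps)
    qed
    then show "AE x in M. norm (V x * (cmod (f x + g x))\<^sup>2)
        \<le> norm (2 * (V x * (cmod (f x))\<^sup>2) + 2 * (V x * (cmod (g x))\<^sup>2))"
      by (auto simp: V_nonneg)
  qed measurable
  then show ?thesis by (simp add: L2w_def)
qed

lemma L2w_diff: "f \<in> L2w M V \<Longrightarrow> g \<in> L2w M V \<Longrightarrow> (\<lambda>x. f x - g x) \<in> L2w M V"
  using L2w_add[of f "\<lambda>x. -1 * g x"] L2w_scale[of g "-1"] by simp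

lemma L2w_sum: "(\<And>i. i \<in> I \<Longrightarrow> f i \<in> L2w M V) \<Longrightarrow> (\<lambda>x. \<Sum>i\<in>I. f i x) \<in> L2w M V"
proof (induction I rule: infinite_finite_induct)
  case (insert a I)
  then show ?case using L2w_add[of "f a" "\<lambda>x. \<Sum>i\<in>I. f i x"] by simp
qed (auto simp: L2w_zero)

lemma wip_integrable:
  assumes "f \<in> L2w M V" "g \<in> L2w M V"
  shows "integrable M (\<lambda>x. complex_of_real (V x) * (cnj (f x) * g x))"
proof -
  have [measurable]: "f \<in> borel_measurable M" "g \<in> borel_measurable M" using assms by (auto simp: L2w_def)
  have cnjm: "(\<lambda>x. cnj (f x)) \<in> borel_measurable M"
    by (rule borel_measurable_cnj) fact
  show ?thesis
  proof (rule Bochner_Integration.integrable_bound)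
    show "integrable M (\<lambda>x. V x * (cmod (f x))\<^sup>2 + V x * (cmod (g x))\<^sup>2)"
      using assms by (auto simp: L2w_def)
    have "V x * (cmod (f x) * cmod (g x)) \<le> V x * (cmod (f x))\<^sup>2 + V x * (cmod (g x))\<^sup>2" for x
      unfolding distrib_left[symmetric]
    proof (intro mult_left_mono V_nonneg)
      show "cmod (f x) * cmod (g x) \<le> (cmod (f x))\<^sup>2 + (cmod (g x))\<^sup>2"
        using sum_squares_bound[of "cmod (f x)" "cmod (g x)"]
          mult_nonneg_nonneg[OF norm_ge_zero[of "f x"] norm_ge_zero[of "g x"]] by linarith
    qed
    then show "AE x in M. norm (complex_of_real (V x) * (cnj (f x) * g x))
       \<le> norm (V x * (cmod (f x))\<^sup>2 + V x * (cmod (g x))\<^sup>2)"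
      by (auto simp: norm_mult V_nonneg)
  qed (use cnjm in measurable)
qed

lemma wip_add_right:
  "f \<in> L2w M V \<Longrightarrow> g \<in> L2w M V \<Longrightarrow> h \<in> L2w M V \<Longrightarrow>
    wip M V f (\<lambda>x. g x + h x) = wip M V f g + wip M V f h"
  unfolding wip_def
  by (subst Bochner_Integration.integral_add[symmetric]) (auto simp: wip_integrable distrib_left)

lemma wip_scale_right: "wip M V f (\<lambda>x. c * g x) = c * wip M V f g"
  unfolding wip_def by (subst integral_mult_right_zero[symmetric]) (simp add: mult_ac)

lemma wip_cnj: "wip M V g f = cnj (wip M V f g)"
proof -
  have "wip M V g f = (\<integral>x. cnj (complex_of_real (V x) * (cnj (f x) * g x)) \<partial>M)"
    unfolding wip_def by (intro Bochner_Integration.integral_cong) (auto simp: mult_ac)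
  then show ?thesis by (simp only: Bochner_Integration.integral_cnj wip_def)
qed

lemma wip_diff_right:
  "f \<in> L2w M V \<Longrightarrow> g \<in> L2w M V \<Longrightarrow> h \<in> L2w M V \<Longrightarrow>
    wip M V f (\<lambda>x. g x - h x) = wip M V f g - wip M V f h"
  unfolding wip_def
  by (subst Bochner_Integration.integral_diff[symmetric]) (auto simp: wip_integrable right_diff_distrib)

lemma wip_add_left:
  "f \<in> L2w M V \<Longrightarrow> g \<in> L2w M V \<Longrightarrow> h \<in> L2w M V \<Longrightarrow>
    wip M V (\<lambda>x. g x + h x) f = wip M V g f + wip M V h f"
  by (simp add: wip_add_right wip_cnj[of _ f])

lemma wip_diff_left:
  "f \<in> L2w M V \<Longrightarrow> g \<in> L2w M V \<Longrightarrow> h \<in> L2w M V \<Longrightarrow>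
    wip M V (\<lambda>x. g x - h x) f = wip M V g f - wip M V h f"
  by (simp add: wip_diff_right wip_cnj[of _ f])

lemma wip_scale_left: "wip M V (\<lambda>x. c * g x) f = cnj c * wip M V g f"
  by (simp add: wip_scale_right wip_cnj[of _ f])

lemma wip_sum_right:
  "f \<in> L2w M V \<Longrightarrow> (\<And>i. i \<in> I \<Longrightarrow> g i \<in> L2w M V) \<Longrightarrow>
    wip M V f (\<lambda>x. \<Sum>i\<in>I. c i * g i x) = (\<Sum>i\<in>I. c i * wip M V f (g i))"
proof (induction I rule: infinite_finite_induct)
  case (insert a I)
  then show ?case
    by (simp add: wip_add_right L2w_scale L2w_sum wip_scale_right)
qed (auto simp: wip_def)

lemma wip_sum_left:
  "f \<in> L2w M V \<Longrightarrow> (\<And>i. i \<in> I \<Longrightarrow> g i \<in> L2w M V) \<Longrightarrow>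
    wip M V (\<lambda>x. \<Sum>i\<in>I. c i * g i x) f = (\<Sum>i\<in>I. cnj (c i) * wip M V (g i) f)"
  by (simp add: wip_sum_right wip_cnj[of _ f])

lemma wip_self: "wip M V f f = complex_of_real (wsq M V f)"
  unfolding wip_def wsq_def
  by (subst integral_complex_of_real[symmetric])
     (intro Bochner_Integration.integral_cong refl, simp add: complex_norm_square mult.commute flip: of_real_power)

lemma wsq_nonneg: "0 \<le> wsq M V f"
  unfolding wsq_def by (intro Bochner_Integration.integral_nonneg) (auto simp: V_nonneg)

lemma wsq_scale: "wsq M V (\<lambda>x. c * f x) = (cmod c)\<^sup>2 * wsq M V f"
proof -
  have "wsq M V (\<lambda>x. c * f x) = (\<integral>x. (cmod c)\<^sup>2 * (V x * (cmod (f x))\<^sup>2) \<partial>M)"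
    unfolding wsq_def by (intro Bochner_Integration.integral_cong) (auto simp: norm_mult power_mult_distrib)
  then show ?thesis by (simp add: wsq_def)
qed

lemma wsq_diff:
  assumes "f \<in> L2w M V" "g \<in> L2w M V"
  shows "wsq M V (\<lambda>x. f x - g x) = wsq M V f - 2 * Re (wip M V f g) + wsq M V g"
proof -
  have "complex_of_real (wsq M V (\<lambda>x. f x - g x)) = wip M V (\<lambda>x. f x - g x) (\<lambda>x. f x - g x)"
    by (simp add: wip_self)
  also have "\<dots> = wip M V f f - wip M V f g - (cnj (wip M V f g) - wip M V g g)"
    using assms by (simp add: wip_diff_left wip_diff_right L2w_diff flip: wip_cnj)
  finally have "Re (complex_of_real (wsq M V (\<lambda>x. f x - g x))) = 
     Re (wip M V f f - wip M V f g - (cnj (wip M V f g) - wip M V g g))" by simp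
  then show ?thesis by (simp add: wip_self)
qed

lemma wip_cong_AE:
  assumes "f \<in> borel_measurable M" "g \<in> borel_measurable M" "f' \<in> borel_measurable M" "g' \<in> borel_measurable M"
    and "AE x in M. f x = f' x" "AE x in M. g x = g' x"
  shows "wip M V f g = wip M V f' g'"
  unfolding wip_def
proof (rule integral_cong_AE)
  note [measurable] = assms(1-4) borel_measurable_cnj[OF assms(1)] borel_measurable_cnj[OF assms(3)]
  show "(\<lambda>x. complex_of_real (V x) * (cnj (f x) * g x)) \<in> borel_measurable M" by measurable
  show "(\<lambda>x. complex_of_real (V x) * (cnj (f' x) * g' x)) \<in> borel_measurable M" by measurable
  show "AE x in M. complex_of_real (V x) * (cnj (f x) * g x) = complex_of_real (V x) * (cnj (f' x) * g' x)"
    using assms(5,6) by eventually_elim simp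
qed

lemma wsq_diff_combination:
  assumes orth: "\<And>i j. i \<in> I \<Longrightarrow> j \<in> I \<Longrightarrow> wip M V (e i) (e j) = (if i = j then 1 else 0)"
    and e: "\<And>i. i \<in> I \<Longrightarrow> e i \<in> L2w M V" and fin: "finite I" and f: "f \<in> L2w M V"
  shows "wsq M V (\<lambda>x. f x - (\<Sum>i\<in>I. d i * e i x))
     = wsq M V f - (\<Sum>i\<in>I. (cmod (wip M V (e i) f))\<^sup>2) + (\<Sum>i\<in>I. (cmod (wip M V (e i) f - d i))\<^sup>2)"
proof -
  have s: "(\<lambda>x. \<Sum>i\<in>I. d i * e i x) \<in> L2w M V" using e by (intro L2w_sum L2w_scale)
  have ei: "wip M V (e i) (\<lambda>x. \<Sum>j\<in>I. d j * e j x) = d i" if "i \<in> I" for i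
    using that e fin by (simp add: wip_sum_right orth if_distrib[where f="\<lambda>z. _ * z"] cong: if_cong)
  have ss: "wip M V (\<lambda>x. \<Sum>i\<in>I. d i * e i x) (\<lambda>x. \<Sum>i\<in>I. d i * e i x) = (\<Sum>i\<in>I. cnj (d i) * d i)"
    using s e by (simp add: wip_sum_left ei)
  have fs: "wip M V f (\<lambda>x. \<Sum>i\<in>I. d i * e i x) = (\<Sum>i\<in>I. d i * cnj (wip M V (e i) f))"
    using f e by (simp add: wip_sum_right wip_cnj[of f "e _"])
  have "complex_of_real (wsq M V (\<lambda>x. \<Sum>i\<in>I. d i * e i x)) = complex_of_real (\<Sum>i\<in>I. (cmod (d i))\<^sup>2)"
    unfolding wip_self[symmetric] ss of_real_sum
    by (intro sum.cong refl) (simp only: complex_norm_square mult.commute)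
  then have w: "wsq M V (\<lambda>x. \<Sum>i\<in>I. d i * e i x) = (\<Sum>i\<in>I. (cmod (d i))\<^sup>2)"
    by (simp only: of_real_eq_iff)
  have "(cmod (a - b))\<^sup>2 = (cmod a)\<^sup>2 - 2 * Re (b * cnj a) + (cmod b)\<^sup>2" for a b
    by (simp only: cmod_power2) (simp add: power2_eq_square algebra_simps)
  then show ?thesis
    by (simp add: wsq_diff[OF f s] w fs sum.distrib sum_subtractf sum_distrib_left)
qed

lemma bessel:
  assumes orth: "\<And>i j. i \<in> I \<Longrightarrow> j \<in> I \<Longrightarrow> wip M V (e i) (e j) = (if i = j then 1 else 0)"
    and e: "\<And>i. i \<in> I \<Longrightarrow> e i \<in> L2w M V" and fin: "finite I" and f: "f \<in> L2w M V"
  shows "(\<Sum>i\<in>I. (cmod (wip M V (e i) f))\<^sup>2) \<le> wsq M V f"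
  using wsq_diff_combination[OF orth e fin f, of "\<lambda>i. wip M V (e i) f"]
    wsq_nonneg[of "\<lambda>x. f x - (\<Sum>i\<in>I. wip M V (e i) f * e i x)"] by simp

lemma wsq_orthonormal_sum:
  assumes orth: "\<And>i j. i \<in> I \<Longrightarrow> j \<in> I \<Longrightarrow> wip M V (e i) (e j) = (if i = j then 1 else 0)"
    and e: "\<And>i. i \<in> I \<Longrightarrow> e i \<in> L2w M V" and fin: "finite I"
  shows "wsq M V (\<lambda>x. \<Sum>i\<in>I. d i * e i x) = (\<Sum>i\<in>I. (cmod (d i))\<^sup>2)"
  using wsq_diff_combination[OF orth e fin L2w_zero, of d]
  by (simp add: wip_def) (simp add: wsq_def)

end

section \<open>The Riesz representation theorem on spaces of functions\<close>

lemma quadratic_nonneg_imp_zero: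
  fixes p q :: real
  assumes "\<And>s. 0 \<le> 2 * s * p + s\<^sup>2 * q"
  shows "p = 0"
proof (cases "q > 0")
  case True
  have "0 \<le> 2 * (- p / q) * p + (- p / q)\<^sup>2 * q" by (rule assms)
  also have "\<dots> = - p\<^sup>2 / q" using True by (simp add: power2_eq_square field_simps)
  finally show ?thesis using True by (simp add: field_simps)
next
  case False
  have "0 \<le> 2 * (- p) * p + (- p)\<^sup>2 * q" by (rule assms)
  moreover have "p\<^sup>2 * q \<le> 0" using False by (simp add: mult_le_0_iff)
  ultimately have "p\<^sup>2 \<le> 0" by (simp add: power2_eq_square)
  then show ?thesis by simp
qed

text \<open>A real vector space of complex-valued functions with a real semi-inner product. It covers both the real-valued
functions in a form domain and the whole form domain, regarded as a real vector space.\<close>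

locale real_function_space =
  fixes D :: "('a \<Rightarrow> complex) set" and b :: "('a \<Rightarrow> complex) \<Rightarrow> ('a \<Rightarrow> complex) \<Rightarrow> real"
  assumes add: "\<And>u v. u \<in> D \<Longrightarrow> v \<in> D \<Longrightarrow> (\<lambda>x. u x + v x) \<in> D"
    and scale: "\<And>u (c::real). u \<in> D \<Longrightarrow> (\<lambda>x. complex_of_real c * u x) \<in> D"
    and zero: "(\<lambda>x. 0) \<in> D"
    and b_add: "\<And>u v w. u \<in> D \<Longrightarrow> v \<in> D \<Longrightarrow> w \<in> D \<Longrightarrow> b u (\<lambda>x. v x + w x) = b u v + b u w"
    and b_scale: "\<And>u v (c::real). u \<in> D \<Longrightarrow> v \<in> D \<Longrightarrow> b u (\<lambda>x. complex_of_real c * v x) = c * b u v"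
    and b_sym: "\<And>u v. u \<in> D \<Longrightarrow> v \<in> D \<Longrightarrow> b u v = b v u"
    and b_nonneg: "\<And>u. u \<in> D \<Longrightarrow> 0 \<le> b u u"
begin

lemma diff: "u \<in> D \<Longrightarrow> v \<in> D \<Longrightarrow> (\<lambda>x. u x - v x) \<in> D"
  using add[of u "\<lambda>x. complex_of_real (-1) * v x"] scale[of v "-1"] by simp

lemma b_expand:
  assumes "u \<in> D" "v \<in> D"
  shows "b (\<lambda>x. u x + complex_of_real s * v x) (\<lambda>x. u x + complex_of_real s * v x)
     = b u u + 2 * s * b u v + s\<^sup>2 * b v v"
proof -
  let ?w = "\<lambda>x. u x + complex_of_real s * v x"
  have sv: "(\<lambda>x. complex_of_real s * v x) \<in> D" and w: "?w \<in> D" using assms by (auto intro: add scale)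
  have "b z ?w = b z u + s * b z v" if "z \<in> D" for z
    using that assms sv by (simp add: b_add b_scale)
  from this[OF w] this[OF assms(1)] this[OF assms(2)] show ?thesis
    using assms w b_sym[OF w assms(1)] b_sym[OF w assms(2)] b_sym[OF assms]
    by (simp add: power2_eq_square algebra_simps)
qed

lemma b_diff_self:
  assumes "u \<in> D" "v \<in> D"
  shows "b (\<lambda>x. u x - v x) (\<lambda>x. u x - v x) = b u u - 2 * b u v + b v v"
  using b_expand[OF assms, of "-1"] by simp

lemma cauchy_schwarz:
  assumes "u \<in> D" "v \<in> D"
  shows "\<bar>b u v\<bar> \<le> sqrt (b u u) * sqrt (b v v)"
proof -
  have q: "0 \<le> b u u + 2 * s * b u v + s\<^sup>2 * b v v" for s
    using b_nonneg[of "\<lambda>x. u x + complex_of_real s * v x"] assms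
    by (simp add: b_expand[OF assms, symmetric] add scale)
  have "(b u v)\<^sup>2 \<le> b u u * b v v"
  proof (cases "b v v = 0")
    case True
    have "b u v = 0"
    proof (rule ccontr)
      assume n: "b u v \<noteq> 0"
      have "0 \<le> b u u + 2 * (- (b u u + 1) / (2 * b u v)) * b u v"
        using q[of "- (b u u + 1) / (2 * b u v)"] True by simp
      moreover have "2 * (- (b u u + 1) / (2 * b u v)) * b u v = - (b u u + 1)" using n by simp
      ultimately show False by simp
    qed
    then show ?thesis using True by simp
  next
    case False
    then have p: "0 < b v v" using b_nonneg[OF assms(2)] by simp
    have "0 \<le> b u u + 2 * (- b u v / b v v) * b u v + (- b u v / b v v)\<^sup>2 * b v v" by (rule q)
    also have "\<dots> = b u u - (b u v)\<^sup>2 / b v v" using p by (simp add: power2_eq_square field_simps)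
    finally show ?thesis using p by (simp add: field_simps)
  qed
  from real_sqrt_le_mono[OF this] show ?thesis
    unfolding real_sqrt_abs real_sqrt_mult .
qed

text \<open>The functional \<open>l\<close> is represented by the minimizer of \<open>b u u - 2 l u\<close>. The hypothesis \<open>l_bound\<close> is the form in which
boundedness of \<open>l\<close> is used: it says that this functional is bounded below.\<close>

lemma riesz:
  fixes l :: "('a \<Rightarrow> complex) \<Rightarrow> real"
  assumes l_add: "\<And>u v. u \<in> D \<Longrightarrow> v \<in> D \<Longrightarrow> l (\<lambda>x. u x + v x) = l u + l v"
    and l_scale: "\<And>u (c::real). u \<in> D \<Longrightarrow> l (\<lambda>x. complex_of_real c * u x) = c * l u"
    and l_bound: "\<And>u. u \<in> D \<Longrightarrow> 2 * l u \<le> b u u + K"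
    and complete: "\<And>u :: nat \<Rightarrow> 'a \<Rightarrow> complex. (\<And>n. u n \<in> D) \<Longrightarrow>
       (\<forall>e>0. \<exists>N. \<forall>m\<ge>N. \<forall>n\<ge>N. b (\<lambda>x. u m x - u n x) (\<lambda>x. u m x - u n x) < e) \<Longrightarrow>
       \<exists>v\<in>D. (\<lambda>n. b (\<lambda>x. u n x - v x) (\<lambda>x. u n x - v x)) \<longlonglongrightarrow> 0"
  shows "\<exists>u\<in>D. \<forall>v\<in>D. b v u = l v"
proof -
  define J where "J = (\<lambda>u. b u u - 2 * l u)"
  define d where "d = Inf (J ` D)"
  have bdd: "bdd_below (J ` D)"
    using l_bound by (intro bdd_belowI2[of _ "-K"]) (auto simp: J_def algebra_simps)
  have d_le: "d \<le> J u" if "u \<in> D" for u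
    unfolding d_def using bdd that by (intro cINF_lower)
  have "\<exists>u\<in>D. J u < d + inverse (real (Suc n))" for n
    unfolding d_def using zero by (intro cInf_lessD[of "J ` D", simplified]) auto
  then obtain u where u: "\<And>n. u n \<in> D" and Ju: "\<And>n. J (u n) < d + inverse (real (Suc n))" by metis
  \<comment> \<open>the parallelogram law shows that a minimizing sequence is a Cauchy sequence\<close>
  have para: "b (\<lambda>x. u m x - u n x) (\<lambda>x. u m x - u n x) < 2 * inverse (real (Suc m)) + 2 * inverse (real (Suc n))" for m n
  proof -
    define w where "w = (\<lambda>x. complex_of_real (1/2) * (u m x + complex_of_real 1 * u n x))"
    have s: "(\<lambda>x. u m x + complex_of_real 1 * u n x) \<in> D"
      using add[OF u u, of m n] by simp
    have w: "w \<in> D" unfolding w_def by (rule scale[OF s])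
    have "b w w = (1/2) * b w (\<lambda>x. u m x + complex_of_real 1 * u n x)"
      unfolding w_def by (rule b_scale[OF _ s]) (rule scale[OF s])
    also have "\<dots> = (1/2) * ((1/2) * b (\<lambda>x. u m x + complex_of_real 1 * u n x) (\<lambda>x. u m x + complex_of_real 1 * u n x))"
      unfolding b_sym[OF w s] unfolding w_def by (subst b_scale[OF s s]) simp
    also have "\<dots> = (1/4) * (b (u m) (u m) + 2 * b (u m) (u n) + b (u n) (u n))"
      by (subst b_expand[OF u u]) simp
    finally have bw: "b w w = (1/4) * (b (u m) (u m) + 2 * b (u m) (u n) + b (u n) (u n))" .
    have lw: "l w = (1/2) * (l (u m) + l (u n))"
      unfolding w_def by (subst l_scale[OF s]) (simp add: l_add u)
    have "4 * b w w = b (u m) (u m) + 2 * b (u m) (u n) + b (u n) (u n)" "2 * l w = l (u m) + l (u n)"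
      unfolding bw lw by simp_all
    then show ?thesis
      using d_le[OF w] Ju[of m] Ju[of n] unfolding b_diff_self[OF u u] J_def by linarith
  qed
  have "\<forall>e>0. \<exists>N. \<forall>m\<ge>N. \<forall>n\<ge>N. b (\<lambda>x. u m x - u n x) (\<lambda>x. u m x - u n x) < e"
  proof (intro allI impI)
    fix e :: real assume "0 < e"
    then obtain N where N: "inverse (real (Suc N)) < e / 4"
      using reals_Archimedean[of "e/4"] by auto
    have small: "inverse (real (Suc m)) < e / 4" if "N \<le> m" for m
    proof -
      have "inverse (real (Suc m)) \<le> inverse (real (Suc N))"
        using that by (intro le_imp_inverse_le) auto
      with N show ?thesis by linarith
    qed
    show "\<exists>N. \<forall>m\<ge>N. \<forall>n\<ge>N. b (\<lambda>x. u m x - u n x) (\<lambda>x. u m x - u n x) < e"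
    proof (intro exI[of _ N] allI impI)
      fix m n assume "N \<le> m" "N \<le> n"
      with small[of m] small[of n] para[of m n]
      show "b (\<lambda>x. u m x - u n x) (\<lambda>x. u m x - u n x) < e" by linarith
    qed
  qed
  from complete[of u, OF u this] obtain v where v: "v \<in> D" and lim: "(\<lambda>n. b (\<lambda>x. u n x - v x) (\<lambda>x. u n x - v x)) \<longlonglongrightarrow> 0"
    by (elim bexE)
  have "b z v = l z" if z: "z \<in> D" for z
  proof -
    have "(\<lambda>n. b (u n) z) \<longlonglongrightarrow> b v z"
    proof (rule LIM_zero_cancel, rule Lim_null_comparison)
      have e: "\<bar>b (u n) z - b v z\<bar> \<le> sqrt (b (\<lambda>x. u n x - v x) (\<lambda>x. u n x - v x)) * sqrt (b z z)" for n
      proof -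
        have "b z (u n) = b z v + b z (\<lambda>x. u n x - v x)"
          using b_add[OF z v diff[OF u v, of n]] by simp
        then have "b (u n) z - b v z = b (\<lambda>x. u n x - v x) z"
          using b_sym[OF z u[of n]] b_sym[OF z v] b_sym[OF z diff[OF u v, of n]] by linarith
        then show ?thesis using cauchy_schwarz[OF diff[OF u v] z, of n] by simp
      qed
      then show "\<forall>\<^sub>F n in sequentially. norm (b (u n) z - b v z)
          \<le> sqrt (b (\<lambda>x. u n x - v x) (\<lambda>x. u n x - v x)) * sqrt (b z z)" by simp
      have "(\<lambda>n. sqrt (b (\<lambda>x. u n x - v x) (\<lambda>x. u n x - v x)) * sqrt (b z z)) \<longlonglongrightarrow> sqrt 0 * sqrt (b z z)"
        by (intro tendsto_mult tendsto_real_sqrt lim tendsto_const)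
      then show "(\<lambda>n. sqrt (b (\<lambda>x. u n x - v x) (\<lambda>x. u n x - v x)) * sqrt (b z z)) \<longlonglongrightarrow> 0" by simp
    qed
    then have lim2: "(\<lambda>n. inverse (real (Suc n)) + (2 * s * (b (u n) z - l z) + s\<^sup>2 * b z z))
        \<longlonglongrightarrow> 0 + (2 * s * (b v z - l z) + s\<^sup>2 * b z z)" for s
      by (intro tendsto_add tendsto_mult tendsto_diff tendsto_const LIMSEQ_inverse_real_of_nat)
    have low: "0 \<le> inverse (real (Suc n)) + (2 * s * (b (u n) z - l z) + s\<^sup>2 * b z z)" for n s
    proof -
      have "d \<le> J (\<lambda>x. u n x + complex_of_real s * z x)" using u z by (intro d_le add scale)
      also have "\<dots> = J (u n) + (2 * s * (b (u n) z - l z) + s\<^sup>2 * b z z)"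
        using u z by (simp add: J_def b_expand l_add l_scale scale algebra_simps)
      finally show ?thesis using Ju[of n] by simp
    qed
    have "0 \<le> 0 + (2 * s * (b v z - l z) + s\<^sup>2 * b z z)" for s
      by (rule LIMSEQ_le_const[OF lim2]) (use low in blast)
    then have "0 \<le> 2 * s * (b v z - l z) + s\<^sup>2 * b z z" for s by simp
    from quadratic_nonneg_imp_zero[OF this] show ?thesis using b_sym[OF z v] by simp
  qed
  then show ?thesis using v by blast
qed

end

section \<open>Resolvents of closed forms\<close>

text \<open>The unit weight.\<close>

abbreviation one :: "'a \<Rightarrow> real" where "one \<equiv> \<lambda>_. 1"

lemma weight_one: "weight M one"
  by unfold_locales auto

lemma Lp_space_2: "f \<in> Lp_space M 2 \<longleftrightarrow> f \<in> L2w M one" for f :: "'a \<Rightarrow> complex"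
  by (simp add: Lp_space_def L2w_def)

lemma Lp_norm_2: "(Lp_norm M 2 f)\<^sup>2 = wsq M one f"
  by (simp add: Lp_norm_def wsq_def powr_half_sqrt)

lemma L2_inner_eq_wip: "L2_inner M u v = wip M one u v"
  by (simp add: L2_inner_def wip_def)

text \<open>Nonnegative forms, with the clauses of their definition as separate facts.\<close>

locale nn_form =
  fixes M :: "'a measure" and a :: "'a form"
  assumes nn: "nonneg_form M a"
begin

sublocale W1: weight M one by (rule weight_one)

lemma dom_zero: "(\<lambda>x. 0) \<in> form_dom a"
  and dom_add: "u \<in> form_dom a \<Longrightarrow> v \<in> form_dom a \<Longrightarrow> (\<lambda>x. u x + v x) \<in> form_dom a"
  and dom_scale: "u \<in> form_dom a \<Longrightarrow> (\<lambda>x. c * u x) \<in> form_dom a"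
  using nn[unfolded nonneg_form_def, THEN conjunct1] by (auto simp: fun_subspace_def)

lemma dom_L2: "u \<in> form_dom a \<Longrightarrow> u \<in> L2w M one"
  using nn[unfolded nonneg_form_def, THEN conjunct2, THEN conjunct1] by (auto simp: dense_in_L2_def Lp_space_2)

lemma dom_meas: "u \<in> form_dom a \<Longrightarrow> u \<in> borel_measurable M"
  by (rule W1.L2w_meas[OF dom_L2])

lemma dom_AE:
  "u \<in> form_dom a \<Longrightarrow> v \<in> borel_measurable M \<Longrightarrow> AE x in M. u x = v x \<Longrightarrow> v \<in> form_dom a"
  by (rule nn[unfolded nonneg_form_def, THEN conjunct2, THEN conjunct2, THEN conjunct1, rule_format])

lemma dom_diff: "u \<in> form_dom a \<Longrightarrow> v \<in> form_dom a \<Longrightarrow> (\<lambda>x. u x - v x) \<in> form_dom a"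
  using dom_add[of u "\<lambda>x. -1 * v x"] dom_scale[of v "-1"] by simp

lemma sesq_add: "u \<in> form_dom a \<Longrightarrow> v \<in> form_dom a \<Longrightarrow> w \<in> form_dom a \<Longrightarrow>
    sesq a u (\<lambda>x. v x + w x) = sesq a u v + sesq a u w"
  by (rule nn[unfolded nonneg_form_def, THEN conjunct2, THEN conjunct2, THEN conjunct2, THEN conjunct2, THEN conjunct1, rule_format])

lemma sesq_scale: "u \<in> form_dom a \<Longrightarrow> v \<in> form_dom a \<Longrightarrow> sesq a u (\<lambda>x. c * v x) = c * sesq a u v"
  by (rule nn[unfolded nonneg_form_def, THEN conjunct2, THEN conjunct2, THEN conjunct2, THEN conjunct2, THEN conjunct2, THEN conjunct1, rule_format])

lemma sesq_cnj: "u \<in> form_dom a \<Longrightarrow> v \<in> form_dom a \<Longrightarrow> sesq a v u = cnj (sesq a u v)"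
  by (rule nn[unfolded nonneg_form_def, THEN conjunct2, THEN conjunct2, THEN conjunct2, THEN conjunct2, THEN conjunct2, THEN conjunct2, THEN conjunct1, rule_format])

lemma sesq_AE: "u \<in> form_dom a \<Longrightarrow> u' \<in> form_dom a \<Longrightarrow> v \<in> form_dom a \<Longrightarrow>
    AE x in M. u x = u' x \<Longrightarrow> sesq a u v = sesq a u' v"
  by (rule nn[unfolded nonneg_form_def, THEN conjunct2, THEN conjunct2, THEN conjunct2, THEN conjunct1, rule_format])

lemma quad_nonneg: "u \<in> form_dom a \<Longrightarrow> 0 \<le> quad a u"
  by (rule nn[unfolded nonneg_form_def, THEN conjunct2, THEN conjunct2, THEN conjunct2, THEN conjunct2, THEN conjunct2, THEN conjunct2, THEN conjunct2, rule_format])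

lemma quad_AE:
  assumes "u \<in> form_dom a" "u' \<in> form_dom a" "AE x in M. u x = u' x"
  shows "quad a u = quad a u'"
proof -
  have "sesq a u u = sesq a u' u" using assms by (intro sesq_AE) auto
  also have "\<dots> = cnj (sesq a u u')" using assms by (intro sesq_cnj) auto
  also have "sesq a u u' = sesq a u' u'" using assms by (intro sesq_AE) auto
  finally show ?thesis by (simp add: quad_def)
qed

text \<open>The real inner product \<open>\<epsilon>(a + \<delta>) + V\<close> for which the resolvent is the Riesz representative.\<close>

definition energy :: "real \<Rightarrow> real \<Rightarrow> ('a \<Rightarrow> real) \<Rightarrow> ('a \<Rightarrow> complex) \<Rightarrow> ('a \<Rightarrow> complex) \<Rightarrow> real" where
  "energy \<epsilon> \<delta> V u v =
     \<epsilon> * (Re (sesq a u v) + \<delta> * Re (wip M one u v)) + Re (wip M V u v)"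

lemma form_norm_sq:
  assumes "u \<in> form_dom a"
  shows "(form_norm M a u)\<^sup>2 = quad a u + wsq M one u"
  using quad_nonneg[OF assms] W1.wsq_nonneg[of u] by (simp add: form_norm_def Lp_norm_2)

lemma energy_function_space:
  assumes V: "weight M V" and \<epsilon>: "0 < \<epsilon>" and \<delta>: "0 < \<delta>"
    and D: "D \<subseteq> form_dom a" "D \<subseteq> L2w M V"
    and D_add: "\<And>u v. u \<in> D \<Longrightarrow> v \<in> D \<Longrightarrow> (\<lambda>x. u x + v x) \<in> D"
    and D_scale: "\<And>u (c::real). u \<in> D \<Longrightarrow> (\<lambda>x. complex_of_real c * u x) \<in> D"
    and D_zero: "(\<lambda>x. 0) \<in> D"
  shows "real_function_space D (energy \<epsilon> \<delta> V)"
proof -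
  interpret V: weight M V by fact
  show ?thesis
  proof
    fix u v w assume uvw: "u \<in> D" "v \<in> D" "w \<in> D"
    then have a: "u \<in> form_dom a" "v \<in> form_dom a" "w \<in> form_dom a"
      "u \<in> L2w M V" "v \<in> L2w M V" "w \<in> L2w M V" using D by auto
    show "energy \<epsilon> \<delta> V u (\<lambda>x. v x + w x) = energy \<epsilon> \<delta> V u v + energy \<epsilon> \<delta> V u w"
      unfolding energy_def sesq_add[OF a(1-3)] V.wip_add_right[OF a(4-6)]
        W1.wip_add_right[OF a(1-3)[THEN dom_L2]]
      by (simp add: algebra_simps)
  next
    fix u v and c :: real assume "u \<in> D" "v \<in> D"
    then show "energy \<epsilon> \<delta> V u (\<lambda>x. complex_of_real c * v x) = c * energy \<epsilon> \<delta> V u v"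
      using D unfolding energy_def W1.wip_scale_right V.wip_scale_right
      by (subst sesq_scale) (auto simp: algebra_simps)
  next
    fix u v assume "u \<in> D" "v \<in> D"
    then have "Re (sesq a u v) = Re (sesq a v u)"
      using sesq_cnj[of u v] D by (metis cnj.simps(1) subsetD)
    moreover have "Re (wip M one u v) = Re (wip M one v u)" by (subst W1.wip_cnj) simp
    moreover have "Re (wip M V u v) = Re (wip M V v u)" by (subst V.wip_cnj) simp
    ultimately show "energy \<epsilon> \<delta> V u v = energy \<epsilon> \<delta> V v u" by (simp add: energy_def)
  next
    fix u assume "u \<in> D"
    then show "0 \<le> energy \<epsilon> \<delta> V u u"
      using quad_nonneg[of u] D \<epsilon> \<delta> W1.wsq_nonneg[of u] V.wsq_nonneg[of u]
      by (auto simp: energy_def W1.wip_self V.wip_self quad_def)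
  qed (use assms in auto)
qed

lemma energy_self:
  assumes "weight M V"
  shows "energy \<epsilon> \<delta> V u u = \<epsilon> * (quad a u + \<delta> * wsq M one u) + wsq M V u"
proof -
  interpret V: weight M V by fact
  show ?thesis by (simp add: energy_def W1.wip_self V.wip_self quad_def)
qed

text \<open>The resolvent \<open>u = (1 + \<epsilon> \<Upsilon>)\<^sup>-\<^sup>1 f\<close> in \<open>L\<^sup>2(V dx)\<close>, where \<open>\<Upsilon>\<close> is the operator of the form
\<open>a + \<delta> \<parallel>\<cdot>\<parallel>\<^sup>2\<close>, in its weak formulation. Neither an operator nor its spectral theory is needed. Since \<open>\<delta> > 0\<close>, the energy norm is equivalent to
the form norm, in which the domain is complete.\<close>

lemma resolvent_exists:
  assumes V: "weight M V" and \<epsilon>: "0 < \<epsilon>" and \<delta>: "0 < \<delta>"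
    and D: "D \<subseteq> form_dom a" "D \<subseteq> L2w M V"
    and D_add: "\<And>u v. u \<in> D \<Longrightarrow> v \<in> D \<Longrightarrow> (\<lambda>x. u x + v x) \<in> D"
    and D_scale: "\<And>u (c::real). u \<in> D \<Longrightarrow> (\<lambda>x. complex_of_real c * u x) \<in> D"
    and D_zero: "(\<lambda>x. 0) \<in> D"
    and D_complete: "\<And>u :: nat \<Rightarrow> 'a \<Rightarrow> complex. (\<And>n. u n \<in> D) \<Longrightarrow>
       (\<forall>e>0. \<exists>N. \<forall>m\<ge>N. \<forall>n\<ge>N. form_norm M a (\<lambda>x. u m x - u n x) < e) \<Longrightarrow>
       \<exists>v\<in>D. (\<lambda>n. form_norm M a (\<lambda>x. u n x - v x)) \<longlonglongrightarrow> 0"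
    and bound: "\<And>u. u \<in> D \<Longrightarrow> wsq M V u \<le> C * (quad a u + \<delta> * wsq M one u)"
    and f: "f \<in> L2w M V"
  shows "\<exists>u\<in>D. \<forall>v\<in>D. energy \<epsilon> \<delta> V v u = Re (wip M V v f)"
proof -
  interpret V: weight M V by fact
  interpret real_function_space D "energy \<epsilon> \<delta> V"
    by (rule energy_function_space[OF V \<epsilon> \<delta> D D_add D_scale D_zero])
  show ?thesis
  proof (rule riesz)
    show "Re (wip M V (\<lambda>x. u x + v x) f) = Re (wip M V u f) + Re (wip M V v f)"
      if "u \<in> D" "v \<in> D" for u v
      using that D f by (subst V.wip_add_left) auto
    show "Re (wip M V (\<lambda>x. complex_of_real c * u x) f) = c * Re (wip M V u f)" for u and c :: real
      by (simp add: V.wip_scale_left)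
    show "2 * Re (wip M V u f) \<le> energy \<epsilon> \<delta> V u u + wsq M V f" if u: "u \<in> D" for u
    proof -
      have "0 \<le> wsq M V (\<lambda>x. u x - f x)" by (rule V.wsq_nonneg)
      also have "\<dots> = wsq M V u - 2 * Re (wip M V u f) + wsq M V f"
        using u D f by (intro V.wsq_diff) auto
      moreover have "0 \<le> \<epsilon> * (quad a u + \<delta> * wsq M one u)"
        using quad_nonneg[of u] W1.wsq_nonneg[of u] \<epsilon> \<delta> u D by auto
      ultimately show ?thesis by (simp add: energy_self[OF V])
    qed
  next
    fix u :: "nat \<Rightarrow> 'a \<Rightarrow> complex"
    assume u: "\<And>n. u n \<in> D"
      and cauchy: "\<forall>e>0. \<exists>N. \<forall>m\<ge>N. \<forall>n\<ge>N.
         energy \<epsilon> \<delta> V (\<lambda>x. u m x - u n x) (\<lambda>x. u m x - u n x) < e"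
    define K where "K = 1 / \<epsilon> + 1 / (\<epsilon> * \<delta>)"
    have K: "0 < K" using \<epsilon> \<delta> by (simp add: K_def add_pos_pos)
    have le1: "(form_norm M a w)\<^sup>2 \<le> K * energy \<epsilon> \<delta> V w w" if w: "w \<in> D" for w
    proof -
      define x y z where "x = quad a w" "y = wsq M one w" "z = wsq M V w"
      have nn: "0 \<le> x" "0 \<le> y" "0 \<le> z"
        using quad_nonneg[of w] W1.wsq_nonneg[of w] V.wsq_nonneg[of w] w D by (auto simp: x_y_z_def)
      have "K * (\<epsilon> * (x + \<delta> * y) + z) = (x + y) + \<delta> * y + x / \<delta> + K * z"
        using \<epsilon> \<delta> by (simp add: K_def field_simps)
      moreover have "0 \<le> \<delta> * y + x / \<delta> + K * z" using nn K \<delta> by simp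
      ultimately have "x + y \<le> K * (\<epsilon> * (x + \<delta> * y) + z)" by linarith
      then show ?thesis using w D by (auto simp: form_norm_sq energy_self[OF V] x_y_z_def)
    qed
    define L where "L = (\<epsilon> + \<bar>C\<bar>) * (1 + \<delta>)"
    have le2: "energy \<epsilon> \<delta> V w w \<le> L * (form_norm M a w)\<^sup>2" if w: "w \<in> D" for w
    proof -
      define x y where "x = quad a w" "y = wsq M one w"
      have nn: "0 \<le> x" "0 \<le> y"
        using quad_nonneg[of w] W1.wsq_nonneg[of w] w D by (auto simp: x_y_def)
      have "wsq M V w \<le> \<bar>C\<bar> * (x + \<delta> * y)"
        using bound[OF w] nn \<delta> unfolding x_y_def
        by (smt (verit) mult_right_mono mult_nonneg_nonneg)
      then have "energy \<epsilon> \<delta> V w w \<le> (\<epsilon> + \<bar>C\<bar>) * (x + \<delta> * y)"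
        by (simp add: energy_self[OF V] x_y_def algebra_simps)
      also have "\<dots> \<le> (\<epsilon> + \<bar>C\<bar>) * ((1 + \<delta>) * (x + y))"
        using nn \<epsilon> \<delta> by (intro mult_left_mono) (auto simp: algebra_simps)
      also have "\<dots> = L * (form_norm M a w)\<^sup>2"
        using w D by (auto simp: L_def form_norm_sq x_y_def)
      finally show ?thesis .
    qed
    have "\<forall>e>0. \<exists>N. \<forall>m\<ge>N. \<forall>n\<ge>N. form_norm M a (\<lambda>x. u m x - u n x) < e"
    proof (intro allI impI)
      fix e :: real assume e: "0 < e"
      then have "0 < e\<^sup>2 / K" using K by simp
      from cauchy[rule_format, OF this] obtain N where N: "\<forall>m\<ge>N. \<forall>n\<ge>N.
         energy \<epsilon> \<delta> V (\<lambda>x. u m x - u n x) (\<lambda>x. u m x - u n x) < e\<^sup>2 / K" by (elim exE)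
      show "\<exists>N. \<forall>m\<ge>N. \<forall>n\<ge>N. form_norm M a (\<lambda>x. u m x - u n x) < e"
      proof (intro exI[of _ N] allI impI)
        fix m n assume mn: "N \<le> m" "N \<le> n"
        have d: "(\<lambda>x. u m x - u n x) \<in> D" by (rule diff[OF u u])
        have "energy \<epsilon> \<delta> V (\<lambda>x. u m x - u n x) (\<lambda>x. u m x - u n x) < e\<^sup>2 / K"
          using N mn by simp
        then have "K * energy \<epsilon> \<delta> V (\<lambda>x. u m x - u n x) (\<lambda>x. u m x - u n x) < K * (e\<^sup>2 / K)"
          using K by (rule mult_strict_left_mono)
        also have "K * (e\<^sup>2 / K) = e\<^sup>2" using K by simp
        finally have "(form_norm M a (\<lambda>x. u m x - u n x))\<^sup>2 < e\<^sup>2"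
          by (rule le_less_trans[OF le1[OF d]])
        then show "form_norm M a (\<lambda>x. u m x - u n x) < e"
          using less_imp_le[OF e] by (rule power2_less_imp_less)
      qed
    qed
    from D_complete[of u, OF u this] obtain v where v: "v \<in> D"
      and lim: "(\<lambda>n. form_norm M a (\<lambda>x. u n x - v x)) \<longlonglongrightarrow> 0" by (elim bexE)
    have "(\<lambda>n. energy \<epsilon> \<delta> V (\<lambda>x. u n x - v x) (\<lambda>x. u n x - v x)) \<longlonglongrightarrow> 0"
    proof (rule Lim_null_comparison)
      show "\<forall>\<^sub>F n in sequentially. norm (energy \<epsilon> \<delta> V (\<lambda>x. u n x - v x) (\<lambda>x. u n x - v x))
          \<le> L * (form_norm M a (\<lambda>x. u n x - v x))\<^sup>2"
      proof (rule always_eventually, rule allI)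
        fix n
        have d: "(\<lambda>x. u n x - v x) \<in> D" by (rule diff[OF u v])
        show "norm (energy \<epsilon> \<delta> V (\<lambda>x. u n x - v x) (\<lambda>x. u n x - v x))
            \<le> L * (form_norm M a (\<lambda>x. u n x - v x))\<^sup>2"
          unfolding real_norm_def abs_of_nonneg[OF b_nonneg[OF d]] by (rule le2[OF d])
      qed
      have "(\<lambda>n. L * (form_norm M a (\<lambda>x. u n x - v x))\<^sup>2) \<longlonglongrightarrow> L * 0\<^sup>2"
        by (intro tendsto_mult tendsto_power lim tendsto_const)
      then show "(\<lambda>n. L * (form_norm M a (\<lambda>x. u n x - v x))\<^sup>2) \<longlonglongrightarrow> 0" by simp
    qed
    from this v show "\<exists>v\<in>D. (\<lambda>n. energy \<epsilon> \<delta> V (\<lambda>x. u n x - v x) (\<lambda>x. u n x - v x)) \<longlonglongrightarrow> 0"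
      by (rule bexI)
  qed
qed

end

lemma closed_formD:
  assumes "closed_form M a" "\<And>n. u n \<in> form_dom a"
    and "\<forall>e>0. \<exists>N. \<forall>m\<ge>N. \<forall>n\<ge>N. form_norm M a (\<lambda>x. u m x - u n x) < e"
  shows "\<exists>v\<in>form_dom a. (\<lambda>n. form_norm M a (\<lambda>x. u n x - v x)) \<longlonglongrightarrow> 0"
proof -
  have dom: "\<forall>n. u n \<in> form_dom a" using assms(2) by (rule allI)
  note spec[OF assms(1)[unfolded closed_form_def], of u]
  from mp[OF mp[OF this dom] assms(3)] show ?thesis .
qed

text \<open>The real-valued functions form a closed subspace of the form domain: the limit may be replaced by its real part, from which it differs on a null set.\<close>

lemma closed_form_real:
  assumes nn: "nonneg_form M a" and cl: "closed_form M a"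
    and u: "\<And>n. u n \<in> form_dom a" "\<And>n x. Im (u n x) = 0"
    and cauchy: "\<forall>e>0. \<exists>N. \<forall>m\<ge>N. \<forall>n\<ge>N. form_norm M a (\<lambda>x. u m x - u n x) < e"
  shows "\<exists>v\<in>form_dom a. (\<forall>x. Im (v x) = 0) \<and> (\<lambda>n. form_norm M a (\<lambda>x. u n x - v x)) \<longlonglongrightarrow> 0"
proof -
  interpret nn_form M a using nn by unfold_locales
  obtain w where w: "w \<in> form_dom a"
    and lim: "(\<lambda>n. form_norm M a (\<lambda>x. u n x - w x)) \<longlonglongrightarrow> 0"
    using closed_formD[OF cl u(1) cauchy] by (elim bexE)
  define v where "v = (\<lambda>x. complex_of_real (Re (w x)))"
  have wm[measurable]: "w \<in> borel_measurable M" using w by (rule dom_meas)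
  have vm: "v \<in> borel_measurable M" unfolding v_def by measurable
  define i where "i = (\<lambda>x. complex_of_real (Im (w x)))"
  have im: "i \<in> borel_measurable M" unfolding i_def by measurable
  have iL: "i \<in> L2w M one"
    using W1.L2w_bound[OF dom_L2[OF w] im] by (simp add: i_def abs_Im_le_cmod)
  have "wsq M one i \<le> (form_norm M a (\<lambda>x. u n x - w x))\<^sup>2" for n
  proof -
    have d: "(\<lambda>x. u n x - w x) \<in> form_dom a" using u w by (intro dom_diff) auto
    have "wsq M one i \<le> wsq M one (\<lambda>x. u n x - w x)"
      unfolding wsq_def
    proof (intro integral_mono)
      fix x
      have "\<bar>Im (w x)\<bar> \<le> cmod (u n x - w x)"
        using abs_Im_le_cmod[of "u n x - w x"] u(2)[of n x] by simp
      then show "1 * (cmod (i x))\<^sup>2 \<le> 1 * (cmod (u n x - w x))\<^sup>2"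
        by (simp add: i_def flip: abs_le_square_iff)
    qed (use W1.L2w_int[OF iL] W1.L2w_int[OF dom_L2[OF d]] in auto)
    then show ?thesis using quad_nonneg[OF d] by (simp add: form_norm_sq[OF d])
  qed
  note low = this
  have lim2: "(\<lambda>n. (form_norm M a (\<lambda>x. u n x - w x))\<^sup>2) \<longlonglongrightarrow> 0\<^sup>2"
    by (intro tendsto_power lim)
  have "wsq M one i \<le> 0\<^sup>2"
    by (rule LIMSEQ_le_const[OF lim2]) (use low in blast)
  then have "wsq M one i = 0" using W1.wsq_nonneg[of i] by simp
  then have "AE x in M. 1 * (cmod (i x))\<^sup>2 = 0"
    unfolding wsq_def using W1.L2w_int[OF iL] by (subst (asm) integral_nonneg_eq_0_iff_AE) auto
  then have ae: "AE x in M. w x = v x"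
    by eventually_elim (simp add: i_def v_def complex_eq_iff)
  have v: "v \<in> form_dom a" by (rule dom_AE[OF w vm ae])
  have "form_norm M a (\<lambda>x. u n x - w x) = form_norm M a (\<lambda>x. u n x - v x)" for n
  proof -
    have 1: "(\<lambda>x. u n x - w x) \<in> form_dom a" "(\<lambda>x. u n x - v x) \<in> form_dom a"
      using u v w by (auto intro: dom_diff)
    have aed: "AE x in M. u n x - w x = u n x - v x" using ae by eventually_elim simp
    have "quad a (\<lambda>x. u n x - w x) = quad a (\<lambda>x. u n x - v x)" by (rule quad_AE[OF 1 aed])
    moreover have "wip M one (\<lambda>x. u n x - w x) (\<lambda>x. u n x - w x) = wip M one (\<lambda>x. u n x - v x) (\<lambda>x. u n x - v x)"
      using aed 1 dom_meas by (intro W1.wip_cong_AE) auto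
    then have "wsq M one (\<lambda>x. u n x - w x) = wsq M one (\<lambda>x. u n x - v x)"
      by (simp only: W1.wip_self of_real_eq_iff)
    ultimately show ?thesis by (simp add: form_norm_def Lp_norm_2)
  qed
  with lim have "(\<lambda>n. form_norm M a (\<lambda>x. u n x - v x)) \<longlonglongrightarrow> 0" by simp
  moreover have "\<forall>x. Im (v x) = 0" by (simp add: v_def)
  ultimately show ?thesis using v by (intro bexI[of _ v] conjI)
qed

section \<open>Diamagnetic domination of resolvents\<close>

lemma wsq_one_eq_0_AE:
  assumes "f \<in> L2w M one" "wsq M one f = 0"
  shows "AE x in M. f x = 0"
proof -
  have "AE x in M. 1 * (cmod (f x))\<^sup>2 = 0"
    using assms unfolding wsq_def
    by (subst (asm) integral_nonneg_eq_0_iff_AE) (auto simp: L2w_def)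
  then show ?thesis by eventually_elim simp
qed

context nn_form
begin

lemma sesq_diff: "u \<in> form_dom a \<Longrightarrow> v \<in> form_dom a \<Longrightarrow> w \<in> form_dom a \<Longrightarrow>
    sesq a u (\<lambda>x. v x - w x) = sesq a u v - sesq a u w"
  using sesq_add[of u v "\<lambda>x. -1 * w x"] sesq_scale[of u w "-1"] dom_scale[of w "-1"] by simp

lemma Re_sesq_commute: "u \<in> form_dom a \<Longrightarrow> v \<in> form_dom a \<Longrightarrow> Re (sesq a u v) = Re (sesq a v u)"
  by (subst sesq_cnj) auto

lemma quad_diff:
  assumes "u \<in> form_dom a" "v \<in> form_dom a"
  shows "quad a (\<lambda>x. u x - v x) = quad a u - 2 * Re (sesq a u v) + quad a v"
proof -
  let ?w = "\<lambda>x. u x - v x"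
  have w: "?w \<in> form_dom a" using assms by (rule dom_diff)
  have "Re (sesq a ?w ?w) = Re (sesq a ?w u) - Re (sesq a ?w v)"
    using assms w by (subst sesq_diff) auto
  also have "Re (sesq a ?w u) = Re (sesq a u ?w)" using assms w by (intro Re_sesq_commute)
  also have "Re (sesq a u ?w) = Re (sesq a u u) - Re (sesq a u v)"
    using assms by (subst sesq_diff) auto
  also have "Re (sesq a ?w v) = Re (sesq a v ?w)" using assms w by (intro Re_sesq_commute)
  also have "Re (sesq a v ?w) = Re (sesq a v u) - Re (sesq a v v)"
    using assms by (subst sesq_diff) auto
  also have "Re (sesq a v u) = Re (sesq a u v)" using assms by (intro Re_sesq_commute)
  finally show ?thesis by (simp add: quad_def)
qed

lemma quad_scale:
  assumes "u \<in> form_dom a"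
  shows "quad a (\<lambda>x. complex_of_real c * u x) = c\<^sup>2 * quad a u"
proof -
  have cu: "(\<lambda>x. complex_of_real c * u x) \<in> form_dom a" using assms by (rule dom_scale)
  have "quad a (\<lambda>x. complex_of_real c * u x) = c * Re (sesq a (\<lambda>x. complex_of_real c * u x) u)"
    unfolding quad_def using assms cu by (subst sesq_scale) auto
  also have "Re (sesq a (\<lambda>x. complex_of_real c * u x) u) = Re (sesq a u (\<lambda>x. complex_of_real c * u x))"
    using assms cu by (intro Re_sesq_commute)
  also have "\<dots> = c * Re (sesq a u u)" using assms by (subst sesq_scale) auto
  finally show ?thesis by (simp add: quad_def power2_eq_square)
qed

lemma energy_mono_AE_zero:
  assumes V: "weight M V" and \<epsilon>: "0 < \<epsilon>" and \<delta>: "0 < \<delta>" and u: "u \<in> form_dom a"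
    and le: "energy \<epsilon> \<delta> V u u \<le> 0"
  shows "AE x in M. u x = 0"
proof (rule wsq_one_eq_0_AE[OF dom_L2[OF u]])
  interpret V: weight M V by fact
  have "\<epsilon> * (quad a u + \<delta> * wsq M one u) \<le> 0"
    using le V.wsq_nonneg[of u] by (simp add: energy_self[OF V])
  then have "quad a u + \<delta> * wsq M one u \<le> 0" using \<epsilon> by (simp add: mult_le_0_iff)
  then have "\<delta> * wsq M one u \<le> 0" using quad_nonneg[OF u] by linarith
  then show "wsq M one u = 0" using \<delta> W1.wsq_nonneg[of u] by (simp add: mult_le_0_iff)
qed

end

text \<open>The common setting of both parts. The weight \<open>V\<close> is nonnegative everywhere, and the Sobolev inequality holds for
\<open>t + \<delta> \<parallel>\<cdot>\<parallel>\<^sup>2\<close> with some \<open>\<delta> > 0\<close>.\<close>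

locale clr_setting = T: nn_form M t + A: nn_form M tA + weight M V
  for M :: "'a measure" and t tA :: "'a form" and V :: "'a \<Rightarrow> real" +
  fixes \<kappa> q S \<delta> :: real
  assumes closed_t: "closed_form M t" and closed_A: "closed_form M tA"
    and dia: "diamagnetic M t tA"
    and abs_dom: "\<And>u :: 'a \<Rightarrow> real. (\<lambda>x. complex_of_real (u x)) \<in> form_dom t \<Longrightarrow>
        (\<lambda>x. complex_of_real \<bar>u x\<bar>) \<in> form_dom t"
    and abs_quad: "\<And>u :: 'a \<Rightarrow> real. (\<lambda>x. complex_of_real (u x)) \<in> form_dom t \<Longrightarrow>
        quad t (\<lambda>x. complex_of_real \<bar>u x\<bar>) \<le> quad t (\<lambda>x. complex_of_real (u x))"
    and kappa: "1 < \<kappa>" and q_eq: "q = 2 * \<kappa> / (\<kappa> - 1)" and S_pos: "0 < S" and delta: "0 < \<delta>"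
    and sob_q: "\<And>u. u \<in> form_dom t \<Longrightarrow> u \<in> Lp_space M q"
    and sob: "\<And>u. u \<in> form_dom t \<Longrightarrow>
        S * (\<integral>x. cmod (u x) powr q \<partial>M) powr (2 / q) \<le> quad t u + \<delta> * wsq M one u"
    and V_int: "integrable M (\<lambda>x. V x powr \<kappa>)"
begin

lemma q_facts: "0 < q" "2 / q = 1 - 1 / \<kappa>" "1 / q = (1 - 1 / \<kappa>) / 2" "2 < q"
  using kappa by (auto simp: q_eq field_simps)

text \<open>\<open>Vk\<close> is the integral of \<open>V\<^sup>\<kappa>\<close>, and \<open>c0\<close> is the constant in the bound of \<open>\<integral> V |u|\<^sup>2\<close> by the form, from
Hoelder's and Sobolev's inequalities.\<close>

definition Vk :: real where "Vk = (\<integral>x. V x powr \<kappa> \<partial>M)"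

lemma Vk_nonneg: "0 \<le> Vk" unfolding Vk_def by (intro Bochner_Integration.integral_nonneg) auto

lemma weight_V: "weight M V" by unfold_locales

definition c0 :: real where "c0 = Vk powr (1 / \<kappa>) / S"

lemma t_weighted:
  assumes u: "u \<in> form_dom t"
  shows "u \<in> L2w M V" and "wsq M V u \<le> c0 * (quad t u + \<delta> * wsq M one u)"
proof -
  have [measurable]: "u \<in> borel_measurable M" using u by (rule T.dom_meas)
  have ui: "integrable M (\<lambda>x. cmod (u x) powr q)" using sob_q[OF u] by (simp add: Lp_space_def)
  have pt: "(V x powr \<kappa>) powr (1 / \<kappa>) * (cmod (u x) powr q) powr (2 / q) = V x * (cmod (u x))\<^sup>2" for x
    using kappa q_facts(1) V_nonneg[of x] by (simp add: powr_powr)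
  have h: "0 < 1 / \<kappa>" "0 < 2 / q" "1 / \<kappa> + 2 / q = 1" using kappa q_facts by auto
  have "integrable M (\<lambda>x. V x * (cmod (u x))\<^sup>2)"
    using holder2(1)[OF V_int _ ui _ h] by (simp add: pt)
  then show "u \<in> L2w M V" by (simp add: L2w_def)
  have "wsq M V u \<le> Vk powr (1 / \<kappa>) * (\<integral>x. cmod (u x) powr q \<partial>M) powr (2 / q)"
    using holder2(2)[OF V_int _ ui _ h] by (simp add: pt wsq_def Vk_def)
  also have "\<dots> \<le> Vk powr (1 / \<kappa>) * ((quad t u + \<delta> * wsq M one u) / S)"
    using sob[OF u] S_pos by (intro mult_left_mono) (auto simp: field_simps)
  finally show "wsq M V u \<le> c0 * (quad t u + \<delta> * wsq M one u)" by (simp add: c0_def)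
qed

lemma modulus:
  assumes u: "u \<in> form_dom tA"
  shows "(\<lambda>x. complex_of_real (cmod (u x))) \<in> form_dom t" (is "?m \<in> _")
    and "quad t (\<lambda>x. complex_of_real (cmod (u x))) \<le> quad tA u"
proof -
  have z: "(\<lambda>x. complex_of_real 0) \<in> form_dom t" using T.dom_zero by simp
  note d = dia[unfolded diamagnetic_def, rule_format, OF u]
  show m: "?m \<in> form_dom t" using d[of "\<lambda>_. 0", OF z] by simp
  have s: "(\<lambda>x. complex_of_real (cmod (u x)) * sgn (u x)) = u"
  proof
    fix x show "complex_of_real (cmod (u x)) * sgn (u x) = u x"
      by (cases "u x = 0") (auto simp: sgn_div_norm scaleR_conv_of_real)
  qed
  show "quad t ?m \<le> quad tA u"
    using d[of "\<lambda>x. cmod (u x)", OF m] by (simp add: quad_def s)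
qed

lemma A_weighted:
  assumes u: "u \<in> form_dom tA"
  shows "u \<in> L2w M V" and "wsq M V u \<le> c0 * (quad tA u + \<delta> * wsq M one u)"
proof -
  let ?m = "\<lambda>x. complex_of_real (cmod (u x))"
  have m: "?m \<in> L2w M V" by (rule t_weighted(1)[OF modulus(1)[OF u]])
  show "u \<in> L2w M V" by (rule L2w_bound[OF m A.dom_meas[OF u]]) simp
  have "wsq M V u = wsq M V ?m" by (simp add: wsq_def)
  also have "\<dots> \<le> c0 * (quad t ?m + \<delta> * wsq M one ?m)" by (rule t_weighted(2)[OF modulus(1)[OF u]])
  also have "\<dots> \<le> c0 * (quad tA u + \<delta> * wsq M one u)"
    using modulus(2)[OF u] S_pos delta by (intro mult_left_mono add_mono) (auto simp: wsq_def c0_def)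
  finally show "wsq M V u \<le> c0 * (quad tA u + \<delta> * wsq M one u)" .
qed

text \<open>The real-valued functions in the domain of \<open>t\<close>. A complex-valued domain need not contain the real parts of its elements, so the resolvent of \<open>t\<close> is constructed within this real space.\<close>

definition Dr :: "('a \<Rightarrow> complex) set" where
  "Dr = {u \<in> form_dom t. \<forall>x. Im (u x) = 0}"

lemma Dr_dom: "Dr \<subseteq> form_dom t" by (auto simp: Dr_def)

lemma Dr_of_real: "(\<lambda>x. complex_of_real (v x)) \<in> Dr \<longleftrightarrow> (\<lambda>x. complex_of_real (v x)) \<in> form_dom t"
  by (simp add: Dr_def)

lemma Dr_Re:
  assumes "u \<in> Dr" shows "(\<lambda>x. complex_of_real (Re (u x))) = u"
  using assms by (intro ext complex_eqI) (auto simp: Dr_def)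

lemma Dr_space:
  "u \<in> Dr \<Longrightarrow> v \<in> Dr \<Longrightarrow> (\<lambda>x. u x + v x) \<in> Dr"
  "u \<in> Dr \<Longrightarrow> (\<lambda>x. complex_of_real c * u x) \<in> Dr"
  "(\<lambda>x. 0) \<in> Dr"
  using T.dom_add T.dom_scale T.dom_zero by (auto simp: Dr_def)

lemma Dr_function_space:
  assumes "0 < \<epsilon>"
  shows "real_function_space Dr (T.energy \<epsilon> \<delta> V)"
  by (rule T.energy_function_space[OF weight_V assms delta Dr_dom])
     (use Dr_dom t_weighted(1) Dr_space in auto)

lemma real_resolvent_exists:
  assumes "0 < \<epsilon>" "f \<in> L2w M V"
  shows "\<exists>u\<in>Dr. \<forall>v\<in>Dr. T.energy \<epsilon> \<delta> V v u = Re (wip M V v f)"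
proof (rule T.resolvent_exists[OF weight_V assms(1) delta Dr_dom])
  fix u :: "nat \<Rightarrow> 'a \<Rightarrow> complex"
  assume u: "\<And>n. u n \<in> Dr"
    and c: "\<forall>e>0. \<exists>N. \<forall>m\<ge>N. \<forall>n\<ge>N. form_norm M t (\<lambda>x. u m x - u n x) < e"
  have "\<exists>v\<in>form_dom t. (\<forall>x. Im (v x) = 0) \<and> (\<lambda>n. form_norm M t (\<lambda>x. u n x - v x)) \<longlonglongrightarrow> 0"
  proof (rule closed_form_real[OF T.nn closed_t _ _ c])
    show "u n \<in> form_dom t" "Im (u n x) = 0" for n x using u[of n] by (auto simp: Dr_def)
  qed
  then obtain v where "v \<in> form_dom t" "\<forall>x. Im (v x) = 0"
     "(\<lambda>n. form_norm M t (\<lambda>x. u n x - v x)) \<longlonglongrightarrow> 0" by (elim bexE conjE)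
  then show "\<exists>v\<in>Dr. (\<lambda>n. form_norm M t (\<lambda>x. u n x - v x)) \<longlonglongrightarrow> 0"
    by (intro bexI[of _ v]) (auto simp: Dr_def)
next
  show "wsq M V u \<le> c0 * (quad t u + \<delta> * wsq M one u)" if "u \<in> Dr" for u
    by (rule t_weighted(2)) (use that Dr_dom in auto)
qed (use Dr_dom t_weighted(1) Dr_space assms in auto)

text \<open>The Riesz theorem yields real parts only; testing with \<open>\<i> v\<close> in place of \<open>v\<close> gives the imaginary parts.\<close>

lemma magnetic_resolvent_exists:
  assumes "0 < \<epsilon>" "f \<in> L2w M V"
  shows "\<exists>u\<in>form_dom tA. \<forall>v\<in>form_dom tA.
     complex_of_real \<epsilon> * (sesq tA v u + complex_of_real \<delta> * wip M one v u) + wip M V v u = wip M V v f"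
proof -
  have "\<exists>u\<in>form_dom tA. \<forall>v\<in>form_dom tA. A.energy \<epsilon> \<delta> V v u = Re (wip M V v f)"
  proof (rule A.resolvent_exists[OF weight_V assms(1) delta order_refl])
    fix u :: "nat \<Rightarrow> 'a \<Rightarrow> complex"
    assume u: "\<And>n. u n \<in> form_dom tA"
      and c: "\<forall>e>0. \<exists>N. \<forall>m\<ge>N. \<forall>n\<ge>N. form_norm M tA (\<lambda>x. u m x - u n x) < e"
    show "\<exists>v\<in>form_dom tA. (\<lambda>n. form_norm M tA (\<lambda>x. u n x - v x)) \<longlonglongrightarrow> 0"
      by (rule closed_formD[OF closed_A u c])
  next
    show "wsq M V u \<le> c0 * (quad tA u + \<delta> * wsq M one u)" if "u \<in> form_dom tA" for u
      by (rule A_weighted(2)) (use that in auto)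
  qed (use A_weighted(1) A.dom_add A.dom_scale A.dom_zero assms in auto)
  then obtain u where u: "u \<in> form_dom tA"
    and eq: "\<And>v. v \<in> form_dom tA \<Longrightarrow> A.energy \<epsilon> \<delta> V v u = Re (wip M V v f)" by blast
  show ?thesis
  proof (intro bexI[OF _ u] ballI)
    fix v assume v: "v \<in> form_dom tA"
    define iv where "iv = (\<lambda>x. \<i> * v x)"
    have iv: "iv \<in> form_dom tA" unfolding iv_def using v by (rule A.dom_scale)
    have s: "sesq tA iv u = - \<i> * sesq tA v u"
    proof -
      have "sesq tA iv u = cnj (sesq tA u iv)" by (rule A.sesq_cnj[OF u iv])
      also have "sesq tA u iv = \<i> * sesq tA u v" unfolding iv_def by (rule A.sesq_scale[OF u v])
      also have "sesq tA u v = cnj (sesq tA v u)" by (rule A.sesq_cnj[OF v u])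
      finally show ?thesis by simp
    qed
    have w: "wip M W iv g = - \<i> * wip M W v g" if "weight M W" for W g
      unfolding iv_def weight.wip_scale_left[OF that] by simp
    show "complex_of_real \<epsilon> * (sesq tA v u + complex_of_real \<delta> * wip M one v u) + wip M V v u = wip M V v f"
    proof (rule complex_eqI)
      show "Re (complex_of_real \<epsilon> * (sesq tA v u + complex_of_real \<delta> * wip M one v u) + wip M V v u)
          = Re (wip M V v f)"
        using eq[OF v] by (simp add: A.energy_def)
      show "Im (complex_of_real \<epsilon> * (sesq tA v u + complex_of_real \<delta> * wip M one v u) + wip M V v u)
          = Im (wip M V v f)"
        using eq[OF iv] by (simp add: A.energy_def s w[OF weight_V] w[OF weight_one])
    qed
  qed
qed

text \<open>Replacing the minimizer by its absolute value does not increase the functional, and the minimizer is unique.\<close>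

lemma real_resolvent_nonneg:
  assumes \<epsilon>: "0 < \<epsilon>" and u: "u \<in> Dr"
    and eq: "\<And>v. v \<in> Dr \<Longrightarrow> T.energy \<epsilon> \<delta> V v u = Re (wip M V v f)"
    and f: "f \<in> L2w M V" "\<And>x. Im (f x) = 0" "\<And>x. 0 \<le> Re (f x)"
  shows "AE x in M. 0 \<le> Re (u x)"
proof -
  interpret real_function_space Dr "T.energy \<epsilon> \<delta> V" by (rule Dr_function_space[OF \<epsilon>])
  define w where "w = (\<lambda>x. complex_of_real \<bar>Re (u x)\<bar>)"
  have ud: "u \<in> form_dom t" using u Dr_dom by auto
  have ur: "(\<lambda>x. complex_of_real (Re (u x))) \<in> form_dom t" using ud by (simp add: Dr_Re[OF u])
  have w: "w \<in> Dr" unfolding w_def Dr_of_real by (rule abs_dom[OF ur])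
  have wd: "w \<in> form_dom t" using w Dr_dom by auto
  have qw: "quad t w \<le> quad t u" using abs_quad[OF ur] by (simp add: w_def Dr_Re[OF u])
  have cm: "cmod (w x) = cmod (u x)" for x
    using u by (simp add: w_def Dr_def cmod_eq_Re)
  have Ew: "T.energy \<epsilon> \<delta> V w w \<le> T.energy \<epsilon> \<delta> V u u"
    using qw \<epsilon> by (simp add: T.energy_self[OF weight_V] wsq_def cm)
  have fw: "Re (wip M V u f) \<le> Re (wip M V w f)"
  proof -
    have "Re (wip M V v f) = (\<integral>x. V x * (Re (v x) * Re (f x)) \<partial>M)" if "v \<in> L2w M V" for v
      unfolding wip_def using wip_integrable[OF that f(1)] f(2)
      by (subst integral_Re[symmetric]) auto
    moreover have i: "integrable M (\<lambda>x. V x * (Re (v x) * Re (f x)))" if "v \<in> L2w M V" for v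
      using integrable_Re[OF wip_integrable[OF that f(1)]] f(2) by simp
    moreover have "(\<integral>x. V x * (Re (u x) * Re (f x)) \<partial>M) \<le> (\<integral>x. V x * (Re (w x) * Re (f x)) \<partial>M)"
      using V_nonneg f(3) t_weighted(1)[OF ud] t_weighted(1)[OF wd]
      by (intro integral_mono i mult_left_mono mult_right_mono) (auto simp: w_def)
    ultimately show ?thesis using t_weighted(1)[OF ud] t_weighted(1)[OF wd] by simp
  qed
  have "T.energy \<epsilon> \<delta> V (\<lambda>x. w x - u x) (\<lambda>x. w x - u x)
      = T.energy \<epsilon> \<delta> V w w - 2 * Re (wip M V w f) + Re (wip M V u f)"
    using b_diff_self[OF w u] eq[OF w] eq[OF u] by simp
  also have "\<dots> \<le> 0" using Ew fw eq[OF u] by simp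
  finally have "AE x in M. w x - u x = 0"
    by (rule T.energy_mono_AE_zero[OF weight_V \<epsilon> delta T.dom_diff[OF wd ud]])
  then show ?thesis
  proof eventually_elim
    case (elim x)
    then have "Re (w x) = Re (u x)" by simp
    then show ?case by (simp add: w_def)
  qed
qed

lemma pos_part_quad:
  fixes z :: "'a \<Rightarrow> real"
  assumes z: "(\<lambda>x. complex_of_real (z x)) \<in> form_dom t"
  shows "(\<lambda>x. complex_of_real (max (z x) 0)) \<in> form_dom t"
    and "quad t (\<lambda>x. complex_of_real (max (z x) 0))
           \<le> Re (sesq t (\<lambda>x. complex_of_real (max (z x) 0)) (\<lambda>x. complex_of_real (z x)))"
proof -
  let ?z = "\<lambda>x. complex_of_real (z x)" and ?a = "\<lambda>x. complex_of_real \<bar>z x\<bar>"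
  let ?p = "\<lambda>x. complex_of_real (max (z x) 0)"
  have p_eq: "?p = (\<lambda>x. complex_of_real (1/2) * (?a x + ?z x))"
    by (rule ext) (auto simp: max_def)
  show p: "?p \<in> form_dom t"
    unfolding p_eq by (intro T.dom_scale T.dom_add abs_dom z)
  have a_eq: "?a = (\<lambda>x. complex_of_real 2 * ?p x - ?z x)"
    by (rule ext) (auto simp: max_def)
  have p2: "(\<lambda>x. complex_of_real 2 * ?p x) \<in> form_dom t" using p by (rule T.dom_scale)
  have "Re (sesq t (\<lambda>x. complex_of_real 2 * ?p x) ?z) = Re (sesq t ?z (\<lambda>x. complex_of_real 2 * ?p x))"
    by (rule T.Re_sesq_commute[OF p2 z])
  also have "\<dots> = 2 * Re (sesq t ?z ?p)" by (subst T.sesq_scale[OF z p]) simp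
  also have "Re (sesq t ?z ?p) = Re (sesq t ?p ?z)" by (rule T.Re_sesq_commute[OF z p])
  finally have "quad t ?a = 4 * quad t ?p - 4 * Re (sesq t ?p ?z) + quad t ?z"
    unfolding a_eq by (subst T.quad_diff[OF p2 z]) (simp add: T.quad_scale[OF p, of 2, simplified])
  then show "quad t ?p \<le> Re (sesq t ?p ?z)" using abs_quad[OF z] by simp
qed

text \<open>Resolvents inherit the diamagnetic inequality. With \<open>u\<close> the magnetic and \<open>w\<close> the nonmagnetic resolvent of \<open>f \<ge> 0\<close>, the test functions are
\<open>p = max (|u| - w) 0\<close> and \<open>p sgn u\<close>; note that \<open>p \<le> |u|\<close> because \<open>w \<ge> 0\<close>. Comparing the two weak equations
shows that the energy of \<open>p\<close> is not positive.\<close>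

lemma magnetic_resolvent_dominated:
  assumes \<epsilon>: "0 < \<epsilon>" and w: "w \<in> Dr"
    and eqw: "\<And>v. v \<in> Dr \<Longrightarrow> T.energy \<epsilon> \<delta> V v w = Re (wip M V v f)"
    and u: "u \<in> form_dom tA"
    and equ: "\<And>v. v \<in> form_dom tA \<Longrightarrow>
       complex_of_real \<epsilon> * (sesq tA v u + complex_of_real \<delta> * wip M one v u) + wip M V v u = wip M V v f"
    and f: "f \<in> L2w M V" "\<And>x. Im (f x) = 0" "\<And>x. 0 \<le> Re (f x)"
  shows "AE x in M. cmod (u x) \<le> Re (w x)"
proof -
  interpret real_function_space Dr "T.energy \<epsilon> \<delta> V" by (rule Dr_function_space[OF \<epsilon>])
  have wpos: "AE x in M. 0 \<le> Re (w x)" by (rule real_resolvent_nonneg[OF \<epsilon> w eqw f])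
  define m where "m = (\<lambda>x. complex_of_real (cmod (u x)))"
  define z where "z = (\<lambda>x. cmod (u x) - Re (w x))"
  define p where "p = (\<lambda>x. complex_of_real (max (z x) 0))"
  define ps where "ps = (\<lambda>x. complex_of_real (max (z x) 0) * sgn (u x))"
  have wd: "w \<in> form_dom t" using w Dr_dom by auto
  have md: "m \<in> form_dom t" unfolding m_def by (rule modulus(1)[OF u])
  have m: "m \<in> Dr" using md by (simp add: m_def Dr_of_real)
  have z_eq: "(\<lambda>x. complex_of_real (z x)) = (\<lambda>x. m x - w x)"
    using Dr_Re[OF w] by (auto simp: z_def m_def fun_eq_iff)
  have zd: "(\<lambda>x. complex_of_real (z x)) \<in> form_dom t"
    unfolding z_eq by (rule T.dom_diff[OF md wd])
  have pd: "p \<in> form_dom t" unfolding p_def by (rule pos_part_quad(1)[OF zd])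
  have p: "p \<in> Dr" using pd by (simp add: p_def Dr_of_real)
  have ple: "AE x in M. 0 \<le> max (z x) 0 \<and> max (z x) 0 \<le> cmod (u x)"
    using wpos by eventually_elim (simp add: z_def)
  have d: "ps \<in> form_dom tA" "Re (sesq t p m) \<le> Re (sesq tA ps u)"
    using dia[unfolded diamagnetic_def, rule_format, OF u, of "\<lambda>x. max (z x) 0", OF pd[unfolded p_def] ple]
    by (simp_all add: p_def ps_def m_def)
  have sg: "cnj (sgn y) * y = complex_of_real (cmod y)" for y
  proof (cases "y = 0")
    case False
    have "cnj (sgn y) * y = cnj y * y / complex_of_real (cmod y)"
      by (simp add: sgn_div_norm scaleR_conv_of_real field_simps)
    also have "cnj y * y = complex_of_real (cmod y) * complex_of_real (cmod y)"
      using complex_norm_square[of y] by (simp add: power2_eq_square mult.commute)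
    finally show ?thesis using False by simp
  qed simp
  have wps: "wip M W ps u = wip M W p m" for W
    unfolding wip_def
  proof (rule Bochner_Integration.integral_cong)
    fix x
    have "cnj (ps x) * u x = complex_of_real (max (z x) 0) * (cnj (sgn (u x)) * u x)"
      by (simp add: ps_def mult_ac)
    then show "complex_of_real (W x) * (cnj (ps x) * u x) = complex_of_real (W x) * (cnj (p x) * m x)"
      unfolding sg by (simp add: p_def m_def)
  qed simp
  have fle: "Re (wip M V ps f) \<le> Re (wip M V p f)"
  proof -
    have ip: "integrable M (\<lambda>x. complex_of_real (V x) * (cnj (p x) * f x))"
      by (rule wip_integrable[OF t_weighted(1)[OF pd] f(1)])
    have ips: "integrable M (\<lambda>x. complex_of_real (V x) * (cnj (ps x) * f x))"
      by (rule wip_integrable[OF A_weighted(1)[OF d(1)] f(1)])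
    have "(\<integral>x. Re (complex_of_real (V x) * (cnj (ps x) * f x)) \<partial>M)
        \<le> (\<integral>x. Re (complex_of_real (V x) * (cnj (p x) * f x)) \<partial>M)"
    proof (rule integral_mono)
      fix x
      have "Re (cnj (ps x) * f x) = max (z x) 0 * Re (f x) * Re (sgn (u x))"
        using f(2)[of x] by (simp add: ps_def)
      also have "\<dots> \<le> max (z x) 0 * Re (f x) * 1"
        using f(3)[of x] complex_Re_le_cmod[of "sgn (u x)"]
        by (intro mult_left_mono) (auto simp: norm_sgn split: if_splits)
      also have "\<dots> = Re (cnj (p x) * f x)" by (simp add: p_def)
      finally show "Re (complex_of_real (V x) * (cnj (ps x) * f x)) \<le> Re (complex_of_real (V x) * (cnj (p x) * f x))"
        using V_nonneg[of x] by (simp add: mult_left_mono)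
    qed (rule integrable_Re[OF ips], rule integrable_Re[OF ip])
    then show ?thesis unfolding wip_def integral_Re[OF ip] integral_Re[OF ips] .
  qed
  have "T.energy \<epsilon> \<delta> V p m \<le> \<epsilon> * (Re (sesq tA ps u) + \<delta> * Re (wip M one ps u)) + Re (wip M V ps u)"
    unfolding T.energy_def wps using d(2) \<epsilon> by simp
  also have "\<dots> = Re (wip M V ps f)"
    unfolding equ[OF d(1), symmetric] by simp
  also note fle
  also have "Re (wip M V p f) = T.energy \<epsilon> \<delta> V p w" using eqw[OF p] by simp
  finally have le: "T.energy \<epsilon> \<delta> V p m \<le> T.energy \<epsilon> \<delta> V p w" .
  have "T.energy \<epsilon> \<delta> V p m = T.energy \<epsilon> \<delta> V p w + T.energy \<epsilon> \<delta> V p (\<lambda>x. m x - w x)"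
    using b_add[OF p w diff[OF m w]] by simp
  with le have neg: "T.energy \<epsilon> \<delta> V p (\<lambda>x. m x - w x) \<le> 0" by simp
  have wpp: "wip M W p (\<lambda>x. m x - w x) = wip M W p p" for W
    unfolding wip_def z_eq[symmetric, THEN fun_cong]
    by (rule Bochner_Integration.integral_cong) (auto simp: p_def max_def)
  have "quad t p \<le> Re (sesq t p (\<lambda>x. m x - w x))"
    using pos_part_quad(2)[OF zd] by (simp add: p_def z_eq)
  then have "T.energy \<epsilon> \<delta> V p p \<le> T.energy \<epsilon> \<delta> V p (\<lambda>x. m x - w x)"
    unfolding T.energy_def wpp using \<epsilon> by (simp add: quad_def)
  with neg have "T.energy \<epsilon> \<delta> V p p \<le> 0" by linarith
  then have "AE x in M. p x = 0" by (rule T.energy_mono_AE_zero[OF weight_V \<epsilon> delta pd])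
  then show ?thesis
  proof eventually_elim
    case (elim x)
    then show ?case by (simp add: p_def z_def max_def split: if_splits)
  qed
qed

end

section \<open>Discretization\<close>

context nn_form
begin

lemma dom_sum:
  "(\<And>i. i \<in> I \<Longrightarrow> g i \<in> form_dom a) \<Longrightarrow> (\<lambda>x. \<Sum>i\<in>I. c i * g i x) \<in> form_dom a"
proof (induction I rule: infinite_finite_induct)
  case (insert j I)
  have "(\<lambda>x. c j * g j x + (\<Sum>i\<in>I. c i * g i x)) \<in> form_dom a"
    using insert by (intro dom_add dom_scale) auto
  then show ?case using insert by simp
qed (auto simp: dom_zero)

lemma sesq_sum:
  assumes v: "v \<in> form_dom a"
  shows "(\<And>i. i \<in> I \<Longrightarrow> g i \<in> form_dom a) \<Longrightarrow>
    sesq a v (\<lambda>x. \<Sum>i\<in>I. c i * g i x) = (\<Sum>i\<in>I. c i * sesq a v (g i))"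
proof (induction I rule: infinite_finite_induct)
  case (insert j I)
  have g: "g j \<in> form_dom a" "\<And>i. i \<in> I \<Longrightarrow> g i \<in> form_dom a" using insert by auto
  have "sesq a v (\<lambda>x. c j * g j x + (\<Sum>i\<in>I. c i * g i x))
      = sesq a v (\<lambda>x. c j * g j x) + sesq a v (\<lambda>x. \<Sum>i\<in>I. c i * g i x)"
    by (rule sesq_add[OF v dom_scale[OF g(1)] dom_sum[OF g(2)]])
  then show ?case using insert by (simp add: sesq_scale[OF v g(1)])
qed (use sesq_scale[OF v v, of 0] in auto)

end

context real_function_space
begin

lemma sum_mem:
  "(\<And>i. i \<in> I \<Longrightarrow> g i \<in> D) \<Longrightarrow> (\<lambda>x. \<Sum>i\<in>I. complex_of_real (c i) * g i x) \<in> D"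
proof (induction I rule: infinite_finite_induct)
  case (insert j I)
  have "(\<lambda>x. complex_of_real (c j) * g j x + (\<Sum>i\<in>I. complex_of_real (c i) * g i x)) \<in> D"
    using insert by (intro add scale) auto
  then show ?case using insert by simp
qed (auto simp: zero)

lemma b_sum:
  assumes v: "v \<in> D"
  shows "(\<And>i. i \<in> I \<Longrightarrow> g i \<in> D) \<Longrightarrow>
    b v (\<lambda>x. \<Sum>i\<in>I. complex_of_real (c i) * g i x) = (\<Sum>i\<in>I. c i * b v (g i))"
proof (induction I rule: infinite_finite_induct)
  case (insert j I)
  have g: "g j \<in> D" "\<And>i. i \<in> I \<Longrightarrow> g i \<in> D" using insert by auto
  have "b v (\<lambda>x. complex_of_real (c j) * g j x + (\<Sum>i\<in>I. complex_of_real (c i) * g i x))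
      = b v (\<lambda>x. complex_of_real (c j) * g j x) + b v (\<lambda>x. \<Sum>i\<in>I. complex_of_real (c i) * g i x)"
    by (rule b_add[OF v scale[OF g(1)] sum_mem[OF g(2)]])
  then show ?case using insert by (simp add: b_scale[OF v g(1)])
qed (use b_scale[OF v v, of 0] in auto)

end

text \<open>A family \<open>w\<close> of \<open>N\<close> functions, orthonormal in \<open>L\<^sup>2(V dx)\<close>, on which the form \<open>t\<^sub>A + \<delta> \<parallel>\<cdot>\<parallel>\<^sup>2\<close> is at most 1. The resolvents are compressed to the span of
finitely many nonnegative functions with disjoint supports, chosen such that every \<open>w j\<close> is close to this span and such that their
number is polynomial in \<open>L\<close>. With \<open>W = (\<Sum>\<^sub>j |w\<^sub>j|\<^sup>2)\<^bsup>1/2\<^esup>\<close> the quotients \<open>\<theta>\<^sub>j = w\<^sub>j / W\<close> are bounded by 1, so that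
a grid of mesh \<open>1/L\<close> in their values has at most \<open>(2L + 1)\<^bsup>2N\<^esup>\<close> cells whatever the \<open>w j\<close> are; the basis functions are the normalized
restrictions of \<open>W\<close> to the cells.\<close>

locale clr_discretization = clr_setting +
  fixes w :: "nat \<Rightarrow> 'a \<Rightarrow> complex" and N L :: nat and \<epsilon> :: real
  assumes eps: "0 < \<epsilon>" and L_pos: "0 < L"
    and w_dom: "\<And>j. j < N \<Longrightarrow> w j \<in> form_dom tA"
    and w_orth: "\<And>j k. j < N \<Longrightarrow> k < N \<Longrightarrow> wip M V (w j) (w k) = (if j = k then 1 else 0)"
    and w_le: "\<And>j. j < N \<Longrightarrow> quad tA (w j) + \<delta> * wsq M one (w j) \<le> 1"
begin

lemma w_L2: "j < N \<Longrightarrow> w j \<in> L2w M V"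
  by (rule A_weighted(1)[OF w_dom])

lemma w_meas: "j < N \<Longrightarrow> w j \<in> borel_measurable M"
  by (rule L2w_meas[OF w_L2])

lemma wsq_w: "j < N \<Longrightarrow> wsq M V (w j) = 1"
  using w_orth[of j j] wip_self[of "w j"] by (metis of_real_eq_1_iff)

text \<open>The square function of the family, and its members divided by it (with value 0 where all of them vanish).\<close>

definition W :: "'a \<Rightarrow> real" where "W x = sqrt (\<Sum>j<N. (cmod (w j x))\<^sup>2)"

definition \<theta> :: "nat \<Rightarrow> 'a \<Rightarrow> complex" where "\<theta> j x = w j x / complex_of_real (W x)"

lemma W_nonneg: "0 \<le> W x" by (simp add: W_def sum_nonneg)

lemma W_sq: "(W x)\<^sup>2 = (\<Sum>j<N. (cmod (w j x))\<^sup>2)" by (simp add: W_def sum_nonneg)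

lemma w_le_W: "j < N \<Longrightarrow> cmod (w j x) \<le> W x"
  unfolding W_def by (rule real_le_rsqrt) (rule member_le_sum, auto)

lemma w_eq: "j < N \<Longrightarrow> w j x = complex_of_real (W x) * \<theta> j x"
  using w_le_W[of j x] by (cases "W x = 0") (auto simp: \<theta>_def)

lemma theta_le: "j < N \<Longrightarrow> cmod (\<theta> j x) \<le> 1"
  using w_le_W[of j x] W_nonneg[of x] by (cases "W x = 0") (auto simp: \<theta>_def norm_divide divide_le_eq_1)

lemma W_meas[measurable]: "W \<in> borel_measurable M"
proof -
  have "(\<lambda>x. \<Sum>j<N. (cmod (w j x))\<^sup>2) \<in> borel_measurable M"
    using w_meas by (intro borel_measurable_sum borel_measurable_power borel_measurable_norm) auto
  then show ?thesis unfolding W_def[abs_def] by simp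
qed

lemma theta_meas: "j < N \<Longrightarrow> \<theta> j \<in> borel_measurable M"
  unfolding \<theta>_def[abs_def] using w_meas by (intro borel_measurable_divide) auto

lemma W_int: "integrable M (\<lambda>x. V x * (W x)\<^sup>2)"
  unfolding W_sq sum_distrib_left
  by (rule Bochner_Integration.integrable_sum) (simp add: L2w_int[OF w_L2])

lemma W_integral: "(\<integral>x. V x * (W x)\<^sup>2 \<partial>M) = real N"
proof -
  have "(\<integral>x. V x * (W x)\<^sup>2 \<partial>M) = (\<Sum>j<N. wsq M V (w j))"
    unfolding W_sq sum_distrib_left wsq_def
    using L2w_int[OF w_L2] by (intro Bochner_Integration.integral_sum) auto
  then show ?thesis by (simp add: wsq_w)
qed

text \<open>The grid cell in which \<open>(\<theta>\<^sub>j x)\<^sub>j\<^sub><\<^sub>N\<close> lies is described by the integer parts of the real and imaginary parts of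
\<open>L \<theta>\<^sub>j x\<close>; \<open>I0\<close> is the set of all cells. Its members are functions on \<open>{..<N}\<close>, extended by \<open>undefined\<close>.\<close>

definition key :: "nat \<Rightarrow> 'a \<Rightarrow> int \<times> int" where
  "key j x = (\<lfloor>real L * Re (\<theta> j x)\<rfloor>, \<lfloor>real L * Im (\<theta> j x)\<rfloor>)"

definition I0 :: "(nat \<Rightarrow> int \<times> int) set" where
  "I0 = PiE {..<N} (\<lambda>_. {- int L..int L} \<times> {- int L..int L})"

definition cell :: "(nat \<Rightarrow> int \<times> int) \<Rightarrow> 'a \<Rightarrow> bool" where
  "cell i x \<longleftrightarrow> (\<forall>j\<in>{..<N}. key j x = i j)"

lemma finite_I0: "finite I0"
  unfolding I0_def by (intro finite_PiE) auto

lemma card_I0: "real (card I0) = (2 * real L + 1) ^ (2 * N)"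
proof -
  have "card I0 = (card ({- int L..int L} \<times> {- int L..int L})) ^ N"
    unfolding I0_def by (subst card_PiE) auto
  also have "card {- int L..int L} = 2 * L + 1"
    unfolding card_atLeastAtMost_int by linarith
  then have "card ({- int L..int L} \<times> {- int L..int L}) = (2 * L + 1)\<^sup>2"
    by (simp only: card_cartesian_product power2_eq_square)
  finally show ?thesis by (simp add: power_mult add.commute)
qed

lemma cell_unique: "i \<in> I0 \<Longrightarrow> k \<in> I0 \<Longrightarrow> cell i x \<Longrightarrow> cell k x \<Longrightarrow> i = k"
  unfolding I0_def cell_def by (rule PiE_ext) auto

lemma cell_exists: "\<exists>i\<in>I0. cell i x"
proof
  show "(\<lambda>j\<in>{..<N}. key j x) \<in> I0"
    unfolding I0_def
  proof (rule restrict_PiE_iff[THEN iffD2], intro ballI)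
    fix j assume "j \<in> {..<N}"
    then have c: "cmod (\<theta> j x) \<le> 1" by (simp add: theta_le)
    have "\<bar>Re (\<theta> j x)\<bar> \<le> 1" "\<bar>Im (\<theta> j x)\<bar> \<le> 1"
      using abs_Re_le_cmod[of "\<theta> j x"] abs_Im_le_cmod[of "\<theta> j x"] c by auto
    then have b: "\<bar>real L * Re (\<theta> j x)\<bar> \<le> real L" "\<bar>real L * Im (\<theta> j x)\<bar> \<le> real L"
      by (auto simp: abs_mult mult_left_le)
    have f: "\<lfloor>y\<rfloor> \<in> {- int L..int L}" if "\<bar>y\<bar> \<le> real L" for y :: real
    proof -
      have "- int L \<le> \<lfloor>y\<rfloor>" using that by (simp add: le_floor_iff)
      moreover have "\<lfloor>y\<rfloor> \<le> int L" using that by (simp add: floor_le_iff)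
      ultimately show ?thesis by simp
    qed
    show "key j x \<in> {- int L..int L} \<times> {- int L..int L}"
      using f[OF b(1)] f[OF b(2)] by (simp add: key_def)
  qed
  show "cell (\<lambda>j\<in>{..<N}. key j x) x" by (simp add: cell_def)
qed

lemma cell_meas: "Measurable.pred M (cell i)"
proof -
  have "Measurable.pred M (\<lambda>x. key j x = i j)" if "j \<in> {..<N}" for j
  proof -
    have [measurable]: "\<theta> j \<in> borel_measurable M" using that by (simp add: theta_meas)
    have "(\<lambda>x. key j x = i j) = (\<lambda>x. \<lfloor>real L * Re (\<theta> j x)\<rfloor> = fst (i j) \<and> \<lfloor>real L * Im (\<theta> j x)\<rfloor> = snd (i j))"
      by (auto simp: key_def prod_eq_iff)
    then show ?thesis by simp
  qed
  then show ?thesis unfolding cell_def[abs_def] by (intro pred_intros_finite) auto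
qed

text \<open>The restriction \<open>\<phi> i\<close> of \<open>W\<close> to the cell \<open>i\<close>, its norm \<open>m i\<close> in \<open>L\<^sup>2(V dx)\<close>, the set \<open>I\<close> of cells where this norm does not vanish, and
the normalized restrictions as a real function \<open>er i\<close> and as a complex one \<open>e i\<close>.\<close>

definition \<phi> :: "(nat \<Rightarrow> int \<times> int) \<Rightarrow> 'a \<Rightarrow> real" where
  "\<phi> i x = (if cell i x then W x else 0)"

definition m :: "(nat \<Rightarrow> int \<times> int) \<Rightarrow> real" where
  "m i = sqrt (\<integral>x. V x * (\<phi> i x)\<^sup>2 \<partial>M)"

definition I :: "(nat \<Rightarrow> int \<times> int) set" where "I = {i \<in> I0. m i \<noteq> 0}"

definition er :: "(nat \<Rightarrow> int \<times> int) \<Rightarrow> 'a \<Rightarrow> real" where "er i x = \<phi> i x / m i"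

definition e :: "(nat \<Rightarrow> int \<times> int) \<Rightarrow> 'a \<Rightarrow> complex" where "e i x = complex_of_real (er i x)"

lemma finite_I: "finite I" unfolding I_def using finite_I0 by simp

lemma card_I: "real (card I) \<le> (2 * real L + 1) ^ (2 * N)"
  unfolding card_I0[symmetric] by (simp add: I_def card_mono[OF finite_I0])

lemma phi_meas[measurable]: "\<phi> i \<in> borel_measurable M"
  unfolding \<phi>_def[abs_def] using cell_meas[of i] by measurable

lemma phi_int: "integrable M (\<lambda>x. V x * (\<phi> i x)\<^sup>2)"
proof (rule Bochner_Integration.integrable_bound[OF W_int])
  show "(\<lambda>x. V x * (\<phi> i x)\<^sup>2) \<in> borel_measurable M" by measurable
  show "AE x in M. norm (V x * (\<phi> i x)\<^sup>2) \<le> norm (V x * (W x)\<^sup>2)"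
    by (auto simp: \<phi>_def V_nonneg)
qed

lemma m_sq: "(m i)\<^sup>2 = (\<integral>x. V x * (\<phi> i x)\<^sup>2 \<partial>M)"
  unfolding m_def by (intro real_sqrt_pow2 Bochner_Integration.integral_nonneg) (simp add: V_nonneg)

lemma m_nonneg: "0 \<le> m i"
  unfolding m_def by (intro real_sqrt_ge_zero Bochner_Integration.integral_nonneg) (simp add: V_nonneg)

lemma er_nonneg: "0 \<le> er i x"
  by (simp add: er_def \<phi>_def W_nonneg m_nonneg)

lemma er_meas[measurable]: "er i \<in> borel_measurable M"
  unfolding er_def[abs_def] by measurable

lemma cmod_e: "cmod (e i x) = er i x"
  by (simp only: e_def norm_of_real abs_of_nonneg[OF er_nonneg])

lemma e_L2: "e i \<in> L2w M V"
proof -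
  have "integrable M (\<lambda>x. (V x * (\<phi> i x)\<^sup>2) / (m i)\<^sup>2)" using phi_int by simp
  moreover have "e i \<in> borel_measurable M" unfolding e_def[abs_def] by measurable
  ultimately show ?thesis by (simp add: L2w_def cmod_e er_def power_divide)
qed

lemma e_orth:
  assumes "i \<in> I" "k \<in> I"
  shows "wip M V (e i) (e k) = (if i = k then 1 else 0)"
proof (cases "i = k")
  case True
  have "wsq M V (e i) = (\<integral>x. (V x * (\<phi> i x)\<^sup>2) / (m i)\<^sup>2 \<partial>M)"
    unfolding wsq_def by (simp add: cmod_e er_def power_divide)
  also have "\<dots> = (\<integral>x. V x * (\<phi> i x)\<^sup>2 \<partial>M) / (m i)\<^sup>2" by simp
  also have "\<dots> = (m i)\<^sup>2 / (m i)\<^sup>2" by (simp only: m_sq)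
  also have "\<dots> = 1" using assms by (simp add: I_def)
  finally show ?thesis using True by (simp add: wip_self)
next
  case False
  have z: "cnj (e i x) * e k x = 0" for x
    using cell_unique[of i k x] assms False by (auto simp: e_def er_def \<phi>_def I_def)
  show ?thesis using False unfolding wip_def z by simp
qed

lemma e_real: "Im (e i x) = 0" "0 \<le> Re (e i x)"
  by (auto simp: e_def er_nonneg)

text \<open>The resolvents of \<open>t\<close> (\<open>rr\<close>) and of \<open>tA\<close> (\<open>ra\<close>) applied to the basis functions.\<close>

definition rr :: "(nat \<Rightarrow> int \<times> int) \<Rightarrow> 'a \<Rightarrow> complex" where
  "rr k = (SOME u. u \<in> Dr \<and> (\<forall>v\<in>Dr. T.energy \<epsilon> \<delta> V v u = Re (wip M V v (e k))))"

definition ra :: "(nat \<Rightarrow> int \<times> int) \<Rightarrow> 'a \<Rightarrow> complex" where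
  "ra k = (SOME u. u \<in> form_dom tA \<and> (\<forall>v\<in>form_dom tA.
     complex_of_real \<epsilon> * (sesq tA v u + complex_of_real \<delta> * wip M one v u) + wip M V v u = wip M V v (e k)))"

lemma rr: "rr k \<in> Dr" "v \<in> Dr \<Longrightarrow> T.energy \<epsilon> \<delta> V v (rr k) = Re (wip M V v (e k))"
proof -
  have "\<exists>u. u \<in> Dr \<and> (\<forall>v\<in>Dr. T.energy \<epsilon> \<delta> V v u = Re (wip M V v (e k)))"
    using real_resolvent_exists[OF eps e_L2[of k]] by blast
  from someI_ex[OF this] show "rr k \<in> Dr"
    and "v \<in> Dr \<Longrightarrow> T.energy \<epsilon> \<delta> V v (rr k) = Re (wip M V v (e k))"
    unfolding rr_def by auto
qed

lemma ra: "ra k \<in> form_dom tA" "v \<in> form_dom tA \<Longrightarrow>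
     complex_of_real \<epsilon> * (sesq tA v (ra k) + complex_of_real \<delta> * wip M one v (ra k)) + wip M V v (ra k)
       = wip M V v (e k)"
proof -
  have "\<exists>u. u \<in> form_dom tA \<and> (\<forall>v\<in>form_dom tA.
     complex_of_real \<epsilon> * (sesq tA v u + complex_of_real \<delta> * wip M one v u) + wip M V v u = wip M V v (e k))"
    using magnetic_resolvent_exists[OF eps e_L2[of k]] by blast
  from someI_ex[OF this] show "ra k \<in> form_dom tA" "v \<in> form_dom tA \<Longrightarrow>
     complex_of_real \<epsilon> * (sesq tA v (ra k) + complex_of_real \<delta> * wip M one v (ra k)) + wip M V v (ra k)
       = wip M V v (e k)"
    unfolding ra_def by auto
qed

lemma rr_L2: "rr k \<in> L2w M V" using rr(1) Dr_dom t_weighted(1) by auto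

lemma ra_L2: "ra k \<in> L2w M V" by (rule A_weighted(1)[OF ra(1)])

lemma rr_nonneg: "AE x in M. 0 \<le> Re (rr k x)"
  by (rule real_resolvent_nonneg[OF eps rr(1) rr(2) e_L2 e_real])

lemma ra_dominated: "AE x in M. cmod (ra k x) \<le> Re (rr k x)"
  by (rule magnetic_resolvent_dominated[OF eps rr(1) rr(2) ra(1) ra(2) e_L2 e_real])

text \<open>The matrices of the two compressed resolvents.\<close>

definition \<rho> :: "(nat \<Rightarrow> int \<times> int) \<Rightarrow> (nat \<Rightarrow> int \<times> int) \<Rightarrow> real" where
  "\<rho> i k = Re (wip M V (e i) (rr k))"

definition \<sigma> :: "(nat \<Rightarrow> int \<times> int) \<Rightarrow> (nat \<Rightarrow> int \<times> int) \<Rightarrow> complex" where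
  "\<sigma> i k = wip M V (e i) (ra k)"

lemma Re_wip_commute: "Re (wip M V f g) = Re (wip M V g f)"
  by (subst wip_cnj) simp

text \<open>Both sides are the energy of a pair of resolvents.\<close>

lemma rho_sym: "\<rho> i k = \<rho> k i"
proof -
  interpret real_function_space Dr "T.energy \<epsilon> \<delta> V" by (rule Dr_function_space[OF eps])
  have "\<rho> i k = T.energy \<epsilon> \<delta> V (rr k) (rr i)" for i k
    unfolding \<rho>_def rr(2)[OF rr(1)] by (rule Re_wip_commute)
  then show ?thesis using b_sym[OF rr(1) rr(1)] by simp
qed

lemma Re_wip_e: 
  assumes "f \<in> L2w M V"
  shows "Re (wip M V (e i) f) = (\<integral>x. V x * (er i x * Re (f x)) \<partial>M)"
    and "integrable M (\<lambda>x. V x * (er i x * Re (f x)))"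
proof -
  note int = wip_integrable[OF e_L2[of i] assms]
  have pt: "Re (complex_of_real (V x) * (cnj (e i x) * f x)) = V x * (er i x * Re (f x))" for x
    by (simp add: e_def)
  show "Re (wip M V (e i) f) = (\<integral>x. V x * (er i x * Re (f x)) \<partial>M)"
    unfolding wip_def integral_Re[OF int, symmetric] pt ..
  show "integrable M (\<lambda>x. V x * (er i x * Re (f x)))"
    using integrable_Re[OF int] unfolding pt .
qed

lemma rho_nonneg: "0 \<le> \<rho> i k"
  unfolding \<rho>_def Re_wip_e(1)[OF rr_L2]
proof (rule integral_nonneg_AE)
  show "AE x in M. 0 \<le> V x * (er i x * Re (rr k x))"
    using rr_nonneg[of k] by eventually_elim (simp add: V_nonneg er_nonneg)
qed

lemma sigma_herm: "\<sigma> i k = cnj (\<sigma> k i)"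
proof -
  define F where "F = (\<lambda>v u. complex_of_real \<epsilon> * (sesq tA v u + complex_of_real \<delta> * wip M one v u) + wip M V v u)"
  have F: "F (ra i) (ra k) = wip M V (ra i) (e k)" for i k
    unfolding F_def by (rule ra(2)[OF ra(1)])
  have Fc: "F (ra i) (ra k) = cnj (F (ra k) (ra i))" for i k
    using A.sesq_cnj[OF ra(1) ra(1), of i k] T.W1.wip_cnj[of "ra i" "ra k"] wip_cnj[of "ra i" "ra k"]
    by (simp add: F_def)
  have "\<sigma> i k = cnj (F (ra k) (ra i))" unfolding F \<sigma>_def by (rule wip_cnj)
  also have "\<dots> = F (ra i) (ra k)" by (rule Fc[symmetric])
  also have "\<dots> = cnj (\<sigma> k i)" unfolding F \<sigma>_def by (rule wip_cnj)
  finally show ?thesis .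
qed

lemma sigma_le_rho: "cmod (\<sigma> i k) \<le> \<rho> i k"
proof -
  note int = wip_integrable[OF e_L2[of i] ra_L2[of k]]
  have pt: "norm (complex_of_real (V x) * (cnj (e i x) * ra k x)) = V x * (er i x * cmod (ra k x))" for x
    using V_nonneg[of x] er_nonneg[of i x] by (simp add: e_def norm_mult)
  have "cmod (\<sigma> i k) \<le> (\<integral>x. V x * (er i x * cmod (ra k x)) \<partial>M)"
    unfolding \<sigma>_def wip_def pt[symmetric] by (rule integral_norm_bound)
  also have "\<dots> \<le> (\<integral>x. V x * (er i x * Re (rr k x)) \<partial>M)"
  proof (rule integral_mono_AE)
    show "integrable M (\<lambda>x. V x * (er i x * cmod (ra k x)))"
      using integrable_norm[OF int] unfolding pt .
    show "integrable M (\<lambda>x. V x * (er i x * Re (rr k x)))" by (rule Re_wip_e(2)[OF rr_L2])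
    show "AE x in M. V x * (er i x * cmod (ra k x)) \<le> V x * (er i x * Re (rr k x))"
      using ra_dominated[of k] by eventually_elim (intro mult_left_mono V_nonneg er_nonneg)
  qed
  also have "\<dots> = \<rho> i k" by (simp add: \<rho>_def Re_wip_e(1)[OF rr_L2])
  finally show ?thesis .
qed

end

section \<open>The bound for orthonormal families\<close>

context clr_discretization
begin

lemma mv_rho:
  "mv I \<rho> x i = Re (wip M V (e i) (\<lambda>y. \<Sum>k\<in>I. complex_of_real (x k) * rr k y))"
  by (simp add: mv_def \<rho>_def wip_sum_right[OF e_L2 rr_L2] mult.commute)

text \<open>For a real vector \<open>x\<close> let \<open>u\<close> be the resolvent of \<open>\<Sum> x\<^sub>i e\<^sub>i\<close>. Then \<open>\<langle>x, \<rho> x\<rangle>\<close> is the energy of \<open>u\<close>, and Bessel's inequality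
bounds \<open>\<parallel>\<rho> x\<parallel>\<^sup>2\<close> by its potential part.\<close>

lemma resolvent_combination:
  fixes x :: "(nat \<Rightarrow> int \<times> int) \<Rightarrow> real"
  defines "u \<equiv> (\<lambda>y. \<Sum>k\<in>I. complex_of_real (x k) * rr k y)"
  shows "u \<in> Dr"
    and "(\<Sum>i\<in>I. x i * mv I \<rho> x i) = \<epsilon> * (quad t u + \<delta> * wsq M one u) + wsq M V u"
    and "(\<Sum>i\<in>I. (mv I \<rho> x i)\<^sup>2) \<le> wsq M V u"
proof -
  interpret real_function_space Dr "T.energy \<epsilon> \<delta> V" by (rule Dr_function_space[OF eps])
  show u: "u \<in> Dr" unfolding u_def by (rule sum_mem[OF rr(1)])
  have uL: "u \<in> L2w M V" using u Dr_dom t_weighted(1) by auto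
  have "T.energy \<epsilon> \<delta> V u u = (\<Sum>k\<in>I. x k * T.energy \<epsilon> \<delta> V u (rr k))"
    by (subst (2) u_def) (rule b_sum[OF u rr(1)])
  also have "\<dots> = (\<Sum>k\<in>I. x k * Re (wip M V (e k) u))"
    unfolding rr(2)[OF u] Re_wip_commute[of u] ..
  finally show "(\<Sum>i\<in>I. x i * mv I \<rho> x i) = \<epsilon> * (quad t u + \<delta> * wsq M one u) + wsq M V u"
    unfolding T.energy_self[OF weight_V] by (simp add: mv_rho u_def)
  have "(\<Sum>i\<in>I. (mv I \<rho> x i)\<^sup>2) \<le> (\<Sum>i\<in>I. (cmod (wip M V (e i) u))\<^sup>2)"
    unfolding mv_rho u_def[symmetric] using abs_Re_le_cmod
    by (intro sum_mono) (simp flip: abs_le_square_iff)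
  also have "\<dots> \<le> wsq M V u" by (rule bessel[OF e_orth e_L2 finite_I uL])
  finally show "(\<Sum>i\<in>I. (mv I \<rho> x i)\<^sup>2) \<le> wsq M V u" .
qed

text \<open>The function \<open>V\<^bsup>(\<kappa>-1)/2\<^esup>\<close>, whose squared norm in \<open>L\<^sup>2(V dx)\<close> is the integral of \<open>V\<^sup>\<kappa>\<close>, and its coefficients with respect to the basis functions.\<close>

definition hV :: "'a \<Rightarrow> complex" where "hV x = complex_of_real (V x powr ((\<kappa> - 1) / 2))"

definition b :: "(nat \<Rightarrow> int \<times> int) \<Rightarrow> real" where "b i = Re (wip M V (e i) hV)"

lemma hV_sq: "V x * (cmod (hV x))\<^sup>2 = V x powr \<kappa>"
proof (cases "V x = 0")
  case False
  then have v: "0 < V x" using V_nonneg[of x] by simp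
  have "(cmod (hV x))\<^sup>2 = V x powr (\<kappa> - 1)"
    by (simp add: hV_def power2_eq_square flip: powr_add)
  then show ?thesis using v by (simp add: powr_diff)
qed (use kappa in simp)

lemma hV_L2: "hV \<in> L2w M V"
proof -
  have "hV \<in> borel_measurable M" unfolding hV_def[abs_def] by measurable
  then show ?thesis using V_int by (simp add: L2w_def hV_sq)
qed

lemma wsq_hV: "wsq M V hV = Vk" by (simp add: wsq_def hV_sq Vk_def)

lemma b_nonneg: "0 \<le> b i"
  unfolding b_def Re_wip_e(1)[OF hV_L2]
  by (intro Bochner_Integration.integral_nonneg mult_nonneg_nonneg V_nonneg er_nonneg) (simp add: hV_def)

lemma b_le: "(\<Sum>i\<in>I. (b i)\<^sup>2) \<le> Vk"
proof -
  have "(\<Sum>i\<in>I. (b i)\<^sup>2) \<le> (\<Sum>i\<in>I. (cmod (wip M V (e i) hV))\<^sup>2)"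
    unfolding b_def using abs_Re_le_cmod by (intro sum_mono) (simp flip: abs_le_square_iff)
  also have "\<dots> \<le> wsq M V hV" by (rule bessel[OF e_orth e_L2 finite_I hV_L2])
  finally show ?thesis by (simp add: wsq_hV)
qed

text \<open>The left-hand side is the square of \<open>\<integral> V F u\<close> with \<open>F = \<Sum> f\<^sub>i e\<^sub>i \<ge> 0\<close>. The integrand is at most the product of
\<open>|u|\<close>, \<open>(V F\<^sup>2)\<^bsup>1/q\<^esup>\<close> and \<open>(F V\<^bsup>(\<kappa>+1)/2\<^esup>)\<^bsup>1/\<kappa>\<^esup>\<close>; Hoelder's inequality with three exponents and the Sobolev inequality for
\<open>u\<close> give the bound.\<close>

lemma weighted_pairing_le:
  fixes f :: "(nat \<Rightarrow> int \<times> int) \<Rightarrow> real"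
  assumes f: "\<And>i. i \<in> I \<Longrightarrow> 0 \<le> f i" and u: "u \<in> Dr"
  shows "(\<Sum>i\<in>I. f i * Re (wip M V (e i) u))\<^sup>2
     \<le> (quad t u + \<delta> * wsq M one u) / S * (\<Sum>i\<in>I. (f i)\<^sup>2) powr (1 - 1 / \<kappa>) * (\<Sum>i\<in>I. f i * b i) powr (2 / \<kappa>)"
proof -
  have ud: "u \<in> form_dom t" using u Dr_dom by auto
  note uL = t_weighted(1)[OF ud]
  define F where "F = (\<lambda>x. \<Sum>i\<in>I. f i * er i x)"
  have F0: "0 \<le> F x" for x unfolding F_def by (intro sum_nonneg mult_nonneg_nonneg f er_nonneg)
  define Fc where "Fc = (\<lambda>x. \<Sum>i\<in>I. complex_of_real (f i) * e i x)"
  have Fc_eq: "Fc x = complex_of_real (F x)" for x by (simp add: Fc_def F_def e_def)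
  have FcL: "Fc \<in> L2w M V" unfolding Fc_def by (intro L2w_sum L2w_scale e_L2)
  have cF: "cmod (Fc x) = F x" for x using F0[of x] by (simp add: Fc_eq)
  have pair: "(\<Sum>i\<in>I. f i * Re (wip M V (e i) g)) = (\<integral>x. V x * (F x * Re (g x)) \<partial>M)"
    and pair_int: "integrable M (\<lambda>x. V x * (F x * Re (g x)))" if g: "g \<in> L2w M V" for g
  proof -
    have "(\<Sum>i\<in>I. f i * Re (wip M V (e i) g)) = (\<Sum>i\<in>I. \<integral>x. f i * (V x * (er i x * Re (g x))) \<partial>M)"
      by (simp add: Re_wip_e(1)[OF g])
    also have "\<dots> = (\<integral>x. (\<Sum>i\<in>I. f i * (V x * (er i x * Re (g x)))) \<partial>M)"
      using Re_wip_e(2)[OF g] by (intro Bochner_Integration.integral_sum[symmetric]) auto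
    also have "\<dots> = (\<integral>x. V x * (F x * Re (g x)) \<partial>M)"
      by (simp add: F_def sum_distrib_left sum_distrib_right mult_ac)
    finally show "(\<Sum>i\<in>I. f i * Re (wip M V (e i) g)) = (\<integral>x. V x * (F x * Re (g x)) \<partial>M)" .
    have "integrable M (\<lambda>x. \<Sum>i\<in>I. f i * (V x * (er i x * Re (g x))))"
      using Re_wip_e(2)[OF g] by (intro Bochner_Integration.integrable_sum) auto
    then show "integrable M (\<lambda>x. V x * (F x * Re (g x)))"
      by (simp add: F_def sum_distrib_left sum_distrib_right mult_ac)
  qed
  define X Y Z where "X = (\<lambda>x. cmod (u x) powr q)" and "Y = (\<lambda>x. V x * (F x)\<^sup>2)"
    and "Z = (\<lambda>x. V x * (F x * V x powr ((\<kappa> - 1) / 2)))"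
  have Xi: "integrable M X" using sob_q[OF ud] by (simp add: Lp_space_def X_def)
  have Yi: "integrable M Y" using L2w_int[OF FcL] by (simp add: Y_def cF)
  have Zi: "integrable M Z" using pair_int[OF hV_L2] by (simp add: Z_def hV_def)
  have nn: "0 \<le> X x" "0 \<le> Y x" "0 \<le> Z x" for x
    using F0[of x] V_nonneg[of x] by (auto simp: X_def Y_def Z_def)
  have ex: "0 < 1 / q" "0 < 1 / \<kappa>" "1 / q + 1 / q + 1 / \<kappa> = 1"
    using q_facts kappa by (auto simp: field_simps)
  have pt: "X x powr (1 / q) * Y x powr (1 / q) * Z x powr (1 / \<kappa>) = V x * (F x * cmod (u x))" for x
  proof (cases "V x = 0 \<or> F x = 0")
    case True
    then show ?thesis using ex by (auto simp: Y_def)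
  next
    case False
    then have p: "0 < V x" "0 < F x" using V_nonneg[of x] F0[of x] by auto
    have x1: "X x powr (1 / q) = cmod (u x)" using q_facts(1) by (simp add: X_def powr_powr)
    have y1: "Y x powr (1 / q) = V x powr (1 / q) * F x powr (2 / q)"
    proof -
      have "(F x)\<^sup>2 powr (1 / q) = (F x powr 2) powr (1 / q)" using p by simp
      also have "\<dots> = F x powr (2 / q)" unfolding powr_powr by simp
      finally show ?thesis using p by (simp add: Y_def powr_mult)
    qed
    have z1: "Z x powr (1 / \<kappa>) = V x powr (1 / \<kappa> + (\<kappa> - 1) / 2 * (1 / \<kappa>)) * F x powr (1 / \<kappa>)"
      using p by (simp add: Z_def powr_mult powr_powr powr_add)
    have "1 / q + (1 / \<kappa> + (\<kappa> - 1) / 2 * (1 / \<kappa>)) = 1" "2 / q + 1 / \<kappa> = 1"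
      using q_facts kappa by (auto simp: field_simps)
    then have v: "V x powr (1 / q) * V x powr (1 / \<kappa> + (\<kappa> - 1) / 2 * (1 / \<kappa>)) = V x"
      and w: "F x powr (2 / q) * F x powr (1 / \<kappa>) = F x"
      using p by (simp_all only: powr_add[symmetric] powr_one)
    have "X x powr (1 / q) * Y x powr (1 / q) * Z x powr (1 / \<kappa>)
        = cmod (u x) * (V x powr (1 / q) * V x powr (1 / \<kappa> + (\<kappa> - 1) / 2 * (1 / \<kappa>)))
            * (F x powr (2 / q) * F x powr (1 / \<kappa>))"
      unfolding x1 y1 z1 by (simp only: mult_ac)
    then show ?thesis unfolding v w by (simp only: mult_ac)
  qed
  have Pi: "integrable M (\<lambda>x. V x * (F x * cmod (u x)))"
    using holder3(1)[OF Xi nn(1) Yi nn(2) Zi nn(3) ex(1) ex(1) ex(2) ex(3)] unfolding pt .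
  have "\<bar>\<Sum>i\<in>I. f i * Re (wip M V (e i) u)\<bar> = \<bar>\<integral>x. V x * (F x * Re (u x)) \<partial>M\<bar>"
    by (simp only: pair[OF uL])
  also have "\<dots> \<le> (\<integral>x. \<bar>V x * (F x * Re (u x))\<bar> \<partial>M)" by (rule integral_abs_bound)
  also have "\<dots> \<le> (\<integral>x. V x * (F x * cmod (u x)) \<partial>M)"
  proof (rule integral_mono[OF _ Pi])
    show "integrable M (\<lambda>x. \<bar>V x * (F x * Re (u x))\<bar>)" using pair_int[OF uL] by (rule integrable_abs)
    show "\<bar>V x * (F x * Re (u x))\<bar> \<le> V x * (F x * cmod (u x))" for x
      using V_nonneg[of x] F0[of x] abs_Re_le_cmod[of "u x"] by (simp add: abs_mult mult_left_mono)
  qed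
  also have "\<dots> \<le> (\<integral>x. X x \<partial>M) powr (1 / q) * (\<integral>x. Y x \<partial>M) powr (1 / q) * (\<integral>x. Z x \<partial>M) powr (1 / \<kappa>)"
    using holder3(2)[OF Xi nn(1) Yi nn(2) Zi nn(3) ex(1) ex(1) ex(2) ex(3)] unfolding pt .
  finally have "\<bar>\<Sum>i\<in>I. f i * Re (wip M V (e i) u)\<bar>\<^sup>2
      \<le> ((\<integral>x. X x \<partial>M) powr (1 / q) * (\<integral>x. Y x \<partial>M) powr (1 / q) * (\<integral>x. Z x \<partial>M) powr (1 / \<kappa>))\<^sup>2"
    by (rule power_mono) simp
  also have "\<dots> = (\<integral>x. X x \<partial>M) powr (2 / q) * (\<integral>x. Y x \<partial>M) powr (2 / q) * (\<integral>x. Z x \<partial>M) powr (2 / \<kappa>)"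
  proof -
    have "(y powr (1 / p))\<^sup>2 = y powr (2 / p)" for y p :: real
      by (simp add: power2_eq_square flip: powr_add add_divide_distrib)
    then show ?thesis by (simp only: power_mult_distrib)
  qed
  also have "(\<integral>x. Y x \<partial>M) = (\<Sum>i\<in>I. (f i)\<^sup>2)"
  proof -
    have "(\<integral>x. Y x \<partial>M) = wsq M V Fc" by (simp add: Y_def wsq_def cF)
    also have "\<dots> = (\<Sum>i\<in>I. (cmod (complex_of_real (f i)))\<^sup>2)"
      unfolding Fc_def by (rule wsq_orthonormal_sum[OF e_orth e_L2 finite_I])
    finally show ?thesis by simp
  qed
  also have "(\<integral>x. Z x \<partial>M) = (\<Sum>i\<in>I. f i * b i)"
    using pair[OF hV_L2] by (simp add: Z_def b_def hV_def)
  also have "2 / q = 1 - 1 / \<kappa>" by (rule q_facts(2))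
  finally have "(\<Sum>i\<in>I. f i * Re (wip M V (e i) u))\<^sup>2
      \<le> (\<integral>x. X x \<partial>M) powr (1 - 1 / \<kappa>) * ((\<Sum>i\<in>I. (f i)\<^sup>2) powr (1 - 1 / \<kappa>) * (\<Sum>i\<in>I. f i * b i) powr (2 / \<kappa>))"
    by (simp add: mult.assoc)
  also have "\<dots> \<le> (quad t u + \<delta> * wsq M one u) / S * ((\<Sum>i\<in>I. (f i)\<^sup>2) powr (1 - 1 / \<kappa>) * (\<Sum>i\<in>I. f i * b i) powr (2 / \<kappa>))"
    using sob[OF ud] S_pos unfolding q_facts(2) X_def
    by (intro mult_right_mono) (auto simp: field_simps)
  finally show ?thesis by (simp only: mult.assoc)
qed

sublocale matrix: nash_matrix I \<rho> b \<kappa> "1 / (\<epsilon> * S)" Vk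
proof
  fix x f :: "(nat \<Rightarrow> int \<times> int) \<Rightarrow> real"
  define u where "u = (\<lambda>y. \<Sum>k\<in>I. complex_of_real (x k) * rr k y)"
  note c = resolvent_combination[of x, folded u_def]
  have qn: "0 \<le> quad t u + \<delta> * wsq M one u"
    using T.quad_nonneg[of u] T.W1.wsq_nonneg[of u] delta c(1) Dr_dom by auto
  show "(\<Sum>i\<in>I. (mv I \<rho> x i)\<^sup>2) \<le> (\<Sum>i\<in>I. x i * mv I \<rho> x i)"
    using c(2,3) mult_nonneg_nonneg[OF less_imp_le[OF eps] qn] by linarith
  assume f: "\<And>i. i \<in> I \<Longrightarrow> 0 \<le> f i"
  define B where "B = (\<Sum>i\<in>I. (f i)\<^sup>2) powr (1 - 1 / \<kappa>) * (\<Sum>i\<in>I. f i * b i) powr (2 / \<kappa>)"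
  have B: "0 \<le> B" by (simp add: B_def)
  have "(\<Sum>i\<in>I. f i * mv I \<rho> x i)\<^sup>2 \<le> (quad t u + \<delta> * wsq M one u) / S * B"
    unfolding mv_rho u_def[symmetric] B_def using weighted_pairing_le[OF f c(1)] by (simp only: mult.assoc)
  also have "\<dots> = 1 / (\<epsilon> * S) * B * (\<epsilon> * (quad t u + \<delta> * wsq M one u))"
    using eps S_pos by (simp add: field_simps)
  also have "\<dots> \<le> 1 / (\<epsilon> * S) * B * ((\<Sum>i\<in>I. x i * mv I \<rho> x i) - (\<Sum>i\<in>I. (mv I \<rho> x i)\<^sup>2))"
    using c(2,3) B eps S_pos by (intro mult_left_mono) auto
  finally show "(\<Sum>i\<in>I. f i * mv I \<rho> x i)\<^sup>2
      \<le> 1 / (\<epsilon> * S) * (\<Sum>i\<in>I. (f i)\<^sup>2) powr (1 - 1 / \<kappa>) * (\<Sum>i\<in>I. f i * b i) powr (2 / \<kappa>)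
         * ((\<Sum>i\<in>I. x i * mv I \<rho> x i) - (\<Sum>i\<in>I. (mv I \<rho> x i)\<^sup>2))"
    unfolding B_def by (simp only: mult.assoc)
qed (use finite_I kappa eps S_pos rho_sym rho_nonneg b_nonneg b_le in auto)

text \<open>The coefficients of the projections of \<open>w j\<close> to the span of the basis functions.\<close>

definition c :: "nat \<Rightarrow> (nat \<Rightarrow> int \<times> int) \<Rightarrow> complex" where
  "c j i = wip M V (e i) (w j)"

lemma c_bessel: "(\<Sum>j<N. (cmod (\<Sum>i\<in>I. cnj (d i) * c j i))\<^sup>2) \<le> (\<Sum>i\<in>I. (cmod (d i))\<^sup>2)"
proof -
  define F where "F = (\<lambda>x. \<Sum>i\<in>I. d i * e i x)"
  have F: "F \<in> L2w M V" unfolding F_def by (intro L2w_sum L2w_scale e_L2)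
  have "(\<Sum>j<N. (cmod (\<Sum>i\<in>I. cnj (d i) * c j i))\<^sup>2) = (\<Sum>j<N. (cmod (wip M V (w j) F))\<^sup>2)"
  proof (intro sum.cong refl)
    fix j assume "j \<in> {..<N}"
    then have wj: "w j \<in> L2w M V" by (simp add: w_L2)
    have "(\<Sum>i\<in>I. cnj (d i) * c j i) = wip M V F (w j)"
      unfolding F_def c_def by (rule wip_sum_left[OF wj e_L2, symmetric])
    also have "\<dots> = cnj (wip M V (w j) F)" by (rule wip_cnj)
    finally show "(cmod (\<Sum>i\<in>I. cnj (d i) * c j i))\<^sup>2 = (cmod (wip M V (w j) F))\<^sup>2" by simp
  qed
  also have "\<dots> \<le> wsq M V F"
    by (rule bessel[of "{..<N}" w, OF _ _ _ F]) (auto simp: w_orth w_L2)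
  also have "\<dots> = (\<Sum>i\<in>I. (cmod (d i))\<^sup>2)"
    unfolding F_def by (rule wsq_orthonormal_sum[OF e_orth e_L2 finite_I])
  finally show ?thesis .
qed

lemma c_le_1: "j < N \<Longrightarrow> (\<Sum>i\<in>I. (cmod (c j i))\<^sup>2) \<le> 1"
  using bessel[OF e_orth e_L2 finite_I w_L2] by (simp add: c_def wsq_w)

text \<open>The corner of the grid cell \<open>i\<close> in the \<open>j\<close>-th coordinate.\<close>

definition \<theta>0 :: "nat \<Rightarrow> (nat \<Rightarrow> int \<times> int) \<Rightarrow> complex" where
  "\<theta>0 j i = Complex (real_of_int (fst (i j)) / real L) (real_of_int (snd (i j)) / real L)"

lemma theta_close:
  assumes "j < N" "cell i x"
  shows "(cmod (\<theta> j x - \<theta>0 j i))\<^sup>2 \<le> 2 / (real L)\<^sup>2"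
proof -
  have k: "fst (i j) = \<lfloor>real L * Re (\<theta> j x)\<rfloor>" "snd (i j) = \<lfloor>real L * Im (\<theta> j x)\<rfloor>"
    using assms by (auto simp: cell_def key_def prod_eq_iff)
  have a: "(y - real_of_int \<lfloor>real L * y\<rfloor> / real L)\<^sup>2 \<le> 1 / (real L)\<^sup>2" for y
  proof -
    have "y - real_of_int \<lfloor>real L * y\<rfloor> / real L = (real L * y - real_of_int \<lfloor>real L * y\<rfloor>) / real L"
      using L_pos by (simp add: field_simps)
    moreover have "(real L * y - real_of_int \<lfloor>real L * y\<rfloor>)\<^sup>2 \<le> 1\<^sup>2"
      by (intro power_mono) linarith+
    ultimately show ?thesis by (simp add: power_divide divide_right_mono)
  qed
  have "(cmod (\<theta> j x - \<theta>0 j i))\<^sup>2 = (Re (\<theta> j x - \<theta>0 j i))\<^sup>2 + (Im (\<theta> j x - \<theta>0 j i))\<^sup>2"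
    by (rule cmod_power2)
  also have "\<dots> \<le> 1 / (real L)\<^sup>2 + 1 / (real L)\<^sup>2"
    using a[of "Re (\<theta> j x)"] a[of "Im (\<theta> j x)"] by (simp add: \<theta>0_def k)
  finally show ?thesis by simp
qed

text \<open>The projection of \<open>w j\<close> is at least as close to \<open>w j\<close> as the function obtained by replacing \<open>\<theta> j\<close> by the corner of its cell.\<close>

lemma c_ge:
  assumes j: "j < N"
  shows "1 - 2 * real N / (real L)\<^sup>2 \<le> (\<Sum>i\<in>I. (cmod (c j i))\<^sup>2)"
proof -
  define d where "d = (\<lambda>i. \<theta>0 j i * complex_of_real (m i))"
  define g where "g = (\<lambda>x. w j x - (\<Sum>i\<in>I. d i * e i x))"
  have gL: "g \<in> L2w M V" unfolding g_def by (intro L2w_diff L2w_sum L2w_scale e_L2 w_L2 j)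
  have de: "d i * e i x = \<theta>0 j i * complex_of_real (\<phi> i x)" if "i \<in> I" for i x
    using that by (simp add: d_def e_def er_def I_def)
  \<comment> \<open>cells that are left out of \<open>I\<close> do not contribute\<close>
  have null: "AE x in M. \<forall>i\<in>I0 - I. V x * (\<phi> i x)\<^sup>2 = 0"
  proof (rule AE_finite_allI)
    show "finite (I0 - I)" using finite_I0 by simp
    fix i assume "i \<in> I0 - I"
    then have "(\<integral>x. V x * (\<phi> i x)\<^sup>2 \<partial>M) = 0" using m_sq[of i] by (simp add: I_def)
    then show "AE x in M. V x * (\<phi> i x)\<^sup>2 = 0"
      using integral_nonneg_eq_0_iff_AE[OF phi_int[of i]] V_nonneg by simp
  qed
  have "wsq M V g \<le> (\<integral>x. 2 / (real L)\<^sup>2 * (V x * (W x)\<^sup>2) \<partial>M)"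
    unfolding wsq_def
  proof (rule integral_mono_AE[OF L2w_int[OF gL]])
    show "integrable M (\<lambda>x. 2 / (real L)\<^sup>2 * (V x * (W x)\<^sup>2))" using W_int by simp
    show "AE x in M. V x * (cmod (g x))\<^sup>2 \<le> 2 / (real L)\<^sup>2 * (V x * (W x)\<^sup>2)"
      using null
    proof eventually_elim
      case (elim x)
      obtain i0 where i0: "i0 \<in> I0" "cell i0 x" using cell_exists by blast
      have other: "\<phi> i x = 0" if "i \<in> I0" "i \<noteq> i0" for i
        using that i0 cell_unique[of i i0 x] by (auto simp: \<phi>_def)
      show ?case
      proof (cases "i0 \<in> I")
        case True
        have "(\<Sum>i\<in>I. d i * e i x) = (\<Sum>i\<in>I. if i = i0 then \<theta>0 j i0 * complex_of_real (W x) else 0)"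
          using i0 other by (intro sum.cong) (auto simp: de \<phi>_def I_def)
        also have "\<dots> = \<theta>0 j i0 * complex_of_real (W x)" using True finite_I by simp
        finally have "g x = complex_of_real (W x) * (\<theta> j x - \<theta>0 j i0)"
          by (simp add: g_def w_eq[OF j] algebra_simps)
        then have "(cmod (g x))\<^sup>2 = (W x)\<^sup>2 * (cmod (\<theta> j x - \<theta>0 j i0))\<^sup>2"
          by (simp add: norm_mult power_mult_distrib)
        also have "\<dots> \<le> (W x)\<^sup>2 * (2 / (real L)\<^sup>2)"
          by (intro mult_left_mono theta_close[OF j i0(2)]) simp
        finally show ?thesis
          using mult_left_mono[OF _ V_nonneg[of x], of "(cmod (g x))\<^sup>2" "(W x)\<^sup>2 * (2 / (real L)\<^sup>2)"]
          by (simp add: mult_ac)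
      next
        case False
        then have "V x * (\<phi> i0 x)\<^sup>2 = 0" using elim i0 by blast
        then have "V x * (W x)\<^sup>2 = 0" using i0 by (simp add: \<phi>_def)
        then have "V x = 0 \<or> W x = 0" by simp
        moreover have "(\<Sum>i\<in>I. d i * e i x) = 0"
          using False other by (intro sum.neutral) (auto simp: de I_def)
        ultimately have "V x = 0 \<or> g x = 0"
          by (auto simp: g_def w_eq[OF j])
        then show ?thesis using V_nonneg[of x] by auto
      qed
    qed
  qed
  also have "\<dots> = 2 * real N / (real L)\<^sup>2" by (simp add: W_integral)
  finally have le: "wsq M V g \<le> 2 * real N / (real L)\<^sup>2" .
  have "wsq M V g = wsq M V (w j) - (\<Sum>i\<in>I. (cmod (c j i))\<^sup>2) + (\<Sum>i\<in>I. (cmod (c j i - d i))\<^sup>2)"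
    unfolding g_def c_def by (rule wsq_diff_combination[OF e_orth e_L2 finite_I w_L2[OF j]])
  then have "wsq M V g = 1 - (\<Sum>i\<in>I. (cmod (c j i))\<^sup>2) + (\<Sum>i\<in>I. (cmod (c j i - d i))\<^sup>2)"
    by (simp only: wsq_w[OF j])
  moreover have "0 \<le> (\<Sum>i\<in>I. (cmod (c j i - d i))\<^sup>2)" by (intro sum_nonneg) simp
  ultimately show ?thesis using le by linarith
qed

text \<open>With \<open>f\<close> the projection of \<open>w j\<close> and \<open>u\<close> its magnetic resolvent, this is the minimality of \<open>u\<close>, compared with \<open>w j\<close>:
the energy of \<open>w j - u\<close> is nonnegative.\<close>

lemma c_sigma:
  assumes j: "j < N"
  shows "1 - \<epsilon> - 4 * real N / (real L)\<^sup>2 \<le> Re (\<Sum>i\<in>I. cnj (c j i) * mv I \<sigma> (c j) i)"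
proof -
  interpret real_function_space "form_dom tA" "A.energy \<epsilon> \<delta> V"
    by (rule A.energy_function_space[OF weight_V eps delta order_refl])
       (use A_weighted(1) A.dom_add A.dom_scale A.dom_zero in auto)
  define u where "u = (\<lambda>x. \<Sum>k\<in>I. c j k * ra k x)"
  define f where "f = (\<lambda>x. \<Sum>k\<in>I. c j k * e k x)"
  have u: "u \<in> form_dom tA" unfolding u_def by (rule A.dom_sum[OF ra(1)])
  have uL: "u \<in> L2w M V" by (rule A_weighted(1)[OF u])
  have E: "A.energy \<epsilon> \<delta> V v u = Re (wip M V v f)" if v: "v \<in> form_dom tA" for v
  proof -
    have vL: "v \<in> L2w M V" by (rule A_weighted(1)[OF v])
    have "complex_of_real \<epsilon> * (sesq tA v u + complex_of_real \<delta> * wip M one v u) + wip M V v u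
        = (\<Sum>k\<in>I. c j k * (complex_of_real \<epsilon> * (sesq tA v (ra k) + complex_of_real \<delta> * wip M one v (ra k)) + wip M V v (ra k)))"
      unfolding u_def A.sesq_sum[OF v ra(1)] wip_sum_right[OF vL ra_L2]
        T.W1.wip_sum_right[OF A.dom_L2[OF v] A.dom_L2[OF ra(1)]]
      by (simp add: sum_distrib_left sum.distrib algebra_simps)
    also have "\<dots> = (\<Sum>k\<in>I. c j k * wip M V v (e k))" unfolding ra(2)[OF v] ..
    also have "\<dots> = wip M V v f" unfolding f_def by (rule wip_sum_right[OF vL e_L2, symmetric])
    finally have "Re (complex_of_real \<epsilon> * (sesq tA v u + complex_of_real \<delta> * wip M one v u) + wip M V v u)
        = Re (wip M V v f)" by simp
    then show ?thesis by (simp add: A.energy_def)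
  qed
  have wf: "Re (wip M V (w j) f) = (\<Sum>i\<in>I. (cmod (c j i))\<^sup>2)"
  proof -
    have "wip M V (w j) f = (\<Sum>i\<in>I. c j i * wip M V (w j) (e i))"
      unfolding f_def by (rule wip_sum_right[OF w_L2[OF j] e_L2])
    also have "\<dots> = (\<Sum>i\<in>I. cnj (c j i) * c j i)"
      by (intro sum.cong refl) (simp add: c_def wip_cnj[of "w j"] mult.commute)
    also have "\<dots> = complex_of_real (\<Sum>i\<in>I. (cmod (c j i))\<^sup>2)" by (rule sum_cnj_self)
    finally show ?thesis by simp
  qed
  have fu: "Re (wip M V u f) = Re (\<Sum>i\<in>I. cnj (c j i) * mv I \<sigma> (c j) i)"
  proof -
    have "(\<Sum>i\<in>I. cnj (c j i) * mv I \<sigma> (c j) i) = (\<Sum>i\<in>I. cnj (c j i) * wip M V (e i) u)"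
      unfolding u_def wip_sum_right[OF e_L2 ra_L2] mv_def \<sigma>_def by (simp add: mult.commute)
    also have "\<dots> = wip M V f u" unfolding f_def by (rule wip_sum_left[OF uL e_L2, symmetric])
    finally show ?thesis using Re_wip_commute[of u f] by simp
  qed
  have "0 \<le> A.energy \<epsilon> \<delta> V (\<lambda>x. w j x - u x) (\<lambda>x. w j x - u x)"
    by (rule b_nonneg[OF diff[OF w_dom[OF j] u]])
  also have "\<dots> = A.energy \<epsilon> \<delta> V (w j) (w j) - 2 * A.energy \<epsilon> \<delta> V (w j) u + A.energy \<epsilon> \<delta> V u u"
    by (rule b_diff_self[OF w_dom[OF j] u])
  also have "A.energy \<epsilon> \<delta> V (w j) (w j) = \<epsilon> * (quad tA (w j) + \<delta> * wsq M one (w j)) + 1"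
    by (simp add: A.energy_self[OF weight_V] wsq_w[OF j])
  finally have "0 \<le> \<epsilon> * (quad tA (w j) + \<delta> * wsq M one (w j)) + 1 - 2 * (\<Sum>i\<in>I. (cmod (c j i))\<^sup>2) + Re (wip M V u f)"
    unfolding E[OF u] E[OF w_dom[OF j]] wf .
  moreover have "\<epsilon> * (quad tA (w j) + \<delta> * wsq M one (w j)) \<le> \<epsilon>"
    using w_le[OF j] eps by (simp add: mult_left_le)
  moreover have "1 - 2 * real N / (real L)\<^sup>2 \<le> (\<Sum>i\<in>I. (cmod (c j i))\<^sup>2)" by (rule c_ge[OF j])
  ultimately show ?thesis unfolding fu by linarith
qed

lemma iteration_bound:
  assumes r: "r = 1 - \<epsilon> - 4 * real N / (real L)\<^sup>2" "0 < r" and N: "0 < N" and n: "1 \<le> n" and c0: "0 < c0"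
  shows "(2 * \<epsilon> * real N * r ^ (2 * n + 2) / (1 - r\<^sup>2)) powr (1 / (\<kappa> - 1) + \<kappa> / (\<kappa> - 1) / real n)
     \<le> c0 powr (\<kappa> / (\<kappa> - 1)) / (2 * \<epsilon> * (1 / (\<kappa> - 1)) * real n)
        * (c0 powr (\<kappa> / (\<kappa> - 1)) * (2 * real L + 1) ^ (2 * N)) powr (1 / real n)"
proof -
  have r1: "r < 1"
  proof -
    have "0 \<le> 4 * real N / (real L)\<^sup>2" by simp
    then show ?thesis using eps r(1) by linarith
  qed
  have "(2 * \<epsilon> * real N * r ^ (2 * n + 2) / (1 - r\<^sup>2)) powr (1 / (\<kappa> - 1) + \<kappa> / (\<kappa> - 1) / real n)
     \<le> c0 powr (\<kappa> / (\<kappa> - 1)) / (2 * \<epsilon> * (1 / (\<kappa> - 1)) * real n)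
        * (c0 powr (\<kappa> / (\<kappa> - 1)) * hs_power I \<rho> 0) powr (1 / real n)"
  proof (rule nash_iteration[OF kappa c0 _ _ r(2) r1 hs_power_nonneg _ _ n])
    show "real N * r ^ (2 * k) \<le> hs_power I \<rho> k" if "1 \<le> k" for k
      by (rule hs_power_ge[OF finite_I sigma_herm sigma_le_rho c_bessel c_le_1 r(2) _ that])
         (use c_sigma r(1) in auto)
    show "2 * \<epsilon> * (\<Sum>k<K. hs_power I \<rho> (k + n + 1)) \<le> c0 * hs_power I \<rho> n powr (1 - 1 / \<kappa>)" for n K
    proof -
      have "\<epsilon> * (2 * (\<Sum>k<K. hs_power I \<rho> (k + n + 1)))
          \<le> \<epsilon> * (1 / (\<epsilon> * S) * Vk powr (1 / \<kappa>) * hs_power I \<rho> n powr (1 - 1 / \<kappa>))"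
        using eps by (intro mult_left_mono matrix.hs_power_sum_le) auto
      also have "\<dots> = c0 * hs_power I \<rho> n powr (1 - 1 / \<kappa>)"
        using eps by (simp add: c0_def)
      finally show ?thesis by (simp only: mult_ac)
    qed
  qed (use eps N in auto)
  also have "\<dots> \<le> c0 powr (\<kappa> / (\<kappa> - 1)) / (2 * \<epsilon> * (1 / (\<kappa> - 1)) * real n)
        * (c0 powr (\<kappa> / (\<kappa> - 1)) * (2 * real L + 1) ^ (2 * N)) powr (1 / real n)"
    using card_I eps kappa n by (intro mult_left_mono powr_mono2) (auto simp: hs_power_0[OF finite_I])
  finally show ?thesis .
qed

end

context clr_setting
begin

text \<open>The discretization is used with mesh \<open>1/L = 1/n\<close> and \<open>\<epsilon> = (\<kappa> - 1) / (2n)\<close>, and \<open>n\<close> tends to infinity.\<close>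

lemma orthonormal_family_bound:
  assumes w_dom: "\<And>j. j < N \<Longrightarrow> w j \<in> form_dom tA"
    and w_orth: "\<And>j k. j < N \<Longrightarrow> k < N \<Longrightarrow> wip M V (w j) (w k) = (if j = k then 1 else 0)"
    and w_le: "\<And>j. j < N \<Longrightarrow> quad tA (w j) + \<delta> * wsq M one (w j) \<le> 1"
  shows "real N \<le> exp (\<kappa> - 1) * S powr (- \<kappa>) * Vk"
proof (cases "N = 0")
  case True
  then show ?thesis using Vk_nonneg by simp
next
  case False
  then have N: "0 < N" by simp
  have wL: "w 0 \<in> L2w M V" by (rule A_weighted(1)[OF w_dom[OF N]])
  have "1 = wsq M V (w 0)" using w_orth[OF N N] wip_self[of "w 0"] by (metis of_real_eq_1_iff)
  also have "\<dots> \<le> c0 * (quad tA (w 0) + \<delta> * wsq M one (w 0))" by (rule A_weighted(2)[OF w_dom[OF N]])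
  finally have "c0 \<noteq> 0" by auto
  moreover have "0 \<le> c0" using S_pos by (simp add: c0_def)
  ultimately have c0: "0 < c0" by simp
  have "real N \<le> exp (\<kappa> - 1) * c0 powr \<kappa>"
  proof (rule nash_limit[OF kappa c0, where B = "4 * real N" and J = "real (2 * N)"])
    define rf where "rf = (\<lambda>n. 1 - (\<kappa> - 1) / (2 * real n) - 4 * real N / (real n)\<^sup>2)"
    have "rf \<longlonglongrightarrow> 1" unfolding rf_def by real_asymp
    then have "\<forall>\<^sub>F n in sequentially. 0 < rf n" by (rule order_tendstoD(1)) simp
    then show "\<forall>\<^sub>F n in sequentially. 
      (let \<epsilon> = (\<kappa> - 1) / (2 * real n); r = 1 - \<epsilon> - 4 * real N / (real n)\<^sup>2 in
       (2 * \<epsilon> * real N * r ^ (2 * n + 2) / (1 - r\<^sup>2)) powr (1 / (\<kappa> - 1) + \<kappa> / (\<kappa> - 1) / real n)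
           \<le> c0 powr (\<kappa> / (\<kappa> - 1)) * (c0 powr (\<kappa> / (\<kappa> - 1)) * (2 * real n + 1) powr real (2 * N)) powr (1 / real n))"
      using eventually_gt_at_top[of 0]
    proof eventually_elim
      case (elim n)
      define \<epsilon> where "\<epsilon> = (\<kappa> - 1) / (2 * real n)"
      have \<epsilon>: "0 < \<epsilon>" using kappa elim by (simp add: \<epsilon>_def)
      interpret D: clr_discretization M t tA V \<kappa> q S \<delta> w N n \<epsilon>
        by unfold_locales (use \<epsilon> elim w_dom w_orth w_le in auto)
      have one: "2 * \<epsilon> * (1 / (\<kappa> - 1)) * real n = 1" using kappa elim by (simp add: \<epsilon>_def)
      have pw: "(2 * real n + 1) powr real (2 * N) = (2 * real n + 1) ^ (2 * N)"
        by (rule powr_realpow) simp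
      have r: "0 < 1 - \<epsilon> - 4 * real N / (real n)\<^sup>2" using elim by (simp add: rf_def \<epsilon>_def)
      show ?case
        using D.iteration_bound[OF refl r N _ c0, of n] elim
        unfolding Let_def \<epsilon>_def[symmetric] pw one by simp
    qed
  qed (use N in auto)
  also have "c0 powr \<kappa> = S powr (- \<kappa>) * Vk"
    using kappa S_pos Vk_nonneg by (simp add: c0_def powr_divide powr_powr powr_minus field_simps)
  finally show ?thesis by simp
qed

end

section \<open>From finite orthonormal families to eigenvalue counts\<close>

lemma fun_subspace_zero: "fun_subspace W \<Longrightarrow> (\<lambda>x. 0) \<in> W"
  and fun_subspace_add: "fun_subspace W \<Longrightarrow> u \<in> W \<Longrightarrow> v \<in> W \<Longrightarrow> (\<lambda>x. u x + v x) \<in> W"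
  and fun_subspace_scale: "fun_subspace W \<Longrightarrow> u \<in> W \<Longrightarrow> (\<lambda>x. c * u x) \<in> W"
  by (simp_all add: fun_subspace_def)

lemma fun_subspace_sum:
  assumes W: "fun_subspace W"
  shows "(\<And>i. i \<in> I \<Longrightarrow> u i \<in> W) \<Longrightarrow> (\<lambda>x. \<Sum>i\<in>I. c i * u i x) \<in> W"
proof (induction I rule: infinite_finite_induct)
  case (insert j I)
  have "(\<lambda>x. c j * u j x + (\<Sum>i\<in>I. c i * u i x)) \<in> W"
    using insert by (intro fun_subspace_add[OF W] fun_subspace_scale[OF W]) auto
  then show ?case using insert by simp
qed (auto simp: fun_subspace_zero[OF W])

lemma (in weight) gram_schmidt:
  fixes n :: nat and u :: "nat \<Rightarrow> 'a \<Rightarrow> complex"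
  assumes W: "fun_subspace W" "W \<subseteq> L2w M V"
    and pos: "\<And>u. u \<in> W \<Longrightarrow> \<not> (AE x in M. u x = 0) \<Longrightarrow> 0 < wsq M V u"
  shows "(\<And>i. i < n \<Longrightarrow> u i \<in> W) \<Longrightarrow>
    (\<And>c. AE x in M. (\<Sum>i<n. c i * u i x) = 0 \<Longrightarrow> \<forall>i<n. c i = 0) \<Longrightarrow>
    \<exists>w. (\<forall>j<n. w j \<in> W \<and> (\<exists>c. w j = (\<lambda>x. \<Sum>i<n. c i * u i x))) \<and>
      (\<forall>j<n. \<forall>k<n. wip M V (w j) (w k) = (if j = k then 1 else 0))"
proof (induction n)
  case (Suc n)
  have uW: "u i \<in> W" if "i < Suc n" for i using Suc.prems(1) that .
  have ind: "\<forall>i<n. c i = 0" if "AE x in M. (\<Sum>i<n. c i * u i x) = 0" for c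
  proof -
    have "AE x in M. (\<Sum>i<Suc n. (if i < n then c i else 0) * u i x) = 0"
      using that by simp
    from Suc.prems(2)[OF this] have "(if i < n then c i else 0) = 0" if "i < Suc n" for i
      using that by blast
    then show ?thesis by (metis less_SucI)
  qed
  have "\<exists>w. (\<forall>j<n. w j \<in> W \<and> (\<exists>c. w j = (\<lambda>x. \<Sum>i<n. c i * u i x))) \<and>
      (\<forall>j<n. \<forall>k<n. wip M V (w j) (w k) = (if j = k then 1 else 0))"
    by (rule Suc.IH[OF uW ind]) auto
  then obtain w where w: "\<forall>j<n. w j \<in> W \<and> (\<exists>c. w j = (\<lambda>x. \<Sum>i<n. c i * u i x))"
    and orth: "\<forall>j<n. \<forall>k<n. wip M V (w j) (w k) = (if j = k then 1 else 0)"
    by (elim exE conjE)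
  have "\<forall>j\<in>{..<n}. \<exists>c. w j = (\<lambda>x. \<Sum>i<n. c i * u i x)" using w by simp
  from bchoice[OF this] obtain C where "\<forall>j\<in>{..<n}. w j = (\<lambda>x. \<Sum>i<n. C j i * u i x)" by (elim exE)
  then have C: "w j = (\<lambda>x. \<Sum>i<n. C j i * u i x)" if "j < n" for j using that by simp
  have wW: "w j \<in> W" if "j < n" for j using w that by blast
  have wL: "w j \<in> L2w M V" if "j < n" for j using wW[OF that] W(2) by blast
  define g where "g = (\<lambda>j. wip M V (w j) (u n))"
  define p where "p = (\<lambda>x. \<Sum>j<n. g j * w j x)"
  define v where "v = (\<lambda>x. u n x - p x)"
  have pW: "p \<in> W" unfolding p_def by (rule fun_subspace_sum[OF W(1)]) (simp add: wW)
  have vW: "v \<in> W"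
    using fun_subspace_add[OF W(1) uW fun_subspace_scale[OF W(1) pW, of "-1"], of n] by (simp add: v_def)
  have unL: "u n \<in> L2w M V" and vL: "v \<in> L2w M V" and pL: "p \<in> L2w M V"
    using uW[of n] vW pW W(2) by auto
  define d where "d = (\<lambda>i. if i = n then 1 else - (\<Sum>j<n. g j * C j i))"
  have v_span: "v = (\<lambda>x. \<Sum>i<Suc n. d i * u i x)"
  proof
    fix x
    have "p x = (\<Sum>j<n. \<Sum>i<n. g j * (C j i * u i x))"
      unfolding p_def by (intro sum.cong refl) (simp add: C sum_distrib_left)
    also have "\<dots> = (\<Sum>i<n. \<Sum>j<n. g j * (C j i * u i x))" by (rule sum.swap)
    also have "\<dots> = (\<Sum>i<n. - d i * u i x)"
      by (intro sum.cong refl) (auto simp: d_def sum_distrib_left sum_distrib_right mult_ac)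
    finally have "p x = - (\<Sum>i<n. d i * u i x)" by (simp add: sum_negf)
    moreover have "d n = 1" by (simp add: d_def)
    ultimately show "v x = (\<Sum>i<Suc n. d i * u i x)" by (simp add: v_def)
  qed
  have "\<not> (AE x in M. v x = 0)"
  proof
    assume "AE x in M. v x = 0"
    then have "AE x in M. (\<Sum>i<Suc n. d i * u i x) = 0" unfolding v_span .
    from Suc.prems(2)[OF this] have "d n = 0" by blast
    then show False by (simp add: d_def)
  qed
  then have vpos: "0 < wsq M V v" by (rule pos[OF vW])
  define s where "s = complex_of_real (1 / sqrt (wsq M V v))"
  define wn where "wn = (\<lambda>x. s * v x)"
  have orthv: "wip M V (w j) v = 0" if j: "j < n" for j
  proof -
    have "wip M V (w j) v = wip M V (w j) (u n) - wip M V (w j) p"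
      unfolding v_def by (rule wip_diff_right[OF wL[OF j] unL pL])
    also have "wip M V (w j) p = (\<Sum>k<n. g k * wip M V (w j) (w k))"
      unfolding p_def by (rule wip_sum_right[OF wL[OF j]]) (simp add: wL)
    also have "\<dots> = (\<Sum>k<n. if k = j then g j else 0)"
      using orth j by (intro sum.cong refl) auto
    also have "\<dots> = g j" using j by simp
    finally show ?thesis by (simp add: g_def)
  qed
  have o1: "wip M V (w j) wn = 0" "wip M V wn (w j) = 0" if "j < n" for j
    using orthv[OF that] wip_cnj[of wn "w j"] by (simp_all add: wn_def wip_scale_right)
  have o2: "wip M V wn wn = 1"
  proof -
    have "wsq M V wn = (cmod s)\<^sup>2 * wsq M V v" unfolding wn_def by (rule wsq_scale)
    also have "(cmod s)\<^sup>2 = 1 / wsq M V v"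
      using vpos unfolding s_def norm_of_real power2_abs by (simp add: power_divide)
    finally have "wsq M V wn = 1" using vpos by simp
    then show ?thesis by (simp add: wip_self)
  qed
  define w' where "w' = w(n := wn)"
  show ?case
  proof (intro exI[of _ w'] conjI allI impI)
    fix j assume j: "j < Suc n"
    show "w' j \<in> W"
      using j wW fun_subspace_scale[OF W(1) vW, of s] by (auto simp: w'_def wn_def less_Suc_eq)
    show "\<exists>c. w' j = (\<lambda>x. \<Sum>i<Suc n. c i * u i x)"
    proof (cases "j = n")
      case True
      have "w' j = (\<lambda>x. \<Sum>i<Suc n. (s * d i) * u i x)"
        unfolding w'_def wn_def v_span using True by (simp add: sum_distrib_left distrib_left mult.assoc)
      then show ?thesis by (rule exI[of _ "\<lambda>i. s * d i"])
    next
      case False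
      then have "j < n" using j by simp
      have "w' j = (\<lambda>x. \<Sum>i<Suc n. (if i < n then C j i else 0) * u i x)"
        using False C[OF \<open>j < n\<close>] by (simp add: w'_def)
      then show ?thesis by (rule exI[of _ "\<lambda>i. if i < n then C j i else 0"])
    qed
    fix k assume k: "k < Suc n"
    show "wip M V (w' j) (w' k) = (if j = k then 1 else 0)"
      using j k orth o1 o2 by (auto simp: w'_def less_Suc_eq)
  qed
qed auto

lemma nn_integral_wsq:
  assumes "weight M V" "u \<in> L2w M V"
  shows "(\<integral>\<^sup>+x. ennreal (V x * (cmod (u x))\<^sup>2) \<partial>M) = ennreal (wsq M V u)"
  unfolding wsq_def
  using assms by (intro nn_integral_eq_integral) (auto simp: weight.L2w_int weight.V_nonneg)

lemma integral_cmod_sq: "(\<integral>x. (cmod (u x))\<^sup>2 \<partial>M) = wsq M one u"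
  by (simp add: wsq_def)

text \<open>It suffices to bound the size of families which are orthonormal with respect to \<open>V dx\<close>: on an admissible subspace \<open>\<integral> V |u|\<^sup>2\<close> is positive definite, so that every basis can be orthonormalized.\<close>

lemma variational_count_le:
  assumes nn: "nonneg_form M tA" and V: "weight M V" and \<tau>: "0 \<le> \<tau>"
    and dom: "form_dom tA \<subseteq> L2w M V"
    and core: "\<And>N w. (\<And>j. j < N \<Longrightarrow> w j \<in> form_dom tA) \<Longrightarrow>
      (\<And>j k. j < N \<Longrightarrow> k < N \<Longrightarrow> wip M V (w j) (w k) = (if j = k then 1 else 0)) \<Longrightarrow>
      (\<And>j. j < N \<Longrightarrow> quad tA (w j) + \<tau> * wsq M one (w j) < 1) \<Longrightarrow> N \<le> D"
  shows "variational_count M tA V \<tau> \<le> enat D"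
proof -
  interpret V: weight M V by fact
  interpret A: nn_form M tA using nn by unfold_locales
  have "ae_dim M W \<le> enat D"
    if W: "fun_subspace W" "W \<subseteq> form_dom tA" and less: "\<forall>u\<in>W. \<not> (AE x in M. u x = 0) \<longrightarrow>
          ennreal (quad tA u + \<tau> * (\<integral>x. (cmod (u x))\<^sup>2 \<partial>M))
            < (\<integral>\<^sup>+x. ennreal (V x * (cmod (u x))\<^sup>2) \<partial>M)" for W
  proof -
    have lt: "quad tA u + \<tau> * wsq M one u < wsq M V u"
      if "u \<in> W" "\<not> (AE x in M. u x = 0)" for u
    proof -
      have "u \<in> L2w M V" using that(1) W(2) dom by blast
      from less[rule_format, OF that, unfolded integral_cmod_sq nn_integral_wsq[OF V this]]
      have "ennreal (quad tA u + \<tau> * wsq M one u) < ennreal (wsq M V u)" .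
      then show ?thesis
        using A.quad_nonneg[of u] A.W1.wsq_nonneg[of u] \<tau> that W(2) by (subst (asm) ennreal_less_iff) auto
    qed
    have pos: "0 < wsq M V u" if "u \<in> W" "\<not> (AE x in M. u x = 0)" for u
      using lt[OF that] A.quad_nonneg[of u] mult_nonneg_nonneg[OF \<tau> A.W1.wsq_nonneg[of u]] that W(2)
      by (smt (verit) subsetD)
    have "n \<le> D" if u: "\<forall>i<n. u i \<in> W"
      and ind: "\<forall>c. (AE x in M. (\<Sum>i<n. c i * u i x) = 0) \<longrightarrow> (\<forall>i<n. c i = 0)" for n u
    proof -
      have "\<exists>w. (\<forall>j<n. w j \<in> W \<and> (\<exists>c. w j = (\<lambda>x. \<Sum>i<n. c i * u i x))) \<and>
          (\<forall>j<n. \<forall>k<n. wip M V (w j) (w k) = (if j = k then 1 else 0))"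
      proof (rule V.gram_schmidt[OF W(1) _ pos])
        show "W \<subseteq> L2w M V" using W(2) dom by (rule order_trans)
        show "u i \<in> W" if "i < n" for i using u that by blast
        show "\<forall>i<n. c i = 0" if "AE x in M. (\<Sum>i<n. c i * u i x) = 0" for c
          using ind that by blast
      qed
      then obtain w where wW: "\<And>j. j < n \<Longrightarrow> w j \<in> W"
        and orth: "\<And>j k. j < n \<Longrightarrow> k < n \<Longrightarrow> wip M V (w j) (w k) = (if j = k then 1 else 0)"
        by auto
      show "n \<le> D"
      proof (rule core[where w=w, OF _ orth])
        fix j assume j: "j < n"
        show "w j \<in> form_dom tA" using wW[OF j] W(2) by blast
        have w1: "wsq M V (w j) = 1" using orth[OF j j] V.wip_self[of "w j"] by (metis of_real_eq_1_iff)
        have "\<not> (AE x in M. w j x = 0)"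
        proof
          assume ae: "AE x in M. w j x = 0"
          have m: "w j \<in> borel_measurable M" using wW[OF j] W(2) A.dom_meas by blast
          have "wip M V (w j) (w j) = wip M V (w j) (\<lambda>x. 0)"
            by (rule V.wip_cong_AE[OF m m m _ _ ae]) auto
          then show False using orth[OF j j] by (simp add: wip_def)
        qed
        then show "quad tA (w j) + \<tau> * wsq M one (w j) < 1" using lt[OF wW[OF j]] w1 by simp
      qed auto
    qed
    then show ?thesis unfolding ae_dim_def by (intro Sup_least) auto
  qed
  then show ?thesis unfolding variational_count_def by (intro Sup_least) blast
qed

lemma ae_dim_superadditive:
  assumes W: "W1 \<subseteq> W" "W2 \<subseteq> W" and sub: "fun_subspace W1" "fun_subspace W2"
    and indep: "\<And>a b. a \<in> W1 \<Longrightarrow> b \<in> W2 \<Longrightarrow> AE x in M. a x + b x = 0 \<Longrightarrow>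
       (AE x in M. a x = 0) \<and> (AE x in M. b x = 0)"
  shows "ae_dim M W1 + ae_dim M W2 \<le> ae_dim M W"
proof -
  define S where "S = (\<lambda>W. {n. \<exists>u :: nat \<Rightarrow> 'a \<Rightarrow> complex. (\<forall>i<n. u i \<in> W) \<and>
     (\<forall>c. (AE x in M. (\<Sum>i<n. c i * u i x) = 0) \<longrightarrow> (\<forall>i<n. c i = 0))})"
  have dim: "ae_dim M W = Sup (enat ` S W)" for W
    unfolding ae_dim_def S_def by (rule arg_cong[where f=Sup]) auto
  have zero: "0 \<in> S W" for W by (simp add: S_def)
  have key: "n1 + n2 \<in> S W" if n: "n1 \<in> S W1" "n2 \<in> S W2" for n1 n2
  proof -
    obtain u where u: "\<forall>i<n1. u i \<in> W1"
      and ui: "\<forall>c. (AE x in M. (\<Sum>i<n1. c i * u i x) = 0) \<longrightarrow> (\<forall>i<n1. c i = 0)"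
      using n(1) unfolding S_def mem_Collect_eq by (elim exE conjE)
    obtain v where v: "\<forall>i<n2. v i \<in> W2"
      and vi: "\<forall>c. (AE x in M. (\<Sum>i<n2. c i * v i x) = 0) \<longrightarrow> (\<forall>i<n2. c i = 0)"
      using n(2) unfolding S_def mem_Collect_eq by (elim exE conjE)
    define z where "z = (\<lambda>i. if i < n1 then u i else v (i - n1))"
    have "\<forall>i<n1 + n2. z i \<in> W" using u v W by (auto simp: z_def)
    moreover have "\<forall>i<n1 + n2. c i = 0" if c: "AE x in M. (\<Sum>i<n1 + n2. c i * z i x) = 0" for c
    proof -
      define a b where "a = (\<lambda>x. \<Sum>i<n1. c i * u i x)" and "b = (\<lambda>x. \<Sum>i<n2. c (n1 + i) * v i x)"
      have ab: "a \<in> W1" "b \<in> W2"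
        unfolding a_def b_def using u v by (auto intro!: fun_subspace_sum sub)
      have "(\<Sum>i<n1 + n2. c i * z i x) = a x + b x" for x
      proof -
        have "(\<Sum>i<n1 + n2. c i * z i x) = (\<Sum>i<n1. c i * z i x) + (\<Sum>i<n2. c (n1 + i) * z (n1 + i) x)"
          by (induction n2) auto
        then show ?thesis by (simp add: a_def b_def z_def)
      qed
      then have "AE x in M. a x + b x = 0" using c by simp
      from indep[OF ab this] have "AE x in M. a x = 0" "AE x in M. b x = 0" by auto
      then have "\<forall>i<n1. c i = 0" and c2: "\<forall>i<n2. c (n1 + i) = 0"
        using ui vi unfolding a_def b_def by auto
      moreover have "c i = 0" if "\<not> i < n1" "i < n1 + n2" for i
        using c2 that by (metis add_diff_inverse_nat add_less_cancel_left)
      ultimately show ?thesis by blast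
    qed
    ultimately show ?thesis unfolding S_def mem_Collect_eq by blast
  qed
  show ?thesis
  proof (cases "ae_dim M W")
    case (enat D)
    have le: "n1 + n2 \<le> D" if "n1 \<in> S W1" "n2 \<in> S W2" for n1 n2
    proof -
      have "enat (n1 + n2) \<le> Sup (enat ` S W)" by (intro Sup_upper imageI key that)
      then show ?thesis using enat by (simp add: dim)
    qed
    have "S W1 \<subseteq> {..D}" "S W2 \<subseteq> {..D}" using le[OF _ zero] le[OF zero] by auto
    then have fin: "finite (S W1)" "finite (S W2)" by (auto intro: finite_subset)
    have att: "\<exists>n\<in>X. Sup (enat ` X) = enat n" if "finite X" "0 \<in> X" for X
    proof -
      have ne: "enat ` X \<noteq> {}" using that by auto
      have "Sup (enat ` X) = Max (enat ` X)" using that ne by (simp add: Sup_enat_def)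
      moreover have "Max (enat ` X) \<in> enat ` X" using that ne by (intro Max_in) auto
      ultimately show ?thesis by auto
    qed
    obtain n1 n2 where "n1 \<in> S W1" "ae_dim M W1 = enat n1" "n2 \<in> S W2" "ae_dim M W2 = enat n2"
      using att[OF fin(1) zero] att[OF fin(2) zero] by (auto simp: dim)
    then show ?thesis using le enat by simp
  qed simp
qed

lemma form_operator_cong:
  assumes "form_dom a = form_dom b" "\<And>u v. u \<in> form_dom b \<Longrightarrow> v \<in> form_dom b \<Longrightarrow> sesq a u v = sesq b u v"
  shows "form_operator M a = form_operator M b"
  unfolding form_operator_def using assms by auto

text \<open>On the sum of the eigenspaces for finitely many eigenvalues \<open>l < - \<tau>\<close>, which are orthogonal in \<open>L\<^sup>2\<close>, the form of \<open>T\<^sub>A - V\<close> at \<open>\<Sum> v\<^sub>l\<close>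
is \<open>\<Sum> l \<parallel>v\<^sub>l\<parallel>\<^sup>2\<close>, so that this sum is admissible in the variational principle.\<close>

lemma eigenvalues_below_le:
  assumes nn: "nonneg_form M tA" and V: "weight M V" and \<tau>: "0 \<le> \<tau>"
    and dom: "form_dom tA \<subseteq> L2w M V"
  shows "eigenvalues_below M (form_operator M (form_minus M tA V)) (- \<tau>)
    \<le> ennreal_of_enat (variational_count M tA V \<tau>)"
proof -
  interpret V: weight M V by fact
  interpret A: nn_form M tA using nn by unfold_locales
  have fd: "form_dom (form_minus M tA V) = form_dom tA"
    using dom V.L2w_int by (auto simp: form_minus_def)
  define E where "E = eigenspace (form_operator M (form_minus M tA V))"
  have E_iff: "u \<in> E l \<longleftrightarrow> u \<in> form_dom tA \<and>
      (\<forall>v\<in>form_dom tA. sesq tA v u - wip M V v u = complex_of_real l * wip M one v u)" for u l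
  proof -
    have "(\<lambda>x. complex_of_real l * u x) \<in> Lp_space M 2" if "u \<in> form_dom tA"
      unfolding Lp_space_2 by (rule A.W1.L2w_scale[OF A.dom_L2[OF that]])
    moreover have "sesq (form_minus M tA V) v u = sesq tA v u - wip M V v u" for u v
      by (simp add: form_minus_def wip_def)
    ultimately show ?thesis
      unfolding E_def eigenspace_def form_operator_def fd L2_inner_eq_wip
      by (auto simp: A.W1.wip_scale_right)
  qed
  have E_dom: "u \<in> form_dom tA" if "u \<in> E l" for u l using that by (simp add: E_iff)
  have E_eq: "sesq tA v u - wip M V v u = complex_of_real l * wip M one v u"
    if "u \<in> E l" "v \<in> form_dom tA" for u v l using that by (simp add: E_iff)
  have E_sub: "fun_subspace (E l)" for l
    unfolding fun_subspace_def
  proof (intro conjI ballI allI)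
    show "(\<lambda>x. 0) \<in> E l"
      unfolding E_iff using A.dom_zero A.sesq_scale[of _ "\<lambda>x. 0" 0] by (simp add: wip_def)
    fix u assume u: "u \<in> E l"
    show "(\<lambda>x. u x + v x) \<in> E l" if v: "v \<in> E l" for v
      unfolding E_iff
    proof (intro conjI ballI)
      show "(\<lambda>x. u x + v x) \<in> form_dom tA" by (rule A.dom_add[OF E_dom[OF u] E_dom[OF v]])
      fix z assume z: "z \<in> form_dom tA"
      have L: "z \<in> L2w M V" "u \<in> L2w M V" "v \<in> L2w M V" using z E_dom[OF u] E_dom[OF v] dom by auto
      show "sesq tA z (\<lambda>x. u x + v x) - wip M V z (\<lambda>x. u x + v x)
          = complex_of_real l * wip M one z (\<lambda>x. u x + v x)"
        unfolding A.sesq_add[OF z E_dom[OF u] E_dom[OF v]] V.wip_add_right[OF L]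
          A.W1.wip_add_right[OF z[THEN A.dom_L2] A.dom_L2[OF E_dom[OF u]] A.dom_L2[OF E_dom[OF v]]]
        using E_eq[OF u z] E_eq[OF v z] by (simp add: algebra_simps)
    qed
    show "(\<lambda>x. c * u x) \<in> E l" for c
      unfolding E_iff
    proof (intro conjI ballI)
      show "(\<lambda>x. c * u x) \<in> form_dom tA" by (rule A.dom_scale[OF E_dom[OF u]])
      fix z assume z: "z \<in> form_dom tA"
      have "c * (sesq tA z u - wip M V z u) = c * (complex_of_real l * wip M one z u)"
        by (simp only: E_eq[OF u z])
      then show "sesq tA z (\<lambda>x. c * u x) - wip M V z (\<lambda>x. c * u x)
          = complex_of_real l * wip M one z (\<lambda>x. c * u x)"
        unfolding A.sesq_scale[OF z E_dom[OF u]] V.wip_scale_right A.W1.wip_scale_right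
        by (simp add: right_diff_distrib mult_ac)
    qed
  qed
  have orth: "wip M one v u = 0" if u: "u \<in> E l" and v: "v \<in> E l'" and ne: "l \<noteq> l'" for u v l l'
  proof -
    have "complex_of_real l * wip M one v u = sesq tA v u - wip M V v u"
      by (rule E_eq[OF u E_dom[OF v], symmetric])
    also have "\<dots> = cnj (sesq tA u v - wip M V u v)"
      using A.sesq_cnj[OF E_dom[OF u] E_dom[OF v]] V.wip_cnj[of v u] by simp
    also have "\<dots> = complex_of_real l' * cnj (wip M one u v)"
      unfolding E_eq[OF v E_dom[OF u]] by simp
    also have "cnj (wip M one u v) = wip M one v u" by (rule A.W1.wip_cnj[symmetric])
    finally have "complex_of_real (l - l') * wip M one v u = 0" by (simp add: algebra_simps)
    then show ?thesis using ne by simp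
  qed
  \<comment> \<open>the sum of the eigenspaces for the numbers in \<open>F\<close>; the factor 1 lets the rules for linear combinations apply\<close>
  define WF where "WF = (\<lambda>F. {u. \<exists>v. (\<forall>l\<in>F. v l \<in> E l) \<and> u = (\<lambda>x. \<Sum>l\<in>F. 1 * v l x)})"
  have WF_E: "E l \<subseteq> WF F" if "l \<in> F" "finite F" for l F
  proof
    fix u assume u: "u \<in> E l"
    define v where "v = (\<lambda>k. if k = l then u else (\<lambda>x. 0))"
    have "\<forall>k\<in>F. v k \<in> E k" using u fun_subspace_zero[OF E_sub] by (simp add: v_def)
    moreover have "(\<Sum>k\<in>F. 1 * v k x) = u x" for x
    proof -
      have "(\<Sum>k\<in>F. 1 * v k x) = (\<Sum>k\<in>F. if k = l then u x else 0)"
        by (intro sum.cong refl) (simp add: v_def)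
      then show ?thesis using that by simp
    qed
    then have "u = (\<lambda>x. \<Sum>k\<in>F. 1 * v k x)" by simp
    ultimately show "u \<in> WF F" unfolding WF_def mem_Collect_eq by blast
  qed
  have WF_mono: "WF F \<subseteq> WF (insert l F)" if "finite F" "l \<notin> F" for l F
  proof
    fix u assume "u \<in> WF F"
    then obtain v where v: "\<forall>k\<in>F. v k \<in> E k" and u: "u = (\<lambda>x. \<Sum>k\<in>F. 1 * v k x)"
      unfolding WF_def mem_Collect_eq by (elim exE conjE)
    define v' where "v' = v(l := (\<lambda>x. 0))"
    have "\<forall>k\<in>insert l F. v' k \<in> E k"
      using v fun_subspace_zero[OF E_sub] that by (auto simp: v'_def)
    moreover have "(\<Sum>k\<in>insert l F. 1 * v' k x) = (\<Sum>k\<in>F. 1 * v k x)" for x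
    proof -
      have "(\<Sum>k\<in>F. 1 * v' k x) = (\<Sum>k\<in>F. 1 * v k x)"
        using that by (intro sum.cong refl) (auto simp: v'_def)
      then show ?thesis using that by (simp add: v'_def)
    qed
    then have "u = (\<lambda>x. \<Sum>k\<in>insert l F. 1 * v' k x)" by (simp add: u)
    ultimately show "u \<in> WF (insert l F)" unfolding WF_def mem_Collect_eq by blast
  qed
  have WF_sub: "fun_subspace (WF F)" for F
    unfolding fun_subspace_def
  proof (intro conjI ballI allI)
    show "(\<lambda>x. 0) \<in> WF F"
      unfolding WF_def mem_Collect_eq
      by (intro exI[of _ "\<lambda>l x. 0"]) (simp add: fun_subspace_zero[OF E_sub])
    fix u assume "u \<in> WF F"
    then obtain v where v: "\<forall>k\<in>F. v k \<in> E k" and u: "u = (\<lambda>x. \<Sum>k\<in>F. 1 * v k x)"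
      unfolding WF_def mem_Collect_eq by (elim exE conjE)
    show "(\<lambda>x. c * u x) \<in> WF F" for c
      unfolding WF_def mem_Collect_eq u
      by (intro exI[of _ "\<lambda>l x. c * v l x"]) (use v in \<open>simp add: fun_subspace_scale[OF E_sub] sum_distrib_left\<close>)
    fix u' assume "u' \<in> WF F"
    then obtain v' where v': "\<forall>k\<in>F. v' k \<in> E k" and u': "u' = (\<lambda>x. \<Sum>k\<in>F. 1 * v' k x)"
      unfolding WF_def mem_Collect_eq by (elim exE conjE)
    show "(\<lambda>x. u x + u' x) \<in> WF F"
      unfolding WF_def mem_Collect_eq u u'
      by (intro exI[of _ "\<lambda>l x. v l x + v' l x"]) (use v v' in \<open>simp add: fun_subspace_add[OF E_sub] sum.distrib\<close>)
  qed
  have WF_dom: "WF F \<subseteq> form_dom tA" for F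
  proof
    fix u assume "u \<in> WF F"
    then obtain v where v: "\<forall>k\<in>F. v k \<in> E k" and u: "u = (\<lambda>x. \<Sum>k\<in>F. 1 * v k x)"
      unfolding WF_def mem_Collect_eq by (elim exE conjE)
    show "u \<in> form_dom tA" unfolding u by (rule A.dom_sum) (use v E_dom in blast)
  qed
  have WF_orth: "wip M one b a = 0" if a: "a \<in> WF F" and b: "b \<in> E l" and l: "l \<notin> F" for a b F l
  proof -
    obtain v where v: "\<forall>k\<in>F. v k \<in> E k" and u: "a = (\<lambda>x. \<Sum>k\<in>F. 1 * v k x)"
      using a unfolding WF_def mem_Collect_eq by (elim exE conjE)
    have "wip M one b a = (\<Sum>k\<in>F. 1 * wip M one b (v k))"
      unfolding u by (rule A.W1.wip_sum_right[OF A.dom_L2[OF E_dom[OF b]]]) (use v E_dom A.dom_L2 in blast)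
    also have "\<dots> = 0" using v b l by (intro sum.neutral) (auto intro: orth)
    finally show ?thesis .
  qed
  have dim_sum: "(\<Sum>l\<in>F. ae_dim M (E l)) \<le> ae_dim M (WF F)" if "finite F" for F
    using that
  proof (induction F)
    case (insert l F)
    have "ae_dim M (WF F) + ae_dim M (E l) \<le> ae_dim M (WF (insert l F))"
    proof (rule ae_dim_superadditive[OF _ _ WF_sub E_sub])
      show "WF F \<subseteq> WF (insert l F)" using insert by (intro WF_mono)
      show "E l \<subseteq> WF (insert l F)" using insert by (intro WF_E) auto
      fix a b assume a: "a \<in> WF F" and b: "b \<in> E l" and ae: "AE x in M. a x + b x = 0"
      have aL: "a \<in> L2w M one" and bL: "b \<in> L2w M one"
        using a b WF_dom E_dom A.dom_L2 by blast+
      have meas: "b \<in> borel_measurable M" "(\<lambda>x. a x + b x) \<in> borel_measurable M"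
        using A.W1.L2w_meas[OF bL] A.W1.L2w_meas[OF A.W1.L2w_add[OF aL bL]] by auto
      have "wip M one b (\<lambda>x. a x + b x) = wip M one b (\<lambda>x. 0)"
        by (rule A.W1.wip_cong_AE[OF meas(1) meas(2) meas(1) _ _ ae]) auto
      then have "wip M one b a + wip M one b b = 0"
        unfolding A.W1.wip_add_right[OF bL aL bL] by (simp add: wip_def)
      then have "wsq M one b = 0"
        using WF_orth[OF a b insert(2)] by (simp add: A.W1.wip_self)
      then have b0: "AE x in M. b x = 0" by (rule wsq_one_eq_0_AE[OF bL])
      then have "AE x in M. a x = 0" using ae by eventually_elim simp
      with b0 show "(AE x in M. a x = 0) \<and> (AE x in M. b x = 0)" by blast
    qed
    moreover have "(\<Sum>l\<in>insert l F. ae_dim M (E l)) = (\<Sum>l\<in>F. ae_dim M (E l)) + ae_dim M (E l)"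
      using insert by (simp add: add.commute)
    ultimately show ?case using insert.IH by (metis add_right_mono order_trans)
  qed simp
  have WF_count: "ae_dim M (WF F) \<le> variational_count M tA V \<tau>" if F: "finite F" "F \<subseteq> {..<- \<tau>}" for F
    unfolding variational_count_def
  proof (rule Sup_upper, rule CollectI, rule exI[of _ "WF F"], intro conjI)
    show "ae_dim M (WF F) = ae_dim M (WF F)" ..
    show "fun_subspace (WF F)" by (rule WF_sub)
    show "WF F \<subseteq> form_dom tA" by (rule WF_dom)
    show "\<forall>u\<in>WF F. \<not> (AE x in M. u x = 0) \<longrightarrow>
          ennreal (quad tA u + \<tau> * (\<integral>x. (cmod (u x))\<^sup>2 \<partial>M)) < (\<integral>\<^sup>+x. ennreal (V x * (cmod (u x))\<^sup>2) \<partial>M)"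
    proof (intro ballI impI)
      fix u assume uW: "u \<in> WF F" and nz: "\<not> (AE x in M. u x = 0)"
      have ud: "u \<in> form_dom tA" using uW WF_dom by blast
      have uL: "u \<in> L2w M V" and uL1: "u \<in> L2w M one" using ud dom A.dom_L2 by auto
      obtain v where v: "\<forall>k\<in>F. v k \<in> E k" and u: "u = (\<lambda>x. \<Sum>k\<in>F. 1 * v k x)"
        using uW unfolding WF_def mem_Collect_eq by (elim exE conjE)
      have vd: "v k \<in> form_dom tA" if "k \<in> F" for k using v that E_dom by blast
      have vL: "v k \<in> L2w M V" "v k \<in> L2w M one" if "k \<in> F" for k using vd[OF that] dom A.dom_L2 by auto
      have uv: "wip M one u (v k) = complex_of_real (wsq M one (v k))" if k: "k \<in> F" for k
      proof -
        have "wip M one u (v k) = (\<Sum>j\<in>F. cnj 1 * wip M one (v j) (v k))"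
          unfolding u by (rule A.W1.wip_sum_left[OF vL(2)[OF k] vL(2)])
        also have "\<dots> = (\<Sum>j\<in>F. if j = k then wip M one (v k) (v k) else 0)"
          using v k by (intro sum.cong refl) (auto intro: orth)
        also have "\<dots> = wip M one (v k) (v k)" using k F(1) by simp
        finally show ?thesis by (simp add: A.W1.wip_self)
      qed
      have "complex_of_real (wsq M one u) = (\<Sum>k\<in>F. 1 * wip M one u (v k))"
        unfolding A.W1.wip_self[symmetric] by (subst (2) u) (rule A.W1.wip_sum_right[OF uL1 vL(2)])
      then have n2: "wsq M one u = (\<Sum>k\<in>F. wsq M one (v k))"
        by (simp add: uv flip: of_real_sum)
      have "sesq tA u u - wip M V u u = (\<Sum>k\<in>F. 1 * sesq tA u (v k)) - (\<Sum>k\<in>F. 1 * wip M V u (v k))"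
      proof -
        have "sesq tA u u = (\<Sum>k\<in>F. 1 * sesq tA u (v k))"
          by (subst (2) u) (rule A.sesq_sum[OF ud vd])
        moreover have "wip M V u u = (\<Sum>k\<in>F. 1 * wip M V u (v k))"
          by (subst (2) u) (rule V.wip_sum_right[OF uL vL(1)])
        ultimately show ?thesis by simp
      qed
      also have "\<dots> = (\<Sum>k\<in>F. sesq tA u (v k) - wip M V u (v k))" by (simp add: sum_subtractf)
      also have "\<dots> = (\<Sum>k\<in>F. complex_of_real (k * wsq M one (v k)))"
      proof (intro sum.cong refl)
        fix k assume k: "k \<in> F"
        have "sesq tA u (v k) - wip M V u (v k) = complex_of_real k * wip M one u (v k)"
          by (rule E_eq[OF _ ud]) (use v k in blast)
        then show "sesq tA u (v k) - wip M V u (v k) = complex_of_real (k * wsq M one (v k))"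
          unfolding uv[OF k] of_real_mult .
      qed
      finally have "Re (sesq tA u u - wip M V u u) = (\<Sum>k\<in>F. k * wsq M one (v k))" by simp
      then have q: "quad tA u - wsq M V u = (\<Sum>k\<in>F. k * wsq M one (v k))"
        by (simp add: quad_def V.wip_self)
      have "0 < (\<Sum>k\<in>F. (- \<tau> - k) * wsq M one (v k))"
      proof -
        have "wsq M one u \<noteq> 0" using nz wsq_one_eq_0_AE[OF uL1] by blast
        then obtain k where k: "k \<in> F" "wsq M one (v k) \<noteq> 0"
          unfolding n2 by (meson sum.neutral)
        have "0 < (- \<tau> - k) * wsq M one (v k)"
          using k F(2) A.W1.wsq_nonneg[of "v k"] by (intro mult_pos_pos) auto
        then show ?thesis
          by (intro sum_pos2[OF F(1) k(1)]) (use F(2) A.W1.wsq_nonneg in \<open>auto intro!: mult_nonneg_nonneg\<close>)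
      qed
      also have "(\<Sum>k\<in>F. (- \<tau> - k) * wsq M one (v k)) = - \<tau> * wsq M one u - (quad tA u - wsq M V u)"
        unfolding q n2 by (simp add: left_diff_distrib sum_subtractf sum_distrib_left)
      finally have lt: "quad tA u + \<tau> * wsq M one u < wsq M V u" by simp
      show "ennreal (quad tA u + \<tau> * (\<integral>x. (cmod (u x))\<^sup>2 \<partial>M)) < (\<integral>\<^sup>+x. ennreal (V x * (cmod (u x))\<^sup>2) \<partial>M)"
        unfolding integral_cmod_sq nn_integral_wsq[OF V uL]
        using lt A.quad_nonneg[OF ud] mult_nonneg_nonneg[OF \<tau> A.W1.wsq_nonneg[of u]]
        by (subst ennreal_less_iff) auto
    qed
  qed
  show ?thesis
    unfolding eigenvalues_below_def E_def[symmetric]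
  proof (rule infsum_le_finite_sums)
    fix F assume F: "finite F" "F \<subseteq> {..<- \<tau>}"
    have "(\<Sum>l\<in>F. ennreal_of_enat (ae_dim M (E l))) = ennreal_of_enat (\<Sum>l\<in>F. ae_dim M (E l))"
      by (rule sum_ennreal_of_enat)
    also have "\<dots> \<le> ennreal_of_enat (variational_count M tA V \<tau>)"
      using order_trans[OF dim_sum[OF F(1)] WF_count[OF F]] by simp
    finally show "(\<Sum>l\<in>F. ennreal_of_enat (ae_dim M (E l))) \<le> ennreal_of_enat (variational_count M tA V \<tau>)" .
  qed simp
qed

section \<open>The bound for eigenvalue counts\<close>

text \<open>Both parts of the theorem are instances: \<open>\<tau> = 0\<close> in the first one, and in the second one the Sobolev inequality for \<open>t + \<tau> \<parallel>\<cdot>\<parallel>\<^sup>2\<close> follows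
from the interpolation inequality. The negative values of \<open>V\<close>, on a null set, are removed first.\<close>

lemma clr_bound:
  fixes M :: "'a measure" and t tA :: "'a form" and V :: "'a \<Rightarrow> real"
  assumes nn: "nonneg_form M t" and cl: "closed_form M t"
    and nnA: "nonneg_form M tA" and clA: "closed_form M tA"
    and dia: "diamagnetic M t tA" and bd: "beurling_deny M t \<kappa>"
    and \<kappa>: "1 < \<kappa>" and q: "q = 2 * \<kappa> / (\<kappa> - 1)" and S: "0 < S" and \<tau>: "0 \<le> \<tau>"
    and sob_q: "\<And>u. u \<in> form_dom t \<Longrightarrow> u \<in> Lp_space M q"
    and sob: "\<And>u. u \<in> form_dom t \<Longrightarrow>
        S * (\<integral>x. cmod (u x) powr q \<partial>M) powr (2 / q) \<le> quad t u + \<tau> * wsq M one u"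
    and V: "V \<in> Lp_space M \<kappa>" "AE x in M. 0 \<le> V x"
  defines "B \<equiv> exp (\<kappa> - 1) * S powr (- \<kappa>) * (\<integral>x. V x powr \<kappa> \<partial>M)"
  shows "eigenvalues_below M (form_operator M (form_minus M tA V)) (- \<tau>) \<le> ennreal B"
    and "ennreal_of_enat (variational_count M tA V \<tau>) \<le> ennreal B"
proof -
  interpret T: nn_form M t using nn by unfold_locales
  interpret A: nn_form M tA using nnA by unfold_locales
  define Vp where "Vp = (\<lambda>x. max (V x) 0)"
  have Vm[measurable]: "V \<in> borel_measurable M" using V by (simp add: Lp_space_def)
  have Vpm[measurable]: "Vp \<in> borel_measurable M" unfolding Vp_def by measurable
  have ae: "AE x in M. Vp x = V x" using V(2) by eventually_elim (simp add: Vp_def)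
  have W: "weight M Vp" by unfold_locales (auto simp: Vp_def)
  have absV: "integrable M (\<lambda>x. norm (V x) powr \<kappa>)" using V(1) by (simp add: Lp_space_def)
  have "AE x in M. norm (V x) powr \<kappa> = Vp x powr \<kappa>" using ae V(2) by eventually_elim simp
  then have Vp_int: "integrable M (\<lambda>x. Vp x powr \<kappa>)"
    using absV by (subst integrable_cong_AE[of _ M "\<lambda>x. norm (V x) powr \<kappa>"]) auto
  have Vp_eq: "(\<integral>x. Vp x powr \<kappa> \<partial>M) = (\<integral>x. V x powr \<kappa> \<partial>M)"
  proof (rule integral_cong_AE)
    show "AE x in M. Vp x powr \<kappa> = V x powr \<kappa>" using ae by eventually_elim simp
  qed measurable
  have bd2: "(\<lambda>x. complex_of_real \<bar>u x\<bar>) \<in> form_dom t \<and>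
        quad t (\<lambda>x. complex_of_real \<bar>u x\<bar>) \<le> quad t (\<lambda>x. complex_of_real (u x))"
    if "(\<lambda>x. complex_of_real (u x)) \<in> form_dom t" for u :: "'a \<Rightarrow> real"
    using bd[unfolded beurling_deny_def, THEN conjunct2, THEN conjunct1] that by blast
  have setting: "clr_setting M t tA Vp \<kappa> q S \<delta>" if \<delta>: "0 < \<delta>" "\<tau> \<le> \<delta>" for \<delta>
  proof -
    interpret weight M Vp by fact
    show ?thesis
    proof unfold_locales
      fix u assume u: "u \<in> form_dom t"
      have "\<tau> * wsq M one u \<le> \<delta> * wsq M one u"
        using \<delta> T.W1.wsq_nonneg by (intro mult_right_mono) auto
      then show "S * (\<integral>x. cmod (u x) powr q \<partial>M) powr (2 / q) \<le> quad t u + \<delta> * wsq M one u"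
        using sob[OF u] by linarith
    qed (use cl clA dia bd2 \<kappa> q S \<delta> sob_q Vp_int in auto)
  qed
  have dom: "form_dom tA \<subseteq> L2w M Vp"
    using clr_setting.A_weighted(1)[OF setting[of "\<tau> + 1"]] \<tau> by auto
  have Bn: "0 \<le> B" unfolding B_def Vp_eq[symmetric] by simp
  have "variational_count M tA Vp \<tau> \<le> enat (nat \<lfloor>B\<rfloor>)"
  proof (rule variational_count_le[OF nnA W \<tau> dom])
    fix N :: nat and w :: "nat \<Rightarrow> 'a \<Rightarrow> complex"
    assume wd: "\<And>j. j < N \<Longrightarrow> w j \<in> form_dom tA"
      and orth: "\<And>j k. j < N \<Longrightarrow> k < N \<Longrightarrow> wip M Vp (w j) (w k) = (if j = k then 1 else 0)"
      and lt: "\<And>j. j < N \<Longrightarrow> quad tA (w j) + \<tau> * wsq M one (w j) < 1"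
    define s where "s = (\<lambda>j. (1 - (quad tA (w j) + \<tau> * wsq M one (w j))) / (1 + wsq M one (w j)))"
    \<comment> \<open>the strict inequalities leave room for a positive \<open>\<delta> = \<tau> + \<eta>\<close>, also if \<open>\<tau> = 0\<close>\<close>
    define \<eta> where "\<eta> = Min (insert 1 (s ` {..<N}))"
    have w1: "0 < 1 + wsq M one (w j)" for j using T.W1.wsq_nonneg[of "w j"] by linarith
    have \<eta>: "0 < \<eta>" unfolding \<eta>_def using lt w1 by (subst Min_gr_iff) (auto simp: s_def)
    have "real N \<le> exp (\<kappa> - 1) * S powr (- \<kappa>) * clr_setting.Vk M Vp \<kappa>"
    proof (rule clr_setting.orthonormal_family_bound[OF setting[of "\<tau> + \<eta>"] wd orth])
      fix j assume j: "j < N"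
      have "\<eta> \<le> s j" unfolding \<eta>_def using j by (intro Min_le) auto
      then have "\<eta> * (1 + wsq M one (w j)) \<le> 1 - (quad tA (w j) + \<tau> * wsq M one (w j))"
        using w1[of j] by (simp add: s_def pos_le_divide_eq)
      then show "quad tA (w j) + (\<tau> + \<eta>) * wsq M one (w j) \<le> 1"
        using \<eta> by (simp add: algebra_simps)
    qed (use \<eta> \<tau> in auto)
    also have "\<dots> = B"
      using clr_setting.Vk_def[OF setting[of "\<tau> + 1"]] \<tau> by (simp add: B_def Vp_eq)
    finally show "N \<le> nat \<lfloor>B\<rfloor>" by (simp add: le_nat_floor)
  qed
  moreover have "variational_count M tA Vp \<tau> = variational_count M tA V \<tau>"
  proof -
    have "ennreal (Vp x * (cmod z)\<^sup>2) = ennreal (V x * (cmod z)\<^sup>2)" for x z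
      by (cases "0 \<le> V x") (auto simp: Vp_def max_def ennreal_neg mult_nonpos_nonneg)
    then show ?thesis by (simp add: variational_count_def)
  qed
  ultimately have vc: "variational_count M tA V \<tau> \<le> enat (nat \<lfloor>B\<rfloor>)"
    and vc_eq: "variational_count M tA Vp \<tau> = variational_count M tA V \<tau>" by simp_all
  have "ennreal_of_enat (variational_count M tA V \<tau>) \<le> ennreal_of_enat (enat (nat \<lfloor>B\<rfloor>))"
    using vc by (simp only: ennreal_of_enat_le_iff)
  also have "\<dots> = ennreal (real (nat \<lfloor>B\<rfloor>))" by (simp add: ennreal_of_nat_eq_real_of_nat)
  also have "\<dots> \<le> ennreal B" using Bn by (intro ennreal_leI) simp
  finally show v: "ennreal_of_enat (variational_count M tA V \<tau>) \<le> ennreal B" .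
  have op: "form_operator M (form_minus M tA V) = form_operator M (form_minus M tA Vp)"
  proof (rule form_operator_cong)
    have m: "u \<in> borel_measurable M" if "u \<in> form_dom tA" for u using that by (rule A.dom_meas)
    show "form_dom (form_minus M tA V) = form_dom (form_minus M tA Vp)"
    proof -
      have "integrable M (\<lambda>x. V x * (cmod (u x))\<^sup>2) \<longleftrightarrow> integrable M (\<lambda>x. Vp x * (cmod (u x))\<^sup>2)"
        if u: "u \<in> form_dom tA" for u
      proof (rule integrable_cong_AE)
        note [measurable] = m[OF u]
        show "(\<lambda>x. V x * (cmod (u x))\<^sup>2) \<in> borel_measurable M" by measurable
        show "(\<lambda>x. Vp x * (cmod (u x))\<^sup>2) \<in> borel_measurable M" by measurable
        show "AE x in M. V x * (cmod (u x))\<^sup>2 = Vp x * (cmod (u x))\<^sup>2" using ae by eventually_elim simp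
      qed
      then show ?thesis by (auto simp: form_minus_def)
    qed
    fix u v assume "u \<in> form_dom (form_minus M tA Vp)" "v \<in> form_dom (form_minus M tA Vp)"
    then have u: "u \<in> form_dom tA" and v: "v \<in> form_dom tA" by (auto simp: form_minus_def)
    have "(\<integral>x. complex_of_real (V x) * (cnj (u x) * v x) \<partial>M) = (\<integral>x. complex_of_real (Vp x) * (cnj (u x) * v x) \<partial>M)"
    proof (rule integral_cong_AE)
      note [measurable] = borel_measurable_cnj[OF m[OF u]] m[OF v]
      show "(\<lambda>x. complex_of_real (V x) * (cnj (u x) * v x)) \<in> borel_measurable M" by measurable
      show "(\<lambda>x. complex_of_real (Vp x) * (cnj (u x) * v x)) \<in> borel_measurable M" by measurable
      show "AE x in M. complex_of_real (V x) * (cnj (u x) * v x) = complex_of_real (Vp x) * (cnj (u x) * v x)"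
        using ae by eventually_elim simp
    qed
    then show "sesq (form_minus M tA V) u v = sesq (form_minus M tA Vp) u v" by (simp add: form_minus_def)
  qed
  have "eigenvalues_below M (form_operator M (form_minus M tA V)) (- \<tau>)
      \<le> ennreal_of_enat (variational_count M tA V \<tau>)"
    unfolding op vc_eq[symmetric] by (rule eigenvalues_below_le[OF nnA W \<tau> dom])
  also note v
  finally show "eigenvalues_below M (form_operator M (form_minus M tA V)) (- \<tau>) \<le> ennreal B" .
qed

text \<open>Young's inequality, with the constant that occurs in the second part of the theorem.\<close>

lemma weighted_young:
  fixes x y \<theta> \<tau> :: real
  assumes "0 \<le> x" "0 \<le> y" "0 < \<theta>" "\<theta> < 1" "0 < \<tau>"
  shows "\<theta> powr (- \<theta>) * (1 - \<theta>) powr (- 1 + \<theta>) * \<tau> powr (1 - \<theta>) * (x powr \<theta> * y powr (1 - \<theta>)) \<le> x + \<tau> * y"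
proof (cases "x = 0 \<or> y = 0")
  case True
  have "0 \<le> x + \<tau> * y" using assms by simp
  with True show ?thesis by auto
next
  case False
  then have p: "0 < x" "0 < y" using assms by auto
  have "(x / \<theta>) powr \<theta> * (\<tau> * y / (1 - \<theta>)) powr (1 - \<theta>) \<le> \<theta> * (x / \<theta>) + (1 - \<theta>) * (\<tau> * y / (1 - \<theta>))"
    using assms p by (intro Youngs_inequality_0) auto
  also have "\<dots> = x + \<tau> * y" using assms by simp
  also have "(x / \<theta>) powr \<theta> = x powr \<theta> * \<theta> powr (- \<theta>)"
    using assms p by (simp add: powr_divide powr_minus_divide)
  also have "(\<tau> * y / (1 - \<theta>)) powr (1 - \<theta>) = \<tau> powr (1 - \<theta>) * y powr (1 - \<theta>) * (1 - \<theta>) powr (- (1 - \<theta>))"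
  proof -
    have "(\<tau> * y / (1 - \<theta>)) powr (1 - \<theta>) = \<tau> powr (1 - \<theta>) * y powr (1 - \<theta>) / (1 - \<theta>) powr (1 - \<theta>)"
      using assms p by (simp add: powr_divide powr_mult)
    then show ?thesis unfolding powr_minus_divide by simp
  qed
  also have "- (1 - \<theta>) = - 1 + \<theta>" by simp
  finally show ?thesis by (simp only: mult_ac)
qed

theorem theorem2p3:
  fixes M :: "'a measure" and t tA :: "'a form"
  assumes "sigma_finite_measure M"
    and "nonneg_form M t" and "closed_form M t"
    and "nonneg_form M tA" and "closed_form M tA"
    and "diamagnetic M t tA"
  shows
    "(\<forall>(\<kappa>::real) (q::real) (S::real).
        1 < \<kappa> \<longrightarrow> q = 2 * \<kappa> / (\<kappa> - 1) \<longrightarrow> beurling_deny M t \<kappa> \<longrightarrow> 0 < S \<longrightarrow>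
        (\<forall>u\<in>form_dom t. u \<in> Lp_space M q \<and>
           quad t u \<ge> S * (\<integral>x. cmod (u x) powr q \<partial>M) powr (2 / q)) \<longrightarrow>
        (\<forall>V :: 'a \<Rightarrow> real. V \<in> Lp_space M \<kappa> \<longrightarrow> (AE x in M. 0 \<le> V x) \<longrightarrow>
           eigenvalues_below M (form_operator M (form_minus M tA V)) 0
             \<le> ennreal (exp (\<kappa> - 1) * S powr (- \<kappa>) * (\<integral>x. V x powr \<kappa> \<partial>M)) \<and>
           ennreal_of_enat (variational_count M tA V 0)
             \<le> ennreal (exp (\<kappa> - 1) * S powr (- \<kappa>) * (\<integral>x. V x powr \<kappa> \<partial>M))))
     \<and>
     (\<forall>(\<kappa>::real) (\<gamma>::real) (q::real) (\<theta>::real) (S::real).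
        0 < \<kappa> \<longrightarrow> 0 < \<gamma> \<longrightarrow> 1 < \<gamma> + \<kappa> \<longrightarrow>
        q = 2 * (\<gamma> + \<kappa>) / (\<gamma> + \<kappa> - 1) \<longrightarrow> \<theta> = \<kappa> / (\<gamma> + \<kappa>) \<longrightarrow>
        beurling_deny M t (\<gamma> + \<kappa>) \<longrightarrow> 0 < S \<longrightarrow>
        (\<forall>u\<in>form_dom t. u \<in> Lp_space M q \<and>
           quad t u powr \<theta> * Lp_norm M 2 u powr (2 * (1 - \<theta>))
             \<ge> S * (\<integral>x. cmod (u x) powr q \<partial>M) powr (2 / q)) \<longrightarrow>
        (\<forall>V :: 'a \<Rightarrow> real. V \<in> Lp_space M (\<gamma> + \<kappa>) \<longrightarrow> (AE x in M. 0 \<le> V x) \<longrightarrow>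
           (\<forall>\<tau>>0.
              eigenvalues_below M (form_operator M (form_minus M tA V)) (- \<tau>)
                \<le> ennreal (exp (\<gamma> + \<kappa> - 1)
                     * (\<theta> powr (- \<theta>) * (1 - \<theta>) powr (- 1 + \<theta>) * S) powr (- \<gamma> - \<kappa>)
                     * \<tau> powr (- \<gamma>) * (\<integral>x. V x powr (\<gamma> + \<kappa>) \<partial>M)) \<and>
              ennreal_of_enat (variational_count M tA V \<tau>)
                \<le> ennreal (exp (\<gamma> + \<kappa> - 1)
                     * (\<theta> powr (- \<theta>) * (1 - \<theta>) powr (- 1 + \<theta>) * S) powr (- \<gamma> - \<kappa>)
                     * \<tau> powr (- \<gamma>) * (\<integral>x. V x powr (\<gamma> + \<kappa>) \<partial>M)))))"
proof (intro conjI allI impI)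
  fix \<kappa> q S :: real and V :: "'a \<Rightarrow> real"
  assume \<kappa>: "1 < \<kappa>" and q: "q = 2 * \<kappa> / (\<kappa> - 1)" and bd: "beurling_deny M t \<kappa>" and S: "0 < S"
    and sob: "\<forall>u\<in>form_dom t. u \<in> Lp_space M q \<and>
           quad t u \<ge> S * (\<integral>x. cmod (u x) powr q \<partial>M) powr (2 / q)"
    and V: "V \<in> Lp_space M \<kappa>" "AE x in M. 0 \<le> V x"
  have s1: "u \<in> Lp_space M q" if "u \<in> form_dom t" for u using sob that by blast
  have s2: "S * (\<integral>x. cmod (u x) powr q \<partial>M) powr (2 / q) \<le> quad t u + 0 * wsq M one u"
    if "u \<in> form_dom t" for u using sob that by simp
  note b = clr_bound[OF assms(2-6) bd \<kappa> q S order_refl s1 s2 V]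
  show "eigenvalues_below M (form_operator M (form_minus M tA V)) 0
      \<le> ennreal (exp (\<kappa> - 1) * S powr (- \<kappa>) * (\<integral>x. V x powr \<kappa> \<partial>M))"
    using b(1) by simp
  show "ennreal_of_enat (variational_count M tA V 0)
      \<le> ennreal (exp (\<kappa> - 1) * S powr (- \<kappa>) * (\<integral>x. V x powr \<kappa> \<partial>M))"
    using b(2) by simp
next
  fix \<kappa> \<gamma> q \<theta> S :: real and V :: "'a \<Rightarrow> real" and \<tau> :: real
  assume \<kappa>: "0 < \<kappa>" and \<gamma>: "0 < \<gamma>" and gk: "1 < \<gamma> + \<kappa>"
    and q: "q = 2 * (\<gamma> + \<kappa>) / (\<gamma> + \<kappa> - 1)" and \<theta>: "\<theta> = \<kappa> / (\<gamma> + \<kappa>)"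
    and bd: "beurling_deny M t (\<gamma> + \<kappa>)" and S: "0 < S"
    and sob: "\<forall>u\<in>form_dom t. u \<in> Lp_space M q \<and>
           quad t u powr \<theta> * Lp_norm M 2 u powr (2 * (1 - \<theta>))
             \<ge> S * (\<integral>x. cmod (u x) powr q \<partial>M) powr (2 / q)"
    and V: "V \<in> Lp_space M (\<gamma> + \<kappa>)" "AE x in M. 0 \<le> V x" and \<tau>: "0 < \<tau>"
  interpret T: nn_form M t using assms(2) by unfold_locales
  have \<theta>01: "0 < \<theta>" "\<theta> < 1" using \<kappa> \<gamma> by (auto simp: \<theta> field_simps)
  define K where "K = \<theta> powr (- \<theta>) * (1 - \<theta>) powr (- 1 + \<theta>)"
  have K: "0 < K" using \<theta>01 by (simp add: K_def)
  define S' where "S' = K * \<tau> powr (1 - \<theta>) * S"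
  have S': "0 < S'" using K S \<tau> by (simp add: S'_def)
  have s1: "u \<in> Lp_space M q" if "u \<in> form_dom t" for u using sob that by blast
  have s2: "S' * (\<integral>x. cmod (u x) powr q \<partial>M) powr (2 / q) \<le> quad t u + \<tau> * wsq M one u"
    if u: "u \<in> form_dom t" for u
  proof -
    have half: "1 / 2 * (2 * (1 - \<theta>)) = 1 - \<theta>" by simp
    have lp: "Lp_norm M 2 u powr (2 * (1 - \<theta>)) = wsq M one u powr (1 - \<theta>)"
      unfolding Lp_norm_def powr_powr half by (simp add: wsq_def)
    have "S * (\<integral>x. cmod (u x) powr q \<partial>M) powr (2 / q) \<le> quad t u powr \<theta> * wsq M one u powr (1 - \<theta>)"
      using bspec[OF sob u, THEN conjunct2] unfolding lp .
    then have "K * \<tau> powr (1 - \<theta>) * (S * (\<integral>x. cmod (u x) powr q \<partial>M) powr (2 / q))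
        \<le> K * \<tau> powr (1 - \<theta>) * (quad t u powr \<theta> * wsq M one u powr (1 - \<theta>))"
      using K by (intro mult_left_mono) auto
    also have "\<dots> \<le> quad t u + \<tau> * wsq M one u"
      unfolding K_def by (rule weighted_young[OF T.quad_nonneg[OF u] T.W1.wsq_nonneg \<theta>01 \<tau>])
    finally show ?thesis by (simp only: S'_def mult.assoc)
  qed
  note b = clr_bound[OF assms(2-6) bd gk q S' less_imp_le[OF \<tau>] s1 s2 V]
  have "(1 - \<theta>) * (- (\<gamma> + \<kappa>)) = - \<gamma>" using \<kappa> \<gamma> by (simp add: \<theta> field_simps)
  then have "(\<tau> powr (1 - \<theta>)) powr (- (\<gamma> + \<kappa>)) = \<tau> powr (- \<gamma>)" by (simp only: powr_powr)
  moreover have "S' powr (- (\<gamma> + \<kappa>)) = (K * S) powr (- (\<gamma> + \<kappa>)) * (\<tau> powr (1 - \<theta>)) powr (- (\<gamma> + \<kappa>))"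
    using K S by (simp only: S'_def powr_mult mult_ac)
  moreover have "- (\<gamma> + \<kappa>) = - \<gamma> - \<kappa>" by simp
  ultimately have c: "exp (\<gamma> + \<kappa> - 1) * S' powr (- (\<gamma> + \<kappa>)) * (\<integral>x. V x powr (\<gamma> + \<kappa>) \<partial>M)
      = exp (\<gamma> + \<kappa> - 1) * (\<theta> powr (- \<theta>) * (1 - \<theta>) powr (- 1 + \<theta>) * S) powr (- \<gamma> - \<kappa>)
                     * \<tau> powr (- \<gamma>) * (\<integral>x. V x powr (\<gamma> + \<kappa>) \<partial>M)"
    by (simp only: K_def mult.assoc)
  show "eigenvalues_below M (form_operator M (form_minus M tA V)) (- \<tau>)
      \<le> ennreal (exp (\<gamma> + \<kappa> - 1) * (\<theta> powr (- \<theta>) * (1 - \<theta>) powr (- 1 + \<theta>) * S) powr (- \<gamma> - \<kappa>)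
                     * \<tau> powr (- \<gamma>) * (\<integral>x. V x powr (\<gamma> + \<kappa>) \<partial>M))"
    using b(1) unfolding c .
  show "ennreal_of_enat (variational_count M tA V \<tau>)
      \<le> ennreal (exp (\<gamma> + \<kappa> - 1) * (\<theta> powr (- \<theta>) * (1 - \<theta>) powr (- 1 + \<theta>) * S) powr (- \<gamma> - \<kappa>)
                     * \<tau> powr (- \<gamma>) * (\<integral>x. V x powr (\<gamma> + \<kappa>) \<partial>M))"
    using b(2) unfolding c .
qed

end
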